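(* For every integer $n\ge 2$, the map $F_n:\mathbb{R}^2\to\mathbb{R}^2$ (constructed in the context) has rotation number $\frac1n$.
   Context: Construction of $F_n$. Fix $1<k<\frac{2}{\sqrt3}$ and let $$F_4(x,y)=\left(-\frac{ky^3}{1+x^2+y^2},\ \frac{kx^3}{1+x^2+y^2}\right).$$ For $n\ge2$ let $R_n$ be the rotation of $\mathbb{R}^2$ by $2\pi/n$ around the origin, let $S_{1,n}=\{(r\cos\theta,r\sin\theta): r>0,\ 0<\theta<2\pi/n\}$, and let $S_{j,n}=R_n(S_{j-1,n})$ for $j=2,\dots,n$; bars denote closures. Let $h_n(r\cos\theta,r\sin\theta)=\left(r\cos\frac{4\theta}{n},r\sin\frac{4\theta}{n}\right)$ for $r\ge0$, $0\le\theta<2\pi$; it maps $\overline{S_{1,4}}$ bijectively onto $\overline{S_{1,n}}$ and $\overline{S_{2,4}}$ onto $\overline{S_{2,n}}$, and $h_n^{-1}(r\cos\theta,r\sin\theta)=\left(r\cos\frac{n\theta}{4},r\sin\frac{n\theta}{4}\right)$ denotes the inverse $\overline{S_{1,n}}\to\overline{S_{1,4}}$. Since $F_4(\overline{S_{1,4}})=\overline{S_{2,4}}$, define $F_n=h_n\circ F_4\circ h_n^{-1}:\overline{S_{1,n}}\to\overline{S_{2,n}}$ and extend it to $\mathbb{R}^2$ by $\mathbb{Z}_n$-equivariance, i.e. recursively by $F_n=R_n\circ F_n\circ R_n^{-1}$ on $\overline{S_{j+1,n}}$, $j=1,\dots,n-1$. The map $F_n$ is an orientation preserving homeomorphism of $\mathbb{R}^2$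 for which the origin is an asymptotically stable fixed point. Rotation number. Let $f$ be an orientation preserving homeomorphism of $\mathbb{R}^2$ with $0$ an asymptotically stable fixed point whose basin of attraction $U$ is a proper subset of $\mathbb{R}^2$. Then $U$ is a non-empty, proper, simply connected open set with $f(U)=U$. Regard $U$ as a subset of $\mathbb{S}^2=\mathbb{R}^2\cup\{\infty\}$. Carathéodory's compactification adds to $U$ the space $\mathbb{P}$ of prime ends of $U$; via an (orientation preserving) Riemann map from $U$ onto the open unit disk, $U\cup\mathbb{P}$ is homeomorphic to the closed unit disk and $\mathbb{P}$ to the unit circle $\mathbb{S}^1$. The map $f$ induces an orientation preserving homeomorphism $\tilde f$ of $\mathbb{P}\cong\mathbb{S}^1$. The rotation number of $f$ is defined to be the (Poincaré) rotation number of $\tilde f$, an element of $\mathbb{R}/\mathbb{Z}$. *)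

theory Defs
  imports "HOL-Complex_Analysis.Complex_Analysis"
begin

text \<open>The plane is identified with the type of complex numbers.\<close>

section \<open>The maps \<open>F\<^sub>n\<close>\<close>

definition F4 :: "real \<Rightarrow> complex \<Rightarrow> complex" where
  "F4 k z = (let x = Re z; y = Im z in
     Complex (- (k * y ^ 3) / (1 + x ^ 2 + y ^ 2)) (k * x ^ 3 / (1 + x ^ 2 + y ^ 2)))"

definition rot :: "nat \<Rightarrow> complex \<Rightarrow> complex" where
  "rot n z = cis (2 * pi / real n) * z"

definition rot_inv :: "nat \<Rightarrow> complex \<Rightarrow> complex" where
  "rot_inv n z = cis (- (2 * pi / real n)) * z"

text \<open>Sectors are numbered from \<open>0\<close>: \<open>sector n j\<close> is \<open>S\<^bsub>j+1,n\<^esub>\<close>.\<close>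

primrec sector :: "nat \<Rightarrow> nat \<Rightarrow> complex set" where
  "sector n 0 = {rcis r \<theta> | r \<theta>. 0 < r \<and> 0 < \<theta> \<and> \<theta> < 2 * pi / real n}"
| "sector n (Suc j) = rot n ` sector n j"

definition h :: "nat \<Rightarrow> complex \<Rightarrow> complex" where
  "h n z = rcis (cmod z) (4 * Arg2pi z / real n)"

text \<open>Only used on the closure of \<open>sector n 0\<close>, where it is the inverse of \<open>h n\<close>
  restricted to the closure of \<open>sector 4 0\<close>.\<close>

definition h_inv :: "nat \<Rightarrow> complex \<Rightarrow> complex" where
  "h_inv n z = rcis (cmod z) (real n * Arg2pi z / 4)"

text \<open>\<open>F_sector k n j\<close> is the formula for \<open>F\<^sub>n\<close> on the closure of \<open>sector n j\<close>. For \<open>n \<ge> 2\<close> the closed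
  sectors with \<open>j < n\<close> cover the plane, and the formulas agree where they overlap, so that the
  choice of the least index in \<open>F\<close> is immaterial.\<close>

primrec F_sector :: "real \<Rightarrow> nat \<Rightarrow> nat \<Rightarrow> complex \<Rightarrow> complex" where
  "F_sector k n 0 = h n \<circ> F4 k \<circ> h_inv n"
| "F_sector k n (Suc j) = rot n \<circ> F_sector k n j \<circ> rot_inv n"

definition F :: "real \<Rightarrow> nat \<Rightarrow> complex \<Rightarrow> complex" where
  "F k n z = F_sector k n (LEAST j. z \<in> closure (sector n j)) z"


section \<open>Prime ends\<close>

text \<open>In this section \<open>V\<close> is meant to be a relatively open subset of the unit sphere, so that
  \<open>closure V - V\<close> is its boundary in the sphere. The end points of a crosscut may
  coincide.\<close>

definition crosscut :: "'a::metric_space set \<Rightarrow> 'a set \<Rightarrow> bool" where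
  "crosscut V A \<longleftrightarrow> (\<exists>g. simple_path g \<and> A = g ` {0<..<1} \<and> A \<subseteq> V \<and>
     pathstart g \<in> closure V - V \<and> pathfinish g \<in> closure V - V)"

definition crosscut_nbhd :: "'a::metric_space set \<Rightarrow> 'a set \<Rightarrow> 'a set \<Rightarrow> bool" where
  "crosscut_nbhd V A N \<longleftrightarrow> crosscut V A \<and> N \<in> components (V - A)"

definition fundamental_chains :: "'a::metric_space set \<Rightarrow> (nat \<Rightarrow> 'a set) set" where
  "fundamental_chains V = {N. (\<forall>j. N (Suc j) \<subseteq> N j) \<and>
     (\<exists>A. (\<forall>j. crosscut_nbhd V (A j) (N j)) \<and>
          (\<forall>i j. i \<noteq> j \<longrightarrow> closure (A i) \<inter> closure (A j) = {}) \<and>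
          (\<lambda>j. diameter (A j)) \<longlonglongrightarrow> 0)}"

definition chain_equiv ::
  "'a::metric_space set \<Rightarrow> ((nat \<Rightarrow> 'a set) \<times> (nat \<Rightarrow> 'a set)) set" where
  "chain_equiv V = {(N, M). N \<in> fundamental_chains V \<and> M \<in> fundamental_chains V \<and>
     (\<forall>j. \<exists>i. M i \<subseteq> N j) \<and> (\<forall>j. \<exists>i. N i \<subseteq> M j)}"

type_synonym 'a prime_end = "(nat \<Rightarrow> 'a set) set"

definition prime_ends :: "'a::metric_space set \<Rightarrow> 'a prime_end set" where
  "prime_ends V = fundamental_chains V // chain_equiv V"

text \<open>The Caratheodory compactification is the disjoint union of \<open>V\<close> and the set of prime ends of
  \<open>V\<close>. Basic open sets are the relatively open subsets of \<open>V\<close> and, for each crosscut neighbourhood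
  \<open>N\<close>, the set \<open>N\<close> together with the prime ends represented by chains that enter \<open>N\<close>.\<close>

definition prime_end_nbhd ::
  "'a::metric_space set \<Rightarrow> 'a set \<Rightarrow> ('a + 'a prime_end) set" where
  "prime_end_nbhd V N = Inl ` N \<union> Inr ` {E \<in> prime_ends V. \<exists>M\<in>E. \<exists>j. M j \<subseteq> N}"

definition caratheodory_compactification ::
  "'a::metric_space set \<Rightarrow> ('a + 'a prime_end) topology" where
  "caratheodory_compactification V = topology_generated_by
     ({Inl ` W | W. openin (top_of_set V) W} \<union>
      {prime_end_nbhd V N | N. \<exists>A. crosscut_nbhd V A N})"

definition prime_end_map :: "('a \<Rightarrow> 'a) \<Rightarrow> 'a prime_end \<Rightarrow> 'a prime_end" where
  "prime_end_map f E = (\<lambda>N j. f ` N j) ` E"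


section \<open>Rotation numbers\<close>

definition circle_lift :: "(complex \<Rightarrow> complex) \<Rightarrow> (real \<Rightarrow> real) \<Rightarrow> bool" where
  "circle_lift g G \<longleftrightarrow> continuous_on UNIV G \<and> strict_mono G \<and> (\<forall>t. G (t + 1) = G t + 1) \<and>
     (\<forall>t. g (cis (2 * pi * t)) = cis (2 * pi * G t))"

text \<open>Rotation numbers are elements of \<open>\<real>/\<int>\<close>; here \<open>\<rho>\<close> is any real representative. The existence of a
  lift says that \<open>g\<close> is an orientation preserving homeomorphism of the unit circle.\<close>

definition has_poincare_rotation_number :: "(complex \<Rightarrow> complex) \<Rightarrow> real \<Rightarrow> bool" where
  "has_poincare_rotation_number g \<rho> \<longleftrightarrow> (\<exists>G \<tau>. circle_lift g G \<and>
     (\<forall>t. (\<lambda>m. ((G ^^ m) t - t) / real m) \<longlonglongrightarrow> \<tau>) \<and> \<tau> - \<rho> \<in> \<int>)"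

definition basin :: "(complex \<Rightarrow> complex) \<Rightarrow> complex set" where
  "basin f = {z. (\<lambda>m. (f ^^ m) z) \<longlonglongrightarrow> 0}"

text \<open>Inverse stereographic projection, embedding the plane into its one-point compactification,
  the unit sphere, with the pole \<open>(0, 1)\<close> as the point at infinity.\<close>

definition to_sphere :: "complex \<Rightarrow> complex \<times> real" where
  "to_sphere z = ((2 / (1 + (cmod z)\<^sup>2)) *\<^sub>R z, ((cmod z)\<^sup>2 - 1) / ((cmod z)\<^sup>2 + 1))"

definition sphere_map :: "(complex \<Rightarrow> complex) \<Rightarrow> complex \<times> real \<Rightarrow> complex \<times> real" where
  "sphere_map f = to_sphere \<circ> f \<circ> inv to_sphere"

text \<open>A homeomorphism \<open>\<Phi>\<close> from the Caratheodory compactification of \<open>U\<close>, as a subset of the sphere,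
  onto the closed unit disk that extends a Riemann map of \<open>U\<close>. It restricts to a
  homeomorphism from the space of prime ends onto the unit circle.\<close>

definition prime_end_uniformization ::
  "complex set \<Rightarrow> (complex \<times> real + (complex \<times> real) prime_end \<Rightarrow> complex) \<Rightarrow> bool" where
  "prime_end_uniformization U \<Phi> \<longleftrightarrow>
     homeomorphic_map (caratheodory_compactification (to_sphere ` U)) (top_of_set (cball 0 1)) \<Phi> \<and>
     (\<exists>\<phi>. \<phi> holomorphic_on U \<and> bij_betw \<phi> U (ball 0 1) \<and> (\<forall>z\<in>U. \<Phi> (Inl (to_sphere z)) = \<phi> z))"

text \<open>The map \<open>g\<close> is the map induced on prime ends, transported to the unit circle by \<open>\<Phi>\<close>. The result does not
  depend on \<open>\<Phi>\<close>: two Riemann maps differ by a Moebius transformation of the disk, and the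
  Poincare rotation number is invariant under orientation preserving conjugacy.\<close>

definition has_rotation_number :: "(complex \<Rightarrow> complex) \<Rightarrow> real \<Rightarrow> bool" where
  "has_rotation_number f \<rho> \<longleftrightarrow>
     (let P = prime_ends (to_sphere ` basin f); f' = prime_end_map (sphere_map f) in
      \<exists>\<Phi> g. prime_end_uniformization (basin f) \<Phi> \<and>
        (\<forall>E\<in>P. f' E \<in> P \<and> g (\<Phi> (Inr E)) = \<Phi> (Inr (f' E))) \<and>
        has_poincare_rotation_number g \<rho>)"

end

theory Submission
  imports Defs
begin

text \<open>In polar coordinates the map \<open>F k n\<close> is a skew product. The direction of \<open>F k n z\<close> depends only on
  the direction of \<open>z\<close>, through a circle homeomorphism with lift \<open>angle n\<close>, and
  \<open>cmod (F k n z) = growth k s r * r\<close> for \<open>r = cmod z\<close>, where the direction \<open>\<theta>\<close> of \<open>z\<close> enters only through the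
  phase \<open>s = (1 + cos (n \<theta>)) / 2\<close> (\<open>F_rcis\<close>). The phase moves monotonically to \<open>1\<close> unless it is \<open>0\<close>. Hence
  on each ray with \<open>s > 0\<close> exactly one radius separates the orbits that tend to the origin from those
  that tend to infinity, and the whole ray is attracted if \<open>s = 0\<close>. Attraction and escape are
  both open conditions, so the reciprocal \<open>\<mu>\<close> of the threshold radius is continuous, and the basin is the
  star domain \<open>gauge z < 1\<close> of a continuous gauge that vanishes in exactly \<open>n\<close> directions.

  The closed disk therefore parametrizes the closure of the basin in the sphere: a boundary point of
  the disk is a direction, and the \<open>n\<close> directions with \<open>s = 0\<close> all go to the point at infinity. For any
  domain with such a parametrization the prime ends correspond to the boundary points of the disk
  (\<open>homeomorphic_map_disk_coordinate\<close>), since a crosscut of small diameter pulls back to a small set near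
  the unit circle, and such a set cannot separate a large part of the disk from another one. So
  prime ends are directions, and the induced map on them is the action \<open>D\<close> of \<open>F k n\<close> on directions
  (\<open>boundary_map\<close>). It permutes the \<open>n\<close> directions \<open>2 \<pi> j / n\<close> cyclically, as the rotation by
  \<open>2 \<pi> / n\<close> does.

  The definition asks for a homeomorphism that extends a Riemann map. Hence a Riemann map of the basin,
  seen in the coordinates of the parametrization, has to be extended to a homeomorphism \<open>K\<close> of the closed
  disk (\<open>extends_to_circle\<close>). Its boundary oscillation is controlled by Koebe's lemma: a bounded
  holomorphic function that is very small on a connected set of fixed diameter close to the unit
  circle is small at the origin. Injectivity of \<open>K\<close> on the circle holds because otherwise the Riemann map
  would be constant on a boundary arc (\<open>boundary_uniqueness\<close>).

  Finally, a Riemann map fixing the origin commutes with the rotation by \<open>2 \<pi> / n\<close>, hence so does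
  \<open>K\<close>. So \<open>K\<close> carries the periodic orbit of directions to a periodic orbit of \<open>K \<circ> D \<circ> L\<close>, where \<open>L\<close> is the inverse
  of \<open>K\<close>, on which this map is again the rotation by \<open>2 \<pi> / n\<close>. One orbit determines the rotation number of
  a lift, which is \<open>1 / n\<close> up to an integer, whether or not \<open>K\<close> preserves the orientation
  (\<open>rotation_number_conjugate\<close>).\<close>


section \<open>Crosscuts and chains\<close>

lemma in_components_iff:
  "N \<in> components S \<longleftrightarrow> N \<noteq> {} \<and> N \<subseteq> S \<and> connected N \<and>
     (\<forall>D. N \<subseteq> D \<and> D \<subseteq> S \<and> connected D \<longrightarrow> D = N)"
  unfolding in_components_maximal by (metis order_trans subset_empty)

lemma components_homeomorphic_image:
  assumes "homeomorphism S T f g" and "N \<in> components S'" and "S' \<subseteq> S"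
  shows "f ` N \<in> components (f ` S')"
proof -
  have f: "continuous_on S f" and g: "continuous_on T g" and gf: "\<And>x. x \<in> S \<Longrightarrow> g (f x) = x"
    and fS: "f ` S = T"
    using assms(1) by (auto simp: homeomorphism_def)
  have N: "N \<noteq> {}" "N \<subseteq> S'" "connected N" "\<And>D. N \<subseteq> D \<Longrightarrow> D \<subseteq> S' \<Longrightarrow> connected D \<Longrightarrow> D = N"
    using assms(2) unfolding in_components_iff by simp_all
  have cN: "connected (f ` N)"
    by (rule connected_continuous_image) (use continuous_on_subset[OF f, of N] N assms(3) in auto)
  have "D = f ` N" if D: "f ` N \<subseteq> D" "D \<subseteq> f ` S'" "connected D" for D
  proof -
    have "connected (g ` D)"
      by (rule connected_continuous_image)
        (use continuous_on_subset[OF g, of D] D fS assms(3) in blast)+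
    moreover have "g ` D \<subseteq> S'" using D gf assms(3) by force
    moreover have "N \<subseteq> g ` D"
    proof
      fix x assume "x \<in> N"
      then have "f x \<in> D" "g (f x) = x" using D N gf assms(3) by auto
      then show "x \<in> g ` D" by force
    qed
    ultimately have "g ` D = N" using N(4) by blast
    have "f (g y) = y" if y: "y \<in> D" for y
    proof -
      obtain x where "x \<in> S'" "y = f x" using y D(2) by blast
      then show ?thesis using gf[of x] assms(3) by auto
    qed
    then have "f ` g ` D = D" by (force simp: image_image)
    then show ?thesis using \<open>g ` D = N\<close> by simp
  qed
  then show ?thesis unfolding in_components_iff using N cN by blast
qed

lemma diameter_le_metric:
  fixes S :: "'a::metric_space set"
  assumes "S \<noteq> {}" and "\<And>x y. x \<in> S \<Longrightarrow> y \<in> S \<Longrightarrow> dist x y \<le> e"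
  shows "diameter S \<le> e"
  using assms by (auto simp: diameter_def intro!: cSUP_least)

lemma crosscut_path_image:
  fixes V :: "'a::metric_space set"
  assumes "simple_path g" and "g ` {0<..<1} \<subseteq> V"
    and "pathstart g \<in> closure V - V" and "pathfinish g \<in> closure V - V"
  shows "path_image g = g ` {0<..<1} \<union> {pathstart g, pathfinish g}"
    and "path_image g \<subseteq> closure V"
    and "closure (g ` {0<..<1}) = path_image g"
proof -
  have "{0..1::real} = {0<..<1} \<union> {0,1}" by auto
  then show 1: "path_image g = g ` {0<..<1} \<union> {pathstart g, pathfinish g}"
    unfolding path_image_def pathstart_def pathfinish_def by auto
  show "path_image g \<subseteq> closure V"
    using 1 assms closure_subset[of V] by auto
  have cont: "continuous_on (closure {0<..<1::real}) g"
    using assms(1) by (simp add: simple_path_def path_def)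
  have "compact (g ` {0..1})"
    using assms(1) by (intro compact_continuous_image) (auto simp: simple_path_def path_def)
  then have "closed (path_image g)"
    by (simp add: path_image_def compact_imp_closed)
  then have "closure (g ` {0<..<1}) \<subseteq> path_image g"
    using 1 by (intro closure_minimal) auto
  moreover have "path_image g \<subseteq> closure (g ` {0<..<1})"
    using image_closure_subset[OF cont closed_closure closure_subset]
    by (simp add: path_image_def)
  ultimately show "closure (g ` {0<..<1}) = path_image g" by blast
qed

text \<open>A homeomorphism of the compact closure that preserves \<open>V\<close> is uniformly continuous, so it
  preserves all the data of a fundamental chain.\<close>

locale closure_homeo =
  fixes V :: "'a::metric_space set" and f g :: "'a \<Rightarrow> 'a"
  assumes comp: "compact (closure V)"
    and hom: "homeomorphism (closure V) (closure V) f g"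
    and fV: "f ` V = V"
begin

lemma inverse_homeo: "closure_homeo V g f"
proof
  show "compact (closure V)" by (rule comp)
  show "homeomorphism (closure V) (closure V) g f" using hom homeomorphism_symD by blast
  have "g (f x) = x" if "x \<in> V" for x
    using hom closure_subset[of V] that by (auto simp: homeomorphism_def)
  then have "g ` f ` V = V" by (auto simp: image_image)
  then show "g ` V = V" using fV by simp
qed

lemma inj: "inj_on f (closure V)"
  using hom unfolding homeomorphism_def by (metis inj_onI)

lemma cont: "continuous_on (closure V) f"
  using hom by (simp add: homeomorphism_def)

lemma image_subset: "S \<subseteq> V \<Longrightarrow> f ` S \<subseteq> V"
  using fV by blast

lemma image_closure:
  assumes "S \<subseteq> V"
  shows "closure (f ` S) = f ` closure S"
proof
  have sub: "closure S \<subseteq> closure V" using assms closure_mono by blast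
  then have "compact (closure S)" using comp compact_closure closed_Int_compact
    by (metis closed_closure inf.absorb1)
  then have "compact (f ` closure S)"
    using sub cont compact_continuous_image continuous_on_subset by blast
  then show "closure (f ` S) \<subseteq> f ` closure S"
    by (intro closure_minimal) (auto simp: compact_imp_closed closure_subset image_mono)
  show "f ` closure S \<subseteq> closure (f ` S)"
    by (rule image_closure_subset[OF continuous_on_subset[OF cont sub] closed_closure closure_subset])
qed

lemma crosscut_image:
  assumes "crosscut V A"
  shows "crosscut V (f ` A)"
proof -
  obtain c where c: "simple_path c" "A = c ` {0<..<1}" "A \<subseteq> V"
     "pathstart c \<in> closure V - V" "pathfinish c \<in> closure V - V"
    using assms unfolding crosscut_def by blast
  note im = crosscut_path_image[OF c(1) c(3)[unfolded c(2)] c(4) c(5)]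
  have "simple_path (f \<circ> c)"
    using im c by (intro simple_path_continuous_image)
      (blast intro: continuous_on_subset[OF cont] inj_on_subset[OF inj])+
  moreover have "f x \<in> closure V - V" if "x \<in> closure V - V" for x
  proof -
    have "f x \<in> closure V" using hom that by (auto simp: homeomorphism_def)
    moreover have "f x \<notin> V"
    proof
      assume "f x \<in> V"
      then obtain y where "y \<in> V" "f x = f y" using fV by (metis imageE)
      then show False using inj that closure_subset[of V] by (metis DiffE inj_onD subsetD)
    qed
    ultimately show ?thesis by blast
  qed
  ultimately show ?thesis
    unfolding crosscut_def using c fV
    by (intro exI[of _ "f \<circ> c"]) (auto simp: pathstart_def pathfinish_def)
qed

lemma crosscut_nbhd_image:
  assumes "crosscut_nbhd V A N"
  shows "crosscut_nbhd V (f ` A) (f ` N)"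
proof -
  have "f ` N \<in> components (f ` (V - A))"
    using assms closure_subset[of V] unfolding crosscut_nbhd_def
    by (intro components_homeomorphic_image[OF hom]) auto
  moreover have "f ` (V - A) = V - f ` A"
  proof -
    have "A \<subseteq> V" using assms by (auto simp: crosscut_nbhd_def crosscut_def)
    then show ?thesis
      using fV inj_on_image_set_diff[of f "closure V" V A] inj closure_subset[of V] by auto
  qed
  ultimately show ?thesis
    using assms crosscut_image by (auto simp: crosscut_nbhd_def)
qed

lemma fundamental_chain_image:
  assumes "N \<in> fundamental_chains V"
  shows "(\<lambda>j. f ` N j) \<in> fundamental_chains V"
proof -
  obtain A where A: "\<And>j. N (Suc j) \<subseteq> N j" "\<And>j. crosscut_nbhd V (A j) (N j)"
     "\<And>i j. i \<noteq> j \<Longrightarrow> closure (A i) \<inter> closure (A j) = {}" "(\<lambda>j. diameter (A j)) \<longlonglongrightarrow> 0"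
    using assms unfolding fundamental_chains_def by blast
  have AV: "A j \<subseteq> V" "A j \<noteq> {}" for j
    using A(2)[of j] by (auto simp: crosscut_nbhd_def crosscut_def)
  have bdd: "bounded S" if "S \<subseteq> V" for S
    using that comp compact_imp_bounded bounded_subset closure_subset by metis
  have disj: "closure (f ` A i) \<inter> closure (f ` A j) = {}" if "i \<noteq> j" for i j
    using A(3)[OF that] AV closure_mono[OF AV(1)] inj
    by (simp add: image_closure flip: inj_on_image_Int[OF inj])
  have "(\<lambda>j. diameter (f ` A j)) \<longlonglongrightarrow> 0"
  proof (rule LIMSEQ_I)
    fix e :: real assume "e > 0"
    have "uniformly_continuous_on (closure V) f"
      using comp cont compact_uniformly_continuous by blast
    then obtain d where d: "d > 0" "\<And>x y. x \<in> closure V \<Longrightarrow> y \<in> closure V \<Longrightarrow> dist y x < d \<Longrightarrow> dist (f y) (f x) < e/2"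
      unfolding uniformly_continuous_on_def using \<open>e > 0\<close> half_gt_zero by metis
    obtain J where J: "\<And>j. j \<ge> J \<Longrightarrow> norm (diameter (A j) - 0) < d"
      using LIMSEQ_D[OF A(4) d(1)] by blast
    show "\<exists>no. \<forall>j\<ge>no. norm (diameter (f ` A j) - 0) < e"
    proof (intro exI allI impI)
      fix j assume "j \<ge> J"
      have "dist (f x) (f y) \<le> e/2" if "x \<in> A j" "y \<in> A j" for x y
      proof -
        have "dist x y \<le> diameter (A j)"
          using diameter_bounded_bound[OF bdd[OF AV(1)]] that by blast
        then have "dist x y < d" using J[OF \<open>j \<ge> J\<close>] by auto
        moreover have "x \<in> closure V" "y \<in> closure V" using that AV closure_subset[of V] by blast+
        ultimately show ?thesis using d(2)[of y x] by (simp add: less_imp_le)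
      qed
      then have "diameter (f ` A j) \<le> e/2"
        using AV by (intro diameter_le_metric) auto
      moreover have "diameter (f ` A j) \<ge> 0" using bdd AV image_subset diameter_ge_0 by metis
      ultimately show "norm (diameter (f ` A j) - 0) < e" using \<open>e > 0\<close> by auto
    qed
  qed
  then show ?thesis
    unfolding fundamental_chains_def mem_Collect_eq
    using image_mono[OF A(1)] crosscut_nbhd_image[OF A(2)] disj
    by (intro conjI allI exI[of _ "\<lambda>j. f ` A j"] impI)
qed

lemma chain_equiv_image:
  assumes "(N, M) \<in> chain_equiv V"
  shows "((\<lambda>j. f ` N j), (\<lambda>j. f ` M j)) \<in> chain_equiv V"
proof -
  have NM: "N \<in> fundamental_chains V" "M \<in> fundamental_chains V"
    "\<forall>j. \<exists>i. M i \<subseteq> N j" "\<forall>j. \<exists>i. N i \<subseteq> M j"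
    using assms by (auto simp: chain_equiv_def)
  have "\<exists>i. f ` M i \<subseteq> f ` N j" "\<exists>i. f ` N i \<subseteq> f ` M j" for j
    using NM(3,4) by (meson image_mono)+
  then show ?thesis
    using NM(1,2) by (simp add: chain_equiv_def fundamental_chain_image)
qed

end


text \<open>The part of the disk cut off by a line close to the boundary point \<open>b\<close> is small, and what remains
  of the disk is convex. This replaces separation theorems for arcs.\<close>

lemma dist_cap_le:
  fixes b z :: complex
  assumes "cmod b = 1" "cmod z \<le> 1" "b \<bullet> z \<ge> 1 - e"
  shows "dist z b \<le> sqrt (2 * e)"
proof -
  have "(dist z b)\<^sup>2 = (cmod z)\<^sup>2 + (cmod b)\<^sup>2 - 2 * (b \<bullet> z)"
    by (simp add: dist_norm power2_norm_eq_inner inner_diff_left inner_diff_right inner_commute)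
  moreover have "(cmod z)\<^sup>2 \<le> 1" using assms(2) by (simp add: power_le_one)
  ultimately have "(dist z b)\<^sup>2 \<le> 2 * e" using assms by simp
  then show ?thesis by (rule real_le_rsqrt)
qed

lemma cap_of_small_dist:
  fixes b z :: complex
  assumes "cmod b = 1" "dist z b \<le> e"
  shows "b \<bullet> z \<ge> 1 - e"
proof -
  have "b \<bullet> (b - z) \<le> cmod b * cmod (b - z)" using norm_cauchy_schwarz by blast
  then show ?thesis using assms
    by (simp add: inner_diff_right dist_norm norm_minus_commute dot_square_norm)
qed

text \<open>The arc of the circle of radius \<open>r\<close> about \<open>\<omega>\<close> inside the unit disk, for \<open>\<omega>\<close> on the unit circle. The
  parameter interval ends where \<open>1 - r cis a\<close> has modulus \<open>1\<close>, that is, for \<open>cos a = r / 2\<close>.\<close>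

definition arc_at :: "complex \<Rightarrow> real \<Rightarrow> real \<Rightarrow> complex" where
  "arc_at \<omega> r t = \<omega> * (1 - of_real r * cis (arccos (r/2) * (2 * t - 1)))"

lemma cmod_arc: 
  assumes "cmod \<omega> = 1"
  shows "(cmod (\<omega> * (1 - of_real r * cis a)))\<^sup>2 = 1 + r * (r - 2 * cos a)"
proof -
  have "(cmod (1 - of_real r * cis a))\<^sup>2 = (1 - r * cos a)\<^sup>2 + (r * sin a)\<^sup>2"
    by (simp add: cmod_power2)
  also have "\<dots> = 1 - 2 * r * cos a + r\<^sup>2 * ((sin a)\<^sup>2 + (cos a)\<^sup>2)" by algebra
  finally show ?thesis unfolding norm_mult assms by (simp add: power2_eq_square algebra_simps)
qed

lemma arc_at:
  assumes w: "cmod \<omega> = 1" and r: "0 < r" "r < 2"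
  shows arc_at_image: "arc_at \<omega> r ` {0<..<1} = ball 0 1 \<inter> sphere \<omega> r"
    and arc_at_start: "arc_at \<omega> r 0 \<in> sphere 0 1 \<inter> sphere \<omega> r"
    and arc_at_finish: "arc_at \<omega> r 1 \<in> sphere 0 1 \<inter> sphere \<omega> r"
    and inj_on_arc_at: "inj_on (arc_at \<omega> r) {0..1}"
    and continuous_arc_at: "continuous_on S (arc_at \<omega> r)"
proof -
  define b where "b = arccos (r/2)"
  have b: "0 < b" "b < pi" "cos b = r/2"
    using r arccos_lt_bounded[of "r/2"] by (auto simp: b_def cos_arccos)
  have dist: "dist \<omega> (arc_at \<omega> r t) = r" for t
    using w r by (simp add: arc_at_def dist_norm norm_mult algebra_simps)
  have one: "(cmod x)\<^sup>2 < 1 \<longleftrightarrow> cmod x < 1" for x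
    using abs_square_less_1[of "cmod x"] by simp
  have lt1: "cmod (\<omega> * (1 - of_real r * cis a)) < 1 \<longleftrightarrow> r/2 < cos a" for a
    using r unfolding one[symmetric] cmod_arc[OF w] by (simp add: mult_less_0_iff mult.commute)
  have eq1: "cmod (\<omega> * (1 - of_real r * cis a)) = 1 \<longleftrightarrow> r/2 = cos a" for a
    using r abs_square_eq_1[of "cmod (\<omega> * (1 - of_real r * cis a))"]
    unfolding cmod_arc[OF w] by auto
  have in_ball: "arc_at \<omega> r t \<in> ball 0 1" if "t \<in> {0<..<1}" for t
  proof -
    have "\<bar>b * (2 * t - 1)\<bar> < b" using that b by (auto simp: abs_mult abs_less_iff)
    then have "cos b < cos \<bar>b * (2 * t - 1)\<bar>" using b by (intro cos_monotone_0_pi) auto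
    then have "r/2 < cos (b * (2 * t - 1))" using b by simp
    then show ?thesis unfolding arc_at_def b_def[symmetric] using lt1 by simp
  qed
  show "arc_at \<omega> r ` {0<..<1} = ball 0 1 \<inter> sphere \<omega> r"
  proof
    show "arc_at \<omega> r ` {0<..<1} \<subseteq> ball 0 1 \<inter> sphere \<omega> r" using in_ball dist by auto
    show "ball 0 1 \<inter> sphere \<omega> r \<subseteq> arc_at \<omega> r ` {0<..<1}"
    proof
      fix z assume z: "z \<in> ball 0 1 \<inter> sphere \<omega> r"
      define u where "u = (\<omega> - z) / (of_real r * \<omega>)"
      have "cmod u = 1" using z r w by (simp add: u_def norm_divide norm_mult dist_norm)
      define a where "a = Arg u"
      have u: "u = cis a" using \<open>cmod u = 1\<close> unfolding a_def
        by (metis cis_Arg norm_zero sgn_eq div_by_1 of_real_1 zero_neq_one)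
      have "z = \<omega> * (1 - of_real r * cis a)"
      proof -
        have "\<omega> \<noteq> 0" using w by auto
        then show ?thesis unfolding u[symmetric] u_def using r by (simp add: divide_simps)
      qed
      with z lt1 have "r/2 < cos a" by simp
      then have "arccos (cos \<bar>a\<bar>) < arccos (r/2)" using r by (intro arccos_less_arccos) auto
      moreover have "\<bar>a\<bar> \<le> pi" using Arg_bounded[of u] by (auto simp: a_def)
      ultimately have "\<bar>a\<bar> < b" unfolding b_def using arccos_cos[of "\<bar>a\<bar>"] by simp
      then have "(a/b+1)/2 \<in> {0<..<1}" using b by (auto simp: field_simps)
      moreover have "arc_at \<omega> r ((a/b+1)/2) = z"
        unfolding \<open>z = _\<close> arc_at_def b_def[symmetric] using b by (simp add: field_simps)
      ultimately show "z \<in> arc_at \<omega> r ` {0<..<1}" by (metis imageI)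
    qed
  qed
  show "arc_at \<omega> r 0 \<in> sphere 0 1 \<inter> sphere \<omega> r" "arc_at \<omega> r 1 \<in> sphere 0 1 \<inter> sphere \<omega> r"
    using dist[of 0] dist[of 1] eq1[of "b * (2*0-1)"] eq1[of "b * (2*1-1)"] b
    by (simp_all add: arc_at_def b_def[symmetric])
  show "inj_on (arc_at \<omega> r) {0..1}"
  proof (rule inj_onI)
    fix s t :: real assume st: "s \<in> {0..1}" "t \<in> {0..1}" "arc_at \<omega> r s = arc_at \<omega> r t"
    then have c: "cis (b * (2 * s - 1)) = cis (b * (2 * t - 1))"
      using w r by (auto simp: arc_at_def b_def[symmetric])
    have "Arg (cis (b * (2 * x - 1))) = b * (2 * x - 1)" if "x \<in> {0..1}" for x
    proof -
      have "\<bar>b * (2 * x - 1)\<bar> \<le> b" using that b by (auto simp: abs_mult abs_le_iff)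
      then show ?thesis using b by (intro cis_Arg_unique) auto
    qed
    then have "b * (2 * s - 1) = b * (2 * t - 1)" using c st by metis
    then show "s = t" using b by simp
  qed
  show "continuous_on S (arc_at \<omega> r)"
    unfolding arc_at_def by (intro continuous_intros)
qed


section \<open>Prime ends of a domain parametrized by the closed disk\<close>

lemma ball_inter_ball_nonempty:
  assumes "cmod \<omega> = 1" "e > 0"
  shows "ball 0 1 \<inter> ball \<omega> e \<noteq> {}"
proof -
  have "\<omega> \<in> closure (ball 0 1)" using assms by simp
  then obtain y where "y \<in> ball 0 1" "dist y \<omega> < e" using assms closure_approachable by metis
  then show ?thesis by (auto simp: dist_commute)
qed

text \<open>A set close to the boundary point \<open>b\<close> lies in a thin cap. The rest of the disk is convex and so
  belongs to a single component.\<close>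

lemma component_small_or_large:
  assumes b: "cmod b = 1" and B: "B \<subseteq> cball b e" and M: "M \<in> components (ball 0 1 - B)"
  shows "M \<subseteq> cball b (sqrt (2 * e)) \<or> ball 0 1 - M \<subseteq> cball b (sqrt (2 * e))"
proof -
  define H where "H = ball 0 1 \<inter> {z. b \<bullet> z < 1 - e}"
  have "convex H" unfolding H_def by (intro convex_Int convex_ball convex_halfspace_lt)
  then have "connected H" by (rule convex_connected)
  have "z \<notin> B" if "z \<in> H" for z
  proof
    assume "z \<in> B"
    then have "dist z b \<le> e" using B by (auto simp: dist_commute)
    then show False using cap_of_small_dist[OF b, of z e] that by (auto simp: H_def)
  qed
  then have "H \<subseteq> ball 0 1 - B" by (auto simp: H_def)
  then have "M \<inter> H = {} \<or> H \<subseteq> M" using components_maximal[OF M \<open>connected H\<close>] by blast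
  moreover have "z \<in> cball b (sqrt (2*e))" if "z \<in> ball 0 1" "z \<notin> H" for z
    using dist_cap_le[OF b, of z e] that by (auto simp: H_def dist_commute not_less)
  moreover have "M \<subseteq> ball 0 1" using in_components_subset[OF M] by blast
  ultimately show ?thesis by blast
qed

lemma half_disk_component:
  assumes w: "cmod \<omega> = 1" and r: "0 < r"
  shows "ball 0 1 \<inter> ball \<omega> r \<in> components (ball 0 1 - ball 0 1 \<inter> sphere \<omega> r)"
  unfolding in_components_iff
proof (intro conjI allI impI)
  show "ball 0 1 \<inter> ball \<omega> r \<noteq> {}" by (rule ball_inter_ball_nonempty[OF w r])
  show "connected (ball 0 1 \<inter> ball \<omega> r)" by (intro convex_connected convex_Int convex_ball)
  show "ball 0 1 \<inter> ball \<omega> r \<subseteq> ball 0 1 - ball 0 1 \<inter> sphere \<omega> r" by auto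
  fix D assume D: "ball 0 1 \<inter> ball \<omega> r \<subseteq> D \<and> D \<subseteq> ball 0 1 - ball 0 1 \<inter> sphere \<omega> r \<and> connected D"
  have "D \<inter> frontier (ball \<omega> r) = {}" using D r by auto
  moreover have "D \<inter> ball \<omega> r \<noteq> {}" using D ball_inter_ball_nonempty[OF w r] by blast
  ultimately have "D - ball \<omega> r = {}" using connected_Int_frontier D by blast
  then show "D = ball 0 1 \<inter> ball \<omega> r" using D by blast
qed

text \<open>The map \<open>p\<close> extends a homeomorphism from the open disk onto \<open>V\<close> continuously to the boundary. It may
  identify points of the circle, but only finitely many are affected.\<close>

locale disk_parametrization =
  fixes p :: "complex \<Rightarrow> 'a::metric_space" and V :: "'a set" and Z :: "complex set"
  assumes cont: "continuous_on (cball 0 1) p"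
    and inj: "inj_on p (ball 0 1)"
    and image: "p ` ball 0 1 = V"
    and bdry: "p ` sphere 0 1 \<inter> V = {}"
    and fin: "finite Z"
    and inj_sphere: "inj_on p (sphere 0 1 - Z)"
begin

lemma cball_cases: "(z::complex) \<in> cball 0 1 \<Longrightarrow> z \<in> ball 0 1 \<or> z \<in> sphere 0 1"
  by auto

lemma in_V_iff: "z \<in> cball 0 1 \<Longrightarrow> p z \<in> V \<longleftrightarrow> z \<in> ball 0 1"
  using image bdry by (metis IntI cball_cases empty_iff imageI)

lemma compact_image: "compact (p ` cball 0 1)"
  by (intro compact_continuous_image cont compact_cball)

lemma closure_eq: "closure V = p ` cball 0 1"
proof
  show "closure V \<subseteq> p ` cball 0 1"
    using image compact_imp_closed[OF compact_image] by (intro closure_minimal) auto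
  have "p ` closure (ball 0 1) \<subseteq> closure V"
    using cont image by (intro image_closure_subset) (auto intro: closure_subset[THEN subsetD])
  then show "p ` cball 0 1 \<subseteq> closure V" by simp
qed

lemma closure_image:
  assumes "S \<subseteq> cball 0 1"
  shows "closure (p ` S) = p ` closure S"
proof
  have sub: "closure S \<subseteq> cball 0 1" using assms by (simp add: closure_minimal)
  then have "compact (closure S)" by (metis compact_cball closed_closure compact_Int_closed inf.absorb2)
  then have "compact (p ` closure S)"
    by (intro compact_continuous_image continuous_on_subset[OF cont sub])
  then show "closure (p ` S) \<subseteq> p ` closure S"
    by (intro closure_minimal) (auto simp: compact_imp_closed closure_subset image_mono)
  show "p ` closure S \<subseteq> closure (p ` S)"
    by (rule image_closure_subset[OF continuous_on_subset[OF cont sub] closed_closure closure_subset])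
qed

lemma boundary_eq: "closure V - V = p ` sphere 0 1"
proof -
  have "cball 0 1 = ball 0 1 \<union> sphere (0::complex) 1" by auto
  then have "closure V = V \<union> p ` sphere 0 1" using closure_eq image by auto
  then show ?thesis using bdry by blast
qed

definition q :: "'a \<Rightarrow> complex" where "q = the_inv_into (ball 0 1) p"

lemma q: "v \<in> V \<Longrightarrow> q v \<in> ball 0 1" "v \<in> V \<Longrightarrow> p (q v) = v"
  "z \<in> ball 0 1 \<Longrightarrow> q (p z) = z"
  unfolding q_def using image inj
  by (auto simp: the_inv_into_f_f intro: the_inv_into_into f_the_inv_into_f)

lemma homeo: "homeomorphism (ball 0 1) V p q"
proof -
  have "closedin (top_of_set V) (p ` C)" if C: "closedin (top_of_set (ball 0 1)) C" for C
  proof -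
    obtain C' where C': "closed C'" "C = ball 0 1 \<inter> C'"
      using C unfolding closedin_closed by blast
    have "compact (p ` (cball 0 1 \<inter> C'))"
      using C' by (intro compact_continuous_image continuous_on_subset[OF cont])
        (auto simp: compact_Int_closed)
    moreover have "p ` C = V \<inter> p ` (cball 0 1 \<inter> C')"
    proof
      show "p ` C \<subseteq> V \<inter> p ` (cball 0 1 \<inter> C')"
        unfolding C'(2) image[symmetric] using ball_subset_cball[of "0::complex" 1] by blast
      show "V \<inter> p ` (cball 0 1 \<inter> C') \<subseteq> p ` C"
        unfolding C'(2) using in_V_iff by blast
    qed
    ultimately show ?thesis by (metis closedin_closed compact_imp_closed)
  qed
  then obtain r where r: "homeomorphism (ball 0 1) V p r"
    using homeomorphism_injective_closed_map[OF _ image inj] cont continuous_on_subset[OF _ ball_subset_cball]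
    by metis
  have "r v = q v" if "v \<in> V" for v
    using r that q(3) unfolding homeomorphism_def by (metis image_eqI)
  then show ?thesis using homeomorphism_cong[OF r refl refl refl] by (metis (full_types))
qed

lemma finite_fiber: "finite {z \<in> cball 0 1. p z = a}"
proof -
  have "is_singleton S \<or> S = {}" if "inj_on p T" "S \<subseteq> {z \<in> T. p z = a}" for S T
    using that unfolding inj_on_def is_singleton_def by blast
  then have "finite S" if "inj_on p T" "S \<subseteq> {z \<in> T. p z = a}" for S T
    using that is_singletonE by (metis finite.simps)
  from this[OF inj subset_refl] this[OF inj_sphere subset_refl]
  have "finite ({z \<in> ball 0 1. p z = a} \<union> {z \<in> sphere 0 1 - Z. p z = a} \<union> Z)"
    using fin by blast
  moreover have "{z \<in> cball 0 1. p z = a} \<subseteq> {z \<in> ball 0 1. p z = a} \<union> {z \<in> sphere 0 1 - Z. p z = a} \<union> Z"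
    by fastforce
  ultimately show ?thesis by (rule rev_finite_subset)
qed

text \<open>Connectedness is essential here: close points of \<open>V\<close> may lie near different points of a
  fiber. A connected set that is not small crosses a circle which avoids that fiber.\<close>

lemma connected_small:
  assumes "e > 0"
  obtains d where "d > 0" and "\<And>C x y. connected C \<Longrightarrow> C \<subseteq> cball 0 1 \<Longrightarrow>
    (\<And>x y. x \<in> C \<Longrightarrow> y \<in> C \<Longrightarrow> dist (p x) (p y) < d) \<Longrightarrow> x \<in> C \<Longrightarrow> y \<in> C \<Longrightarrow> dist x y \<le> e"
proof (rule ccontr)
  assume *: "\<not> thesis"
  have "\<exists>C x y. connected C \<and> C \<subseteq> cball 0 1 \<and> (\<forall>x\<in>C. \<forall>y\<in>C. dist (p x) (p y) < inverse (real (Suc n)))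
      \<and> x \<in> C \<and> y \<in> C \<and> dist x y > e" for n
  proof (rule ccontr)
    assume "\<not> ?thesis"
    then show False
      using * that[of "inverse (real (Suc n))"] by (smt (verit, best) inverse_positive_iff_positive of_nat_0_less_iff zero_less_Suc)
  qed
  then obtain C x y where C: "\<And>n. connected (C n)" "\<And>n. C n \<subseteq> cball 0 1"
    "\<And>n u v. u \<in> C n \<Longrightarrow> v \<in> C n \<Longrightarrow> dist (p u) (p v) < inverse (real (Suc n))"
    "\<And>n. x n \<in> C n" "\<And>n. y n \<in> C n" "\<And>n. dist (x n) (y n) > e"
    by metis
  have "\<forall>n. x n \<in> cball 0 1" using C by blast
  then obtain x0 r where x0: "x0 \<in> cball 0 1" "strict_mono r" "(x \<circ> r) \<longlonglongrightarrow> x0"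
    using compact_cball[of "0::complex" 1] unfolding compact_def by meson
  \<comment> \<open>A radius \<open>s\<close> such that the circle about \<open>x0\<close> avoids the fiber of \<open>p x0\<close>.\<close>
  have "finite ((\<lambda>z. dist x0 z) ` {z \<in> cball 0 1. p z = p x0})" using finite_fiber by blast
  then have "infinite ({0<..<e/2} - (\<lambda>z. dist x0 z) ` {z \<in> cball 0 1. p z = p x0})" (is "infinite ?S")
    using \<open>e > 0\<close> by (simp add: Diff_infinite_finite)
  then obtain s where s: "0 < s" "s < e/2" "\<And>z. z \<in> cball 0 1 \<Longrightarrow> p z = p x0 \<Longrightarrow> dist x0 z \<noteq> s"
  proof -
    assume "infinite ?S"
    then have "?S \<noteq> {}" by (metis finite.emptyI)
    then obtain s where "s \<in> ?S" by blast
    then show ?thesis by (intro that[of s]) auto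
  qed
  have "\<forall>\<^sub>F n in sequentially. \<exists>z\<in>C (r n). dist x0 z = s"
  proof -
    have "\<forall>\<^sub>F n in sequentially. dist ((x \<circ> r) n) x0 < s"
      using x0(3) s(1) by (rule tendstoD)
    then show ?thesis
    proof eventually_elim
      case (elim n)
      have con: "connected ((\<lambda>z. dist x0 z) ` C (r n))"
        by (intro connected_continuous_image C continuous_intros)
      have "dist x0 (x (r n)) \<le> s" using elim by (simp add: dist_commute)
      moreover have "s \<le> dist x0 (y (r n))"
        using C(6)[of "r n"] elim s(2) dist_triangle[of "x (r n)" "y (r n)" x0]
        by (simp add: dist_commute)
      ultimately have "s \<in> (\<lambda>z. dist x0 z) ` C (r n)"
        using con C(4)[of "r n"] C(5)[of "r n"] connected_contains_Icc[OF con] by fastforce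
      then show ?case by blast
    qed
  qed
  then obtain m where "\<And>n. n \<ge> m \<Longrightarrow> \<exists>z\<in>C (r n). dist x0 z = s"
    unfolding eventually_sequentially by blast
  then obtain z where z: "\<And>n. n \<ge> m \<Longrightarrow> z n \<in> C (r n)" "\<And>n. n \<ge> m \<Longrightarrow> dist x0 (z n) = s"
    by metis
  have "\<forall>n. z (n + m) \<in> cball 0 1" using z(1) C(2) by (meson le_add2 subset_iff)
  then obtain z0 t where z0: "z0 \<in> cball 0 1" "strict_mono t" "((\<lambda>n. z (n + m)) \<circ> t) \<longlonglongrightarrow> z0"
    using compact_cball[of "0::complex" 1] unfolding compact_def by meson
  have "(\<lambda>n. dist x0 (z (t n + m))) \<longlonglongrightarrow> dist x0 z0"
    using z0(3) by (intro tendsto_intros) (simp add: o_def)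
  moreover have "(\<lambda>n. dist x0 (z (t n + m))) = (\<lambda>n. s)" using z(2) by auto
  ultimately have "dist x0 z0 = s" by (simp add: LIMSEQ_const_iff)
  have lim: "(\<lambda>n. p (w n)) \<longlonglongrightarrow> p l" if "\<And>n. w n \<in> cball 0 1" "l \<in> cball 0 1" "w \<longlonglongrightarrow> l" for w l
    using cont that unfolding continuous_on_sequentially o_def by blast
  have tm: "filterlim (\<lambda>n. t n + m) at_top sequentially"
    using filterlim_subseq[OF z0(2)] filterlim_add_const_nat_at_top filterlim_compose by blast
  have 1: "(\<lambda>n. p (z (t n + m))) \<longlonglongrightarrow> p z0"
    using z0 \<open>\<forall>n. z (n + m) \<in> cball 0 1\<close> by (intro lim) (auto simp: o_def)
  have 2: "(\<lambda>n. p (x (r (t n + m)))) \<longlonglongrightarrow> p x0"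
    using x0(1) \<open>\<forall>n. x n \<in> cball 0 1\<close> filterlim_compose[OF x0(3) tm]
    by (intro lim) (auto simp: o_def)
  have "(\<lambda>n. dist (p (z (t n + m))) (p (x (r (t n + m))))) \<longlonglongrightarrow> 0"
  proof (rule tendsto_sandwich[OF _ _ tendsto_const])
    show "\<forall>\<^sub>F n in sequentially. 0 \<le> dist (p (z (t n + m))) (p (x (r (t n + m))))" by simp
    show "\<forall>\<^sub>F n in sequentially. dist (p (z (t n + m))) (p (x (r (t n + m)))) \<le> inverse (real (Suc (r (t n + m))))"
      using C(3,4) z(1) by (intro always_eventually allI less_imp_le) simp
    show "(\<lambda>n. inverse (real (Suc (r (t n + m))))) \<longlonglongrightarrow> 0"
      using LIMSEQ_inverse_real_of_nat filterlim_compose[OF filterlim_subseq[OF x0(2)] tm]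
      by (rule filterlim_compose)
  qed
  moreover have "(\<lambda>n. dist (p (z (t n + m))) (p (x (r (t n + m))))) \<longlonglongrightarrow> dist (p z0) (p x0)"
    by (intro tendsto_dist 1 2)
  ultimately have "p z0 = p x0" using LIMSEQ_unique by force
  then show False using s(3)[OF z0(1)] \<open>dist x0 z0 = s\<close> by blast
qed

text \<open>The pullback of a crosscut is relatively closed and accumulates at the unit circle, which is enough
  to apply the dichotomy for components.\<close>

lemma crosscut_preimage:
  assumes "crosscut V A"
  shows "A \<subseteq> V" "connected (q ` A)" "closedin (top_of_set (ball 0 1)) (q ` A)"
    and "\<exists>b \<in> closure (q ` A). cmod b = 1" and "p ` q ` A = A"
    and "p ` closure (q ` A) = closure A" and "\<exists>x\<in>A. \<exists>y\<in>A. x \<noteq> y" and "bounded A"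
proof -
  obtain g where g: "simple_path g" "A = g ` {0<..<1}" "A \<subseteq> V"
     "pathstart g \<in> closure V - V" "pathfinish g \<in> closure V - V"
    using assms unfolding crosscut_def by blast
  note im = crosscut_path_image[OF g(1) g(3)[unfolded g(2)] g(4) g(5), folded g(2)]
  show AV: "A \<subseteq> V" by fact
  show pq: "p ` q ` A = A" using AV q(2) by (force simp: image_image)
  have qA: "q ` A \<subseteq> ball 0 1" using AV q(1) by auto
  then have qA': "q ` A \<subseteq> cball 0 1" by force
  have clqA: "closure (q ` A) \<subseteq> cball 0 1" using qA' by (simp add: closure_minimal)
  show cl: "p ` closure (q ` A) = closure A"
    using closure_image[OF qA'] pq by simp
  have "continuous_on {0<..<1} g"
    using g(1) unfolding simple_path_def path_def
    by (auto intro: continuous_on_subset[of "{0..1}"])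
  then have "connected A"
    unfolding g(2) by (intro connected_continuous_image) auto
  then show "connected (q ` A)"
    using homeo AV continuous_on_subset by (intro connected_continuous_image) (auto simp: homeomorphism_def)
  have "pathstart g \<in> closure A" using im by (simp add: pathstart_in_path_image)
  then obtain b where b: "b \<in> closure (q ` A)" "p b = pathstart g" using cl by (metis imageE)
  then have "b \<notin> ball 0 1" using g(4) image by (metis DiffD2 imageI)
  then have "cmod b = 1" using b clqA by force
  then show "\<exists>b \<in> closure (q ` A). cmod b = 1" using b by blast
  have "q ` A = ball 0 1 \<inter> closure (q ` A)"
  proof
    show "q ` A \<subseteq> ball 0 1 \<inter> closure (q ` A)" using qA closure_subset[of "q ` A"] by simp
    show "ball 0 1 \<inter> closure (q ` A) \<subseteq> q ` A"
    proof
      fix x assume x: "x \<in> ball 0 1 \<inter> closure (q ` A)"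
      then have "p x \<in> path_image g" "p x \<in> V" using cl im(3) image by blast+
      then have "p x \<in> A" using im(1) g(4,5) by auto
      then show "x \<in> q ` A" using q(3)[of x] x by force
    qed
  qed
  then show "closedin (top_of_set (ball 0 1)) (q ` A)"
    by (metis closedin_closed closed_closure)
  have "loop_free g" using g(1) by (simp add: simple_path_def)
  from this[unfolded loop_free_def, rule_format, of "1/2" "1/3"]
  have "g (1/2) \<noteq> g (1/3)" by auto
  moreover have "g (1/2) \<in> A" "g (1/3) \<in> A" unfolding g(2) by (intro imageI; simp)+
  ultimately show "\<exists>x\<in>A. \<exists>y\<in>A. x \<noteq> y" by blast
  show "bounded A"
    using AV bounded_subset[OF compact_imp_bounded[OF compact_image]] closure_subset[of V]
    unfolding closure_eq by blast
qed


text \<open>The pullbacks of the chain to the disk form a neighbourhood base at the boundary point \<open>\<omega>\<close>, relative to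
  the open disk.\<close>

definition chain_at :: "(nat \<Rightarrow> 'a set) \<Rightarrow> complex \<Rightarrow> bool" where
  "chain_at N \<omega> \<longleftrightarrow> cmod \<omega> = 1 \<and> (\<forall>e>0. \<exists>j. N j \<subseteq> p ` (ball 0 1 \<inter> ball \<omega> e)) \<and>
     (\<forall>j. \<exists>e>0. p ` (ball 0 1 \<inter> ball \<omega> e) \<subseteq> N j)"

lemma chain_at_unique:
  assumes N: "chain_at N \<omega>" and N': "chain_at N \<omega>'"
  shows "\<omega> = \<omega>'"
proof (rule ccontr)
  assume "\<omega> \<noteq> \<omega>'"
  define e where "e = dist \<omega> \<omega>' / 2"
  have "e > 0" using \<open>\<omega> \<noteq> \<omega>'\<close> by (simp add: e_def)
  then obtain j where j: "N j \<subseteq> p ` (ball 0 1 \<inter> ball \<omega> e)" using N unfolding chain_at_def by blast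
  obtain d where d: "d > 0" "p ` (ball 0 1 \<inter> ball \<omega>' d) \<subseteq> N j" using N' unfolding chain_at_def by blast
  have "ball 0 1 \<inter> ball \<omega>' (min d e) \<noteq> {}"
    using N' d(1) \<open>e > 0\<close> by (intro ball_inter_ball_nonempty) (auto simp: chain_at_def)
  then obtain x where x: "x \<in> ball 0 1" "x \<in> ball \<omega>' (min d e)" by blast
  then have "x \<in> ball 0 1 \<inter> ball \<omega>' d" by simp
  then have "p x \<in> p ` (ball 0 1 \<inter> ball \<omega> e)" using d(2) j by blast
  then obtain y where "y \<in> ball 0 1" "p x = p y" "dist \<omega> y < e" by auto
  then have "dist \<omega> x < e" using inj x by (metis inj_onD)
  then show False using x dist_triangle[of \<omega> \<omega>' x] by (simp add: e_def dist_commute)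
qed

lemma preimage_component:
  assumes "crosscut_nbhd V A N"
  shows "q ` N \<in> components (ball 0 1 - q ` A)" and "p ` q ` N = N" and "N \<subseteq> V" "N \<noteq> {}" "open (q ` N)"
proof -
  have N: "N \<in> components (V - A)" and A: "crosscut V A" using assms by (auto simp: crosscut_nbhd_def)
  show NV: "N \<subseteq> V" using in_components_subset[OF N] by blast
  show "N \<noteq> {}" using in_components_nonempty[OF N] .
  show "p ` q ` N = N" using NV q(2) by (force simp: image_image)
  have "q ` N \<in> components (q ` (V - A))"
    using homeomorphism_symD[OF homeo] N by (rule components_homeomorphic_image) auto
  moreover have "q ` V = ball 0 1" using homeo by (simp add: homeomorphism_def)
  moreover have "inj_on q V" using q(2) by (metis inj_onI)
  then have "q ` (V - A) = q ` V - q ` A"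
    using crosscut_preimage(1)[OF A] by (intro inj_on_image_set_diff[of q V]) auto
  ultimately show *: "q ` N \<in> components (ball 0 1 - q ` A)" by simp
  obtain T where "closed T" "q ` A = ball 0 1 \<inter> T"
    using crosscut_preimage(3)[OF A] unfolding closedin_closed by blast
  then have "ball 0 1 - q ` A = ball 0 1 \<inter> - T" by blast
  then have "open (ball 0 1 - q ` A)" using \<open>closed T\<close> by auto
  then show "open (q ` N)" using * open_components by blast
qed

text \<open>A component of the complement of a small crosscut is either small or has small complement.
  Along a chain the second case cannot persist: the nonempty complements increase.\<close>

lemma chain_at_exists:
  assumes "N \<in> fundamental_chains V"
  shows "\<exists>\<omega>. chain_at N \<omega>"
proof -
  obtain A where A: "\<And>j. N (Suc j) \<subseteq> N j" "\<And>j. crosscut_nbhd V (A j) (N j)"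
     "\<And>i j. i \<noteq> j \<Longrightarrow> closure (A i) \<inter> closure (A j) = {}" "(\<lambda>j. diameter (A j)) \<longlonglongrightarrow> 0"
    using assms unfolding fundamental_chains_def by blast
  define M where "M j = q ` N j" for j
  define B where "B j = q ` A j" for j
  have cc: "crosscut V (A j)" for j using A(2) by (simp add: crosscut_nbhd_def)
  have Mcomp: "M j \<in> components (ball 0 1 - B j)" for j
    using preimage_component(1)[OF A(2)] by (simp add: M_def B_def)
  have pM: "p ` M j = N j" for j using preimage_component(2)[OF A(2)] by (simp add: M_def)
  have Mball: "M j \<subseteq> ball 0 1 - B j" for j using in_components_subset[OF Mcomp] .
  have Mdec: "M j \<subseteq> M i" if "i \<le> j" for i j
    using decseqD[OF decseq_SucI[of N, OF A(1)] that] by (auto simp: M_def)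
  have Bball: "B j \<subseteq> ball 0 1" for j using crosscut_preimage(1)[OF cc[of j]] q(1) by (auto simp: B_def)
  have small: "\<exists>J. \<forall>j\<ge>J. \<exists>b. cmod b = 1 \<and> B j \<subseteq> cball b e" if "e > 0" for e
  proof -
    obtain d where d: "d > 0" "\<And>C x y. connected C \<Longrightarrow> C \<subseteq> cball 0 1 \<Longrightarrow>
        (\<And>x y. x \<in> C \<Longrightarrow> y \<in> C \<Longrightarrow> dist (p x) (p y) < d) \<Longrightarrow> x \<in> C \<Longrightarrow> y \<in> C \<Longrightarrow> dist x y \<le> e"
      using connected_small[OF \<open>e > 0\<close>] by blast
    obtain J where J: "\<And>j. j \<ge> J \<Longrightarrow> norm (diameter (A j) - 0) < d"
      using LIMSEQ_D[OF A(4) d(1)] by blast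
    show ?thesis
    proof (rule exI[of _ J], intro allI impI)
      fix j assume "j \<ge> J"
      have "dist (p x) (p y) < d" if "x \<in> B j" "y \<in> B j" for x y
      proof -
        have "p x \<in> A j" "p y \<in> A j" using that crosscut_preimage(5)[OF cc[of j]] by (auto simp: B_def)
        then have "dist (p x) (p y) \<le> diameter (A j)"
          using diameter_bounded_bound[OF crosscut_preimage(8)[OF cc]] by blast
        then show ?thesis using J[OF \<open>j \<ge> J\<close>] by auto
      qed
      then have "dist x y \<le> e" if "x \<in> B j" "y \<in> B j" for x y
        using d(2)[of "B j" x y] crosscut_preimage(2)[OF cc[of j]] Bball[of j] that
          order_trans[OF Bball ball_subset_cball] by (auto simp: B_def)
      then have sub: "B j \<subseteq> cball x e" if "x \<in> B j" for x using that by auto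
      obtain b where b: "b \<in> closure (B j)" "cmod b = 1"
        using crosscut_preimage(4)[OF cc[of j]] by (auto simp: B_def)
      have "x \<in> cball b e" if "x \<in> B j" for x
        using closure_minimal[OF sub[OF that] closed_cball] b(1) by (auto simp: dist_commute)
      then show "\<exists>b. cmod b = 1 \<and> B j \<subseteq> cball b e" using b(2) by blast
    qed
  qed
  have Msmall: "\<exists>j b. cmod b = 1 \<and> M j \<subseteq> cball b e" if "e > 0" for e
  proof (rule ccontr)
    assume neg: "\<not> ?thesis"
    obtain x y where xy: "x \<in> A 0" "y \<in> A 0" "x \<noteq> y" using crosscut_preimage(7)[OF cc[of 0]] by blast
    define x' y' where "x' = q x" and "y' = q y"
    have xy': "x' \<in> B 0" "y' \<in> B 0" using xy by (auto simp: B_def x'_def y'_def)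
    have "x' \<noteq> y'" using xy q(2) crosscut_preimage(1)[OF cc[of 0]] unfolding x'_def y'_def by (metis subsetD)
    define a where "a = min e (dist x' y' / 3)"
    have a: "a > 0" "a \<le> e" "a \<le> dist x' y' / 3"
      using \<open>e > 0\<close> \<open>x' \<noteq> y'\<close> by (auto simp: a_def)
    obtain J where J: "\<forall>j\<ge>J. \<exists>b. cmod b = 1 \<and> B j \<subseteq> cball b (a\<^sup>2/2)"
      using small[of "a\<^sup>2/2"] a(1) by auto
    then obtain b where b: "cmod b = 1" "B J \<subseteq> cball b (a\<^sup>2/2)" by blast
    have "sqrt (2 * (a\<^sup>2/2)) = a" using a(1) by simp
    then have "M J \<subseteq> cball b a \<or> ball 0 1 - M J \<subseteq> cball b a"
      using component_small_or_large[OF b Mcomp] by simp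
    moreover have "\<not> M J \<subseteq> cball b a"
      using neg b(1) a(2) subset_cball[OF a(2)] by blast
    moreover have "x' \<in> ball 0 1 - M J" "y' \<in> ball 0 1 - M J"
      using xy' Bball[of 0] Mdec[of 0 J] Mball[of 0] by auto
    ultimately have "dist b x' \<le> a" "dist b y' \<le> a" by auto
    then show False using dist_triangle[of x' y' b] dist_commute[of x' b] a by linarith
  qed
  have Mne: "M j \<noteq> {}" for j using in_components_nonempty[OF Mcomp] .
  have Mcl: "closure (M j) \<subseteq> cball 0 1" for j
    using Mball[of j] ball_subset_cball[of "0::complex" 1] by (intro closure_minimal) auto
  have cp: "compact (closure (M j))" for j
    using Mcl by (metis compact_cball closed_closure compact_Int_closed inf.absorb2)
  have "(\<Inter>j. closure (M j)) \<noteq> {}"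
    using Mne Mdec cp by (intro compact_nest) (auto intro!: closure_mono)
  then obtain \<omega> where w: "\<And>j. \<omega> \<in> closure (M j)" by blast
  have near: "\<exists>j. M j \<subseteq> cball \<omega> e \<and> cmod \<omega> \<ge> 1 - e" if "e > 0" for e
  proof -
    obtain j b where b: "cmod b = 1" "M j \<subseteq> cball b (e/2)" using Msmall[of "e/2"] \<open>e > 0\<close> by auto
    have "\<omega> \<in> cball b (e/2)" using w[of j] closure_minimal[OF b(2) closed_cball] by blast
    then have d: "dist b \<omega> \<le> e/2" by simp
    have "M j \<subseteq> cball \<omega> e"
    proof
      fix x assume "x \<in> M j"
      then have "dist b x \<le> e/2" using b by auto
      then show "x \<in> cball \<omega> e" using d dist_triangle[of \<omega> x b] by (simp add: dist_commute)
    qed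
    moreover have "cmod \<omega> \<ge> 1 - e" using d b(1) norm_triangle_ineq2[of b \<omega>] \<open>e > 0\<close> by (simp add: dist_norm)
    ultimately show ?thesis by blast
  qed
  have "cmod \<omega> \<ge> 1"
    using near by (metis field_le_epsilon diff_le_eq)
  moreover have "cmod \<omega> \<le> 1" using w[of 0] Mcl[of 0] by auto
  ultimately have w1: "cmod \<omega> = 1" by simp
  have "chain_at N \<omega>"
    unfolding chain_at_def
  proof (intro conjI allI impI)
    show "cmod \<omega> = 1" by (rule w1)
    fix e :: real assume "e > 0"
    then obtain j where "M j \<subseteq> cball \<omega> (e/2)" using near[of "e/2"] by auto
    moreover have "cball \<omega> (e/2) \<subseteq> ball \<omega> e" using \<open>e > 0\<close> by auto
    ultimately have "M j \<subseteq> ball 0 1 \<inter> ball \<omega> e" using Mball[of j] by blast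
    then show "\<exists>j. N j \<subseteq> p ` (ball 0 1 \<inter> ball \<omega> e)" using pM by (metis image_mono)
  next
    fix j
    have *: "\<exists>e>0. p ` (ball 0 1 \<inter> ball \<omega> e) \<subseteq> N i" if notin: "\<omega> \<notin> closure (B i)" for i
    proof -
      have "\<exists>e>0. ball \<omega> e \<subseteq> - closure (B i)"
        using notin by (intro open_contains_ball[THEN iffD1, rule_format]) auto
      then obtain e where e: "e > 0" "ball \<omega> e \<inter> closure (B i) = {}" by blast
      have "ball 0 1 \<inter> ball \<omega> e \<subseteq> ball 0 1 - B i" using e(2) closure_subset[of "B i"] by blast
      moreover have "connected (ball 0 1 \<inter> ball \<omega> e)"
        by (intro convex_connected convex_Int convex_ball)
      moreover have "M i \<inter> (ball 0 1 \<inter> ball \<omega> e) \<noteq> {}"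
      proof -
        obtain y where "y \<in> M i" "dist y \<omega> < e" using w[of i] e(1) closure_approachable by metis
        then show ?thesis using Mball[of i] by (auto simp: dist_commute)
      qed
      ultimately have "ball 0 1 \<inter> ball \<omega> e \<subseteq> M i"
        using components_maximal[OF Mcomp] by metis
      then show ?thesis using e(1) pM by (metis image_mono)
    qed
    show "\<exists>e>0. p ` (ball 0 1 \<inter> ball \<omega> e) \<subseteq> N j"
    proof (cases "\<omega> \<in> closure (B j)")
      case True
      have "\<omega> \<notin> closure (B (Suc j))"
      proof
        assume "\<omega> \<in> closure (B (Suc j))"
        then have "p \<omega> \<in> closure (A j) \<inter> closure (A (Suc j))"
          using True crosscut_preimage(6)[OF cc[of j]] crosscut_preimage(6)[OF cc[of "Suc j"]]
          unfolding B_def by blast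
        then show False using A(3)[of j "Suc j"] by auto
      qed
      from *[OF this] show ?thesis using A(1)[of j] by blast
    next
      case False
      from *[OF this] show ?thesis .
    qed
  qed
  then show ?thesis by blast
qed

lemma chain_equiv_iff:
  assumes N: "N \<in> fundamental_chains V" "chain_at N \<omega>" and M: "M \<in> fundamental_chains V" "chain_at M \<omega>'"
  shows "(N, M) \<in> chain_equiv V \<longleftrightarrow> \<omega> = \<omega>'"
proof
  have sub: "\<exists>i. M i \<subseteq> N j" if "chain_at N \<omega>" "chain_at M \<omega>" for N M j \<omega>
    using that unfolding chain_at_def by (meson order_trans)
  { assume "\<omega> = \<omega>'"
    then show "(N, M) \<in> chain_equiv V"
      using N M sub unfolding chain_equiv_def by auto }
  assume eq: "(N, M) \<in> chain_equiv V"
  have "chain_at N \<omega>'"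
    unfolding chain_at_def
  proof (intro conjI allI impI)
    show "cmod \<omega>' = 1" using M by (simp add: chain_at_def)
    fix e :: real assume "e > 0"
    then obtain j where "M j \<subseteq> p ` (ball 0 1 \<inter> ball \<omega>' e)" using M by (auto simp: chain_at_def)
    moreover have "\<exists>i. N i \<subseteq> M j" using eq by (simp add: chain_equiv_def)
    ultimately show "\<exists>j. N j \<subseteq> p ` (ball 0 1 \<inter> ball \<omega>' e)" by blast
  next
    fix j
    have "\<exists>i. M i \<subseteq> N j" using eq by (simp add: chain_equiv_def)
    then obtain i where "M i \<subseteq> N j" by blast
    moreover have "\<exists>e>0. p ` (ball 0 1 \<inter> ball \<omega>' e) \<subseteq> M i" using M by (auto simp: chain_at_def)
    ultimately show "\<exists>e>0. p ` (ball 0 1 \<inter> ball \<omega>' e) \<subseteq> N j" by blast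
  qed
  then show "\<omega> = \<omega>'" using chain_at_unique N(2) by blast
qed


lemma inj_on_regular: "inj_on p (ball 0 1 \<union> (sphere 0 1 - Z))"
proof -
  have "p ` ball 0 1 \<inter> p ` (sphere 0 1 - Z) = {}" using image bdry by blast
  then show ?thesis unfolding inj_on_Un using inj inj_sphere by blast
qed

text \<open>Circles about \<open>\<omega>\<close> that avoid the exceptional set, except possibly at \<open>\<omega>\<close> itself, meet the closed disk
  in arcs on which \<open>p\<close> is injective.\<close>

lemma small_crosscut_nbhds:
  assumes w: "cmod \<omega> = 1"
  obtains r0 where "0 < r0" "r0 \<le> 1"
    and "\<And>r. 0 < r \<Longrightarrow> r < r0 \<Longrightarrow>
      crosscut_nbhd V (p ` (ball 0 1 \<inter> sphere \<omega> r)) (p ` (ball 0 1 \<inter> ball \<omega> r))"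
    and "\<And>r. 0 < r \<Longrightarrow> r < r0 \<Longrightarrow> sphere \<omega> r \<inter> Z = {}"
proof -
  obtain d where d: "d > 0" "\<And>x. x \<in> Z \<Longrightarrow> x \<noteq> \<omega> \<Longrightarrow> d \<le> dist \<omega> x"
    using finite_set_avoid[OF fin, of \<omega>] by metis
  have Z: "sphere \<omega> r \<inter> Z = {}" if "0 < r" "r < min d 1" for r
    using d(2) that by fastforce
  have cn: "crosscut_nbhd V (p ` (ball 0 1 \<inter> sphere \<omega> r)) (p ` (ball 0 1 \<inter> ball \<omega> r))"
    if r: "0 < r" "r < min d 1" for r
  proof -
    have r2: "0 < r" "r < 2" using r by auto
    note arc = arc_at[OF w r2]
    have "{0..1::real} = {0<..<1} \<union> {0,1}" by auto
    then have "arc_at \<omega> r ` {0..1} = arc_at \<omega> r ` {0<..<1} \<union> {arc_at \<omega> r 0, arc_at \<omega> r 1}"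
      by (metis image_Un image_insert image_empty)
    then have im: "arc_at \<omega> r ` {0..1} \<subseteq> ball 0 1 \<union> (sphere 0 1 - Z)"
      using arc(1,2,3) Z[OF r] by auto
    have im': "arc_at \<omega> r ` {0..1} \<subseteq> cball 0 1" using im by force
    have "path (p \<circ> arc_at \<omega> r)"
      unfolding path_def by (intro continuous_on_compose arc(5) continuous_on_subset[OF cont im'])
    moreover have "inj_on (p \<circ> arc_at \<omega> r) {0..1}"
      by (intro comp_inj_on arc(4) inj_on_subset[OF inj_on_regular im])
    ultimately have "simple_path (p \<circ> arc_at \<omega> r)"
      unfolding simple_path_def loop_free_def by (blast dest: inj_onD)
    moreover have "(p \<circ> arc_at \<omega> r) ` {0<..<1} = p ` (ball 0 1 \<inter> sphere \<omega> r)"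
      unfolding image_comp[symmetric] arc(1) ..
    moreover have "pathstart (p \<circ> arc_at \<omega> r) \<in> closure V - V" "pathfinish (p \<circ> arc_at \<omega> r) \<in> closure V - V"
      unfolding boundary_eq using arc(2,3) by (auto simp: pathstart_def pathfinish_def)
    ultimately have cc: "crosscut V (p ` (ball 0 1 \<inter> sphere \<omega> r))"
      unfolding crosscut_def using image by (intro exI[of _ "p \<circ> arc_at \<omega> r"]) auto
    from components_homeomorphic_image[OF homeo half_disk_component[OF w r(1)]]
    have "p ` (ball 0 1 \<inter> ball \<omega> r) \<in> components (p ` (ball 0 1 - ball 0 1 \<inter> sphere \<omega> r))" by auto
    moreover have "p ` (ball 0 1 - ball 0 1 \<inter> sphere \<omega> r) = V - p ` (ball 0 1 \<inter> sphere \<omega> r)"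
      unfolding image[symmetric] by (rule inj_on_image_set_diff[OF inj]) auto
    ultimately show ?thesis using cc by (simp add: crosscut_nbhd_def)
  qed
  show ?thesis using that[of "min d 1"] d(1) cn Z by auto
qed

lemma chain_at_surj:
  assumes w: "cmod \<omega> = 1"
  shows "\<exists>N \<in> fundamental_chains V. chain_at N \<omega>"
proof -
  obtain r0 where r0: "0 < r0" "r0 \<le> 1"
    "\<And>r. 0 < r \<Longrightarrow> r < r0 \<Longrightarrow>
      crosscut_nbhd V (p ` (ball 0 1 \<inter> sphere \<omega> r)) (p ` (ball 0 1 \<inter> ball \<omega> r))"
    "\<And>r. 0 < r \<Longrightarrow> r < r0 \<Longrightarrow> sphere \<omega> r \<inter> Z = {}"
    using small_crosscut_nbhds[OF w] by blast
  define r where "r j = r0 / real (j + 2)" for j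
  have r: "0 < r j" "r j < r0" for j
  proof -
    have "r0 * 1 < r0 * real (j + 2)" using r0(1) by (intro mult_strict_left_mono) auto
    then show "0 < r j" "r j < r0" using r0(1) by (auto simp: r_def pos_divide_less_eq)
  qed
  have rdec: "r (Suc j) < r j" for j using r0(1) by (auto simp: r_def field_simps)
  have rinj: "r i \<noteq> r j" if "i \<noteq> j" for i j using r0(1) that by (auto simp: r_def)
  have rlim: "r \<longlonglongrightarrow> 0"
    unfolding r_def
    by (intro real_tendsto_divide_at_top[OF tendsto_const]
        filterlim_compose[OF filterlim_real_sequentially] filterlim_add_const_nat_at_top)
  define A where "A j = p ` (ball 0 1 \<inter> sphere \<omega> (r j))" for j
  define N where "N j = p ` (ball 0 1 \<inter> ball \<omega> (r j))" for j
  have clA: "closure (A j) \<subseteq> p ` (cball 0 1 \<inter> sphere \<omega> (r j))" for j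
  proof (rule closure_minimal)
    show "A j \<subseteq> p ` (cball 0 1 \<inter> sphere \<omega> (r j))"
      unfolding A_def using ball_subset_cball by blast
    have "compact (p ` (cball 0 1 \<inter> sphere \<omega> (r j)))"
      by (intro compact_continuous_image continuous_on_subset[OF cont] compact_Int_closed) auto
    then show "closed (p ` (cball 0 1 \<inter> sphere \<omega> (r j)))" by (rule compact_imp_closed)
  qed
  have disj: "closure (A i) \<inter> closure (A j) = {}" if "i \<noteq> j" for i j
  proof (rule ccontr)
    assume "closure (A i) \<inter> closure (A j) \<noteq> {}"
    then obtain a where "a \<in> closure (A i)" "a \<in> closure (A j)" by blast
    then obtain x y where xy: "x \<in> cball 0 1" "x \<in> sphere \<omega> (r i)" "y \<in> cball 0 1" "y \<in> sphere \<omega> (r j)"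
      "p x = p y" using clA[of i] clA[of j] by blast
    have "x \<in> ball 0 1 \<union> (sphere 0 1 - Z)" "y \<in> ball 0 1 \<union> (sphere 0 1 - Z)"
      using xy cball_cases r0(4)[OF r(1) r(2), of i] r0(4)[OF r(1) r(2), of j] by blast+
    then have "x = y" using xy(5) inj_on_regular by (meson inj_onD)
    then show False using xy rinj[OF that] by auto
  qed
  have AV: "crosscut V (A j)" for j
    using r0(3)[OF r] by (simp add: A_def crosscut_nbhd_def)
  have "(\<lambda>j. diameter (A j)) \<longlonglongrightarrow> 0"
  proof (rule LIMSEQ_I)
    fix e :: real assume "e > 0"
    have "continuous (at \<omega> within cball 0 1) p"
      using cont w by (simp add: continuous_on_eq_continuous_within)
    then obtain d where d: "d > 0" "\<And>x. x \<in> cball 0 1 \<Longrightarrow> dist x \<omega> < d \<Longrightarrow> dist (p x) (p \<omega>) < e/4"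
      unfolding continuous_within_eps_delta using \<open>e > 0\<close> by (metis zero_less_divide_iff zero_less_numeral)
    obtain J where J: "\<And>j. j \<ge> J \<Longrightarrow> norm (r j - 0) < d" using LIMSEQ_D[OF rlim d(1)] by blast
    show "\<exists>no. \<forall>j\<ge>no. norm (diameter (A j) - 0) < e"
    proof (rule exI[of _ J], intro allI impI)
      fix j assume "j \<ge> J"
      have *: "dist a (p \<omega>) < e/4" if "a \<in> A j" for a
        using that J[OF \<open>j \<ge> J\<close>] r(1)[of j] d(2) unfolding A_def by (auto simp: dist_commute)
      have "dist a b \<le> e/2" if "a \<in> A j" "b \<in> A j" for a b
      proof -
        have "dist a (p \<omega>) < e/4" "dist b (p \<omega>) < e/4" using that * by auto
        then show ?thesis using dist_triangle2[of a b "p \<omega>"] by linarith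
      qed
      then have "diameter (A j) \<le> e/2"
        using crosscut_preimage(7)[OF AV] by (intro diameter_le_metric) auto
      moreover have "diameter (A j) \<ge> 0" using crosscut_preimage(8)[OF AV] diameter_ge_0 by blast
      ultimately show "norm (diameter (A j) - 0) < e" using \<open>e > 0\<close> by auto
    qed
  qed
  moreover have "N (Suc j) \<subseteq> N j" for j
    unfolding N_def using rdec[of j] subset_ball[of "r (Suc j)" "r j" \<omega>] by (intro image_mono) auto
  moreover have "crosscut_nbhd V (A j) (N j)" for j
    unfolding A_def N_def by (rule r0(3)[OF r])
  ultimately have "N \<in> fundamental_chains V"
    unfolding fundamental_chains_def using disj by blast
  moreover have "chain_at N \<omega>"
    unfolding chain_at_def
  proof (intro conjI allI impI)
    fix e :: real assume "e > 0"
    obtain J where "norm (r J - 0) < e" using LIMSEQ_D[OF rlim \<open>e > 0\<close>] by blast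
    then have "ball \<omega> (r J) \<subseteq> ball \<omega> e" by (intro subset_ball) auto
    then show "\<exists>j. N j \<subseteq> p ` (ball 0 1 \<inter> ball \<omega> e)" unfolding N_def by blast
  next
    show "\<exists>e>0. p ` (ball 0 1 \<inter> ball \<omega> e) \<subseteq> N j" for j unfolding N_def using r(1) by blast
  qed (rule w)
  ultimately show ?thesis by blast
qed

definition end_at :: "complex \<Rightarrow> 'a prime_end" where
  "end_at \<omega> = {N \<in> fundamental_chains V. chain_at N \<omega>}"

lemma chain_equiv_class:
  assumes "N \<in> fundamental_chains V" "chain_at N \<omega>"
  shows "chain_equiv V `` {N} = end_at \<omega>"
proof -
  have "(N, M) \<in> chain_equiv V \<longleftrightarrow> M \<in> end_at \<omega>" for M
    using chain_equiv_iff[OF assms, of M] chain_at_exists[of M]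
    unfolding end_at_def mem_Collect_eq by (metis (no_types, lifting) case_prodD chain_equiv_def mem_Collect_eq)
  then show ?thesis by blast
qed

lemma bij_betw_end_at: "bij_betw end_at (sphere 0 1) (prime_ends V)"
  unfolding bij_betw_def
proof
  show "inj_on end_at (sphere 0 1)"
  proof (rule inj_onI)
    fix x y assume xy: "x \<in> sphere (0::complex) 1" "y \<in> sphere 0 1" "end_at x = end_at y"
    obtain N where "N \<in> end_at x" using chain_at_surj[of x] xy(1) by (auto simp: end_at_def)
    then show "x = y" using xy(3) chain_at_unique by (auto simp: end_at_def)
  qed
  show "end_at ` sphere 0 1 = prime_ends V"
  proof
    show "end_at ` sphere 0 1 \<subseteq> prime_ends V"
    proof clarify
      fix x :: complex assume "x \<in> sphere 0 1"
      then obtain N where "N \<in> fundamental_chains V" "chain_at N x" using chain_at_surj[of x] by auto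
      then show "end_at x \<in> prime_ends V"
        using chain_equiv_class unfolding prime_ends_def by (metis quotientI)
    qed
    show "prime_ends V \<subseteq> end_at ` sphere 0 1"
    proof
      fix E assume "E \<in> prime_ends V"
      then obtain N where N: "N \<in> fundamental_chains V" "E = chain_equiv V `` {N}"
        unfolding prime_ends_def by (auto elim: quotientE)
      obtain w where w: "chain_at N w" using chain_at_exists N by blast
      then have "w \<in> sphere 0 1" by (simp add: chain_at_def)
      then show "E \<in> end_at ` sphere 0 1" using chain_equiv_class[OF N(1) w] N(2) by blast
    qed
  qed
qed


lemma prime_endE:
  assumes "E \<in> prime_ends V"
  obtains \<omega> where "cmod \<omega> = 1" "E = end_at \<omega>"
proof -
  have "E \<in> end_at ` sphere 0 1" using assms bij_betw_imp_surj_on[OF bij_betw_end_at] by simp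
  then obtain w where "w \<in> sphere 0 1" "E = end_at w" by blast
  then show ?thesis using that[of w] by simp
qed

definition disk_coordinate :: "'a + 'a prime_end \<Rightarrow> complex" where
  "disk_coordinate = case_sum q (the_inv_into (sphere 0 1) end_at)"

definition from_disk :: "complex \<Rightarrow> 'a + 'a prime_end" where
  "from_disk z = (if z \<in> ball 0 1 then Inl (p z) else Inr (end_at z))"

lemma disk_coordinate_Inl: "disk_coordinate (Inl v) = q v"
  by (simp add: disk_coordinate_def)

lemma disk_coordinate_Inr: "cmod \<omega> = 1 \<Longrightarrow> disk_coordinate (Inr (end_at \<omega>)) = \<omega>"
  using bij_betw_end_at unfolding disk_coordinate_def bij_betw_def by (simp add: the_inv_into_f_f)

lemma topspace_compactification:
  "topspace (caratheodory_compactification V) = Inl ` V \<union> Inr ` prime_ends V"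
proof -
  have "Inl ` V \<union> Inr ` prime_ends V \<subseteq> topspace (caratheodory_compactification V)"
  proof -
    have "Inl v \<in> topspace (caratheodory_compactification V)" if "v \<in> V" for v
      unfolding caratheodory_compactification_def topology_generated_by_topspace
      using that by (intro UnionI[of "Inl ` V"] UnI1) (auto intro!: exI[of _ V])
    moreover have "Inr E \<in> topspace (caratheodory_compactification V)" if E: "E \<in> prime_ends V" for E
    proof -
      obtain \<omega> where w: "cmod \<omega> = 1" "E = end_at \<omega>" using prime_endE[OF E] .
      obtain N where N: "N \<in> fundamental_chains V" "chain_at N \<omega>" using chain_at_surj[OF w(1)] by blast
      then obtain A where "crosscut_nbhd V A (N 0)" unfolding fundamental_chains_def by blast
      moreover have "Inr E \<in> prime_end_nbhd V (N 0)"
        unfolding prime_end_nbhd_def using E N w by (auto simp: end_at_def)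
      ultimately show ?thesis
        unfolding caratheodory_compactification_def topology_generated_by_topspace by blast
    qed
    ultimately show ?thesis by blast
  qed
  moreover have "topspace (caratheodory_compactification V) \<subseteq> Inl ` V \<union> Inr ` prime_ends V"
    unfolding caratheodory_compactification_def topology_generated_by_topspace
    using preimage_component(3) openin_imp_subset by (auto simp: prime_end_nbhd_def) blast+
  ultimately show ?thesis by blast
qed

text \<open>With this criterion both topologies can be compared on neighbourhoods of \<open>\<omega>\<close> in the disk.\<close>

lemma prime_end_enters_iff:
  assumes "cmod \<omega> = 1"
  shows "(\<exists>M\<in>end_at \<omega>. \<exists>j. M j \<subseteq> N) \<longleftrightarrow> (\<exists>e>0. p ` (ball 0 1 \<inter> ball \<omega> e) \<subseteq> N)"
proof
  assume "\<exists>M\<in>end_at \<omega>. \<exists>j. M j \<subseteq> N"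
  then obtain M j where "chain_at M \<omega>" "M j \<subseteq> N" unfolding end_at_def by blast
  moreover then have "\<exists>e>0. p ` (ball 0 1 \<inter> ball \<omega> e) \<subseteq> M j" unfolding chain_at_def by blast
  ultimately show "\<exists>e>0. p ` (ball 0 1 \<inter> ball \<omega> e) \<subseteq> N" by blast
next
  assume "\<exists>e>0. p ` (ball 0 1 \<inter> ball \<omega> e) \<subseteq> N"
  then obtain e where e: "e > 0" "p ` (ball 0 1 \<inter> ball \<omega> e) \<subseteq> N" by blast
  obtain M where M: "M \<in> fundamental_chains V" "chain_at M \<omega>" using chain_at_surj[OF assms] by blast
  then obtain j where "M j \<subseteq> p ` (ball 0 1 \<inter> ball \<omega> e)" using e(1) unfolding chain_at_def by blast
  then have "M j \<subseteq> N" using e(2) by blast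
  then show "\<exists>M\<in>end_at \<omega>. \<exists>j. M j \<subseteq> N" using M unfolding end_at_def by blast
qed

lemma continuous_from_disk:
  "continuous_map (top_of_set (cball 0 1)) (caratheodory_compactification V) from_disk"
  unfolding caratheodory_compactification_def
proof (rule continuous_on_generated_topo)
  let ?S = "{Inl ` W |W. openin (top_of_set V) W} \<union> {prime_end_nbhd V N |N. \<exists>A. crosscut_nbhd V A N}"
  have "from_disk z \<in> Inl ` V \<union> Inr ` prime_ends V" if z: "z \<in> cball 0 1" for z
    using cball_cases[OF z] image bij_betwE[OF bij_betw_end_at] by (auto simp: from_disk_def)
  then show "from_disk ` topspace (top_of_set (cball 0 1)) \<subseteq> \<Union> ?S"
    using topspace_compactification
    unfolding caratheodory_compactification_def topology_generated_by_topspace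
    by (simp only: topspace_euclidean_subtopology image_subset_iff) blast
  fix S assume "S \<in> ?S"
  then consider W where "S = Inl ` W" "openin (top_of_set V) W"
    | N A where "S = prime_end_nbhd V N" "crosscut_nbhd V A N" by blast
  then show "openin (top_of_set (cball 0 1)) (from_disk -` S \<inter> topspace (top_of_set (cball 0 1)))"
  proof cases
    case 1
    have "continuous_on (ball 0 1) p" using homeo by (simp add: homeomorphism_def)
    then have "openin (top_of_set (ball 0 1)) (ball 0 1 \<inter> p -` W)"
      using 1 image by (intro continuous_openin_preimage[of _ _ V]) auto
    then have "open (ball 0 1 \<inter> p -` W)" by (simp add: openin_open_eq)
    moreover have "from_disk -` S \<inter> topspace (top_of_set (cball 0 1)) = ball 0 1 \<inter> p -` W"
      using 1 by (auto simp: from_disk_def split: if_splits)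
    ultimately show ?thesis
      using ball_subset_cball[of "0::complex" 1] by (auto intro!: open_subset)
  next
    case 2
    note comp = preimage_component[OF 2(2)]
    have mem: "z \<in> q ` N" if "z \<in> ball 0 1" "p z \<in> N" for z using q(3)[of z] that by force
    show ?thesis
    proof (subst openin_contains_ball, intro conjI ballI)
      fix z assume z: "z \<in> from_disk -` S \<inter> topspace (top_of_set (cball 0 1))"
      show "\<exists>e>0. ball z e \<inter> cball 0 1 \<subseteq> from_disk -` S \<inter> topspace (top_of_set (cball 0 1))"
      proof (cases "z \<in> ball 0 1")
        case True
        then have "z \<in> q ` N" using z 2 mem by (auto simp: from_disk_def prime_end_nbhd_def)
        then obtain e where e: "e > 0" "ball z e \<subseteq> q ` N" using comp(5) openE by blast
        have "x \<in> from_disk -` S" if "x \<in> q ` N" for x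
          using that comp(3) q 2 by (auto simp: from_disk_def prime_end_nbhd_def)
        then have "ball z e \<inter> cball 0 1 \<subseteq> from_disk -` S \<inter> topspace (top_of_set (cball 0 1))"
          using e(2) by auto
        then show ?thesis using e(1) by blast
      next
        case False
        then have z1: "cmod z = 1" using z by auto
        have "Inr (end_at z) \<in> prime_end_nbhd V N" using z False 2(1) by (simp add: from_disk_def)
        then have "\<exists>M\<in>end_at z. \<exists>j. M j \<subseteq> N" unfolding prime_end_nbhd_def by auto
        then obtain e where e: "e > 0" "p ` (ball 0 1 \<inter> ball z e) \<subseteq> N"
          unfolding prime_end_enters_iff[OF z1] by blast
        have "x \<in> from_disk -` S" if x: "x \<in> ball z e \<inter> cball 0 1" for x
        proof (cases "x \<in> ball 0 1")
          case True
          then have "p x \<in> N" using x e(2) by blast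
          then show ?thesis using True 2(1) by (simp add: from_disk_def prime_end_nbhd_def)
        next
          case False
          then have x1: "cmod x = 1" using x by auto
          obtain d where d: "d > 0" "ball x d \<subseteq> ball z e" using x openE[of "ball z e" x] by auto
          then have "p ` (ball 0 1 \<inter> ball x d) \<subseteq> N" using e(2) by blast
          then have "\<exists>M\<in>end_at x. \<exists>j. M j \<subseteq> N" using d(1) prime_end_enters_iff[OF x1] by blast
          moreover have "end_at x \<in> prime_ends V" using bij_betwE[OF bij_betw_end_at] x1 by simp
          ultimately show ?thesis using False 2 by (simp add: from_disk_def prime_end_nbhd_def)
        qed
        then show ?thesis using e(1) by auto
      qed
    qed auto
  qed
qed

lemma continuous_disk_coordinate:
  "continuous_map (caratheodory_compactification V) (top_of_set (cball 0 1)) disk_coordinate"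
  unfolding continuous_map_def
proof (intro conjI allI impI)
  show "disk_coordinate \<in> topspace (caratheodory_compactification V) \<rightarrow> topspace (top_of_set (cball 0 1))"
  proof
    fix x assume "x \<in> topspace (caratheodory_compactification V)"
    then consider v where "x = Inl v" "v \<in> V" | E where "x = Inr E" "E \<in> prime_ends V"
      using topspace_compactification by blast
    then show "disk_coordinate x \<in> topspace (top_of_set (cball 0 1))"
    proof cases
      case 1
      then show ?thesis using q(1)[of v] by (simp add: disk_coordinate_Inl)
    next
      case 2
      then show ?thesis by (auto elim!: prime_endE simp: disk_coordinate_Inr)
    qed
  qed
  fix U assume "openin (top_of_set (cball 0 1)) (U :: complex set)"
  then obtain T where T: "open T" "U = cball 0 1 \<inter> T" by (auto simp: openin_open)
  show "openin (caratheodory_compactification V)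
    {x \<in> topspace (caratheodory_compactification V). disk_coordinate x \<in> U}" (is "openin _ ?P")
  proof (subst openin_subopen, intro ballI)
    fix x assume x: "x \<in> ?P"
    then consider v where "x = Inl v" "v \<in> V" | E where "x = Inr E" "E \<in> prime_ends V"
      using topspace_compactification by blast
    then show "\<exists>S. openin (caratheodory_compactification V) S \<and> x \<in> S \<and> S \<subseteq> ?P"
    proof cases
      case 1
      have "continuous_on V q" using homeo by (simp add: homeomorphism_def)
      then have "openin (top_of_set V) (V \<inter> q -` T)" using T(1) by (rule continuous_openin_preimage_gen)
      then have "openin (caratheodory_compactification V) (Inl ` (V \<inter> q -` T))"
        unfolding caratheodory_compactification_def by (intro topology_generated_by_Basis) blast
      moreover have "Inl ` (V \<inter> q -` T) \<subseteq> ?P"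
        using topspace_compactification q(1)[THEN subsetD[OF ball_subset_cball]] T(2)
        by (auto simp: disk_coordinate_Inl simp del: mem_cball mem_ball)
      moreover have "x \<in> Inl ` (V \<inter> q -` T)" using x 1 T(2) by (simp add: disk_coordinate_Inl)
      ultimately show ?thesis by blast
    next
      case 2
      obtain \<omega> where w: "cmod \<omega> = 1" "E = end_at \<omega>" using prime_endE[OF 2(2)] .
      have "\<omega> \<in> T" using x 2 w T by (simp add: disk_coordinate_Inr)
      then obtain e where e: "e > 0" "cball \<omega> e \<subseteq> T" using T(1) open_contains_cball by blast
      obtain r0 where r0: "0 < r0" "\<And>r. 0 < r \<Longrightarrow> r < r0 \<Longrightarrow>
          crosscut_nbhd V (p ` (ball 0 1 \<inter> sphere \<omega> r)) (p ` (ball 0 1 \<inter> ball \<omega> r))"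
        using small_crosscut_nbhds[OF w(1)] by metis
      define r where "r = min e r0 / 2"
      have r: "0 < r" "r < r0" "r \<le> e" using e r0 by (auto simp: r_def)
      define N where "N = p ` (ball 0 1 \<inter> ball \<omega> r)"
      have cn: "crosscut_nbhd V (p ` (ball 0 1 \<inter> sphere \<omega> r)) N" unfolding N_def using r0(2) r by blast
      have "openin (caratheodory_compactification V) (prime_end_nbhd V N)"
        unfolding caratheodory_compactification_def using cn by (intro topology_generated_by_Basis) blast
      moreover have "x \<in> prime_end_nbhd V N"
      proof -
        have "\<exists>M\<in>E. \<exists>j. M j \<subseteq> N"
          unfolding w(2) prime_end_enters_iff[OF w(1)] N_def using r(1) by blast
        then show ?thesis unfolding prime_end_nbhd_def 2(1) using 2(2) by blast
      qed
      moreover have "prime_end_nbhd V N \<subseteq> ?P"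
      proof
        fix y assume y: "y \<in> prime_end_nbhd V N"
        have NT: "z \<in> T" if "z \<in> ball \<omega> r" for z using that r e(2) by auto
        show "y \<in> ?P"
        proof (cases y)
          case (Inl v)
          then obtain z where z: "z \<in> ball 0 1" "z \<in> ball \<omega> r" "v = p z"
            using y by (auto simp: prime_end_nbhd_def N_def)
          then have "v \<in> V" "q v = z" using image q(3) by auto
          then show ?thesis using Inl z NT T(2) topspace_compactification
            by (auto simp: disk_coordinate_Inl dest: less_imp_le)
        next
          case (Inr E')
          then have E': "E' \<in> prime_ends V" "\<exists>M\<in>E'. \<exists>j. M j \<subseteq> N" using y by (auto simp: prime_end_nbhd_def)
          obtain z where z: "cmod z = 1" "E' = end_at z" using prime_endE[OF E'(1)] .
          obtain d where d: "d > 0" "p ` (ball 0 1 \<inter> ball z d) \<subseteq> N"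
            using E'(2) z prime_end_enters_iff[OF z(1)] by blast
          have sub: "ball 0 1 \<inter> ball z d \<subseteq> ball \<omega> r"
          proof
            fix u assume u: "u \<in> ball 0 1 \<inter> ball z d"
            then obtain u' where "u' \<in> ball 0 1 \<inter> ball \<omega> r" "p u = p u'" using d(2) unfolding N_def by blast
            then show "u \<in> ball \<omega> r" using u inj by (metis IntE inj_onD)
          qed
          have "dist \<omega> z \<le> r + e'" if "e' > 0" for e'
          proof -
            have "ball 0 1 \<inter> ball z (min d e') \<noteq> {}"
              using d(1) that by (intro ball_inter_ball_nonempty z) auto
            then obtain u where "u \<in> ball 0 1" "u \<in> ball z (min d e')" by blast
            then have "u \<in> ball \<omega> r" "dist u z < e'" using sub by (auto simp: dist_commute)
            then show ?thesis using dist_triangle[of \<omega> z u] by auto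
          qed
          then have "dist \<omega> z \<le> r" by (rule field_le_epsilon)
          then have "z \<in> T" using r e(2) by auto
          then show ?thesis using Inr z T(2) E' topspace_compactification
            by (auto simp: disk_coordinate_Inr)
        qed
      qed
      ultimately show ?thesis by blast
    qed
  qed
qed

text \<open>Near a boundary point both topologies are generated by the pieces that small circles about this point
  cut off from the disk.\<close>

theorem homeomorphic_map_disk_coordinate:
  "homeomorphic_map (caratheodory_compactification V) (top_of_set (cball 0 1)) disk_coordinate"
proof -
  have "homeomorphic_maps (caratheodory_compactification V) (top_of_set (cball 0 1)) disk_coordinate from_disk"
    unfolding homeomorphic_maps_def
  proof (intro conjI ballI continuous_disk_coordinate continuous_from_disk)
    fix x assume "x \<in> topspace (caratheodory_compactification V)"
    then consider v where "x = Inl v" "v \<in> V" | E where "x = Inr E" "E \<in> prime_ends V"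
      using topspace_compactification by blast
    then show "from_disk (disk_coordinate x) = x"
    proof cases
      case 1
      then show ?thesis using q(1,2) by (simp add: disk_coordinate_Inl from_disk_def)
    next
      case 2
      then show ?thesis by (auto elim!: prime_endE simp: disk_coordinate_Inr from_disk_def)
    qed
  next
    fix z assume "z \<in> topspace (top_of_set (cball (0::complex) 1))"
    then show "disk_coordinate (from_disk z) = z"
      using q(3) by (auto simp: from_disk_def disk_coordinate_Inl disk_coordinate_Inr)
  qed
  then show ?thesis using homeomorphic_map_maps by blast
qed

text \<open>Every member of the image of a chain at \<open>\<omega>\<close> contains the points \<open>p (T z)\<close> with \<open>z\<close> close to \<open>\<omega>\<close>, so the
  image chain can only be a chain at the limit of \<open>T\<close>.\<close>

lemma prime_end_map_end_at:
  assumes f: "closure_homeo V f g" and w: "cmod \<omega> = 1"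
    and T: "\<And>z. z \<in> ball 0 1 \<Longrightarrow> T z \<in> ball 0 1 \<and> p (T z) = f (p z)"
    and lim: "(T \<longlongrightarrow> \<omega>') (at \<omega> within ball 0 1)"
  shows "prime_end_map f (end_at \<omega>) = end_at \<omega>'" and "cmod \<omega>' = 1"
proof -
  interpret f: closure_homeo V f g by (rule f)
  interpret g: closure_homeo V g f by (rule f.inverse_homeo)
  have at: "chain_at (\<lambda>j. f ` N j) \<omega>'" if N: "N \<in> fundamental_chains V" "chain_at N \<omega>" for N
  proof -
    obtain v where v: "chain_at (\<lambda>j. f ` N j) v" using chain_at_exists f.fundamental_chain_image[OF N(1)] by blast
    have "dist v \<omega>' \<le> 0 + e" if "e > 0" for e
    proof -
      obtain j where j: "f ` N j \<subseteq> p ` (ball 0 1 \<inter> ball v (e/2))"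
        using v \<open>e > 0\<close> unfolding chain_at_def by (meson half_gt_zero)
      obtain d where d: "d > 0" "p ` (ball 0 1 \<inter> ball \<omega> d) \<subseteq> N j" using N(2) unfolding chain_at_def by blast
      obtain d' where d': "d' > 0" "\<And>z. z \<in> ball 0 1 \<Longrightarrow> 0 < dist z \<omega> \<and> dist z \<omega> < d' \<Longrightarrow> dist (T z) \<omega>' < e/2"
        using lim[unfolded Lim_within, rule_format, of "e/2"] \<open>e > 0\<close> by auto
      have "ball 0 1 \<inter> ball \<omega> (min d d') \<noteq> {}"
        using d d' by (intro ball_inter_ball_nonempty w) auto
      then obtain z where z: "z \<in> ball 0 1" "z \<in> ball \<omega> (min d d')" by blast
      then have "z \<noteq> \<omega>" using w by auto
      then have 1: "dist (T z) \<omega>' < e/2" using d'(2)[OF z(1)] z(2) by (simp add: dist_commute)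
      have "p (T z) \<in> p ` (ball 0 1 \<inter> ball v (e/2))"
      proof -
        have "p z \<in> N j" using z d(2) by auto
        then show ?thesis using T[OF z(1)] j by auto
      qed
      then obtain u where "u \<in> ball 0 1" "u \<in> ball v (e/2)" "p (T z) = p u" by blast
      moreover have "T z = u" using calculation T[OF z(1)] by (intro inj_onD[OF inj]) auto
      ultimately have "dist v (T z) < e/2" by simp
      then show ?thesis using 1 dist_triangle[of v \<omega>' "T z"] by linarith
    qed
    then have "dist v \<omega>' \<le> 0" by (rule field_le_epsilon)
    then show ?thesis using v by simp
  qed
  then show "cmod \<omega>' = 1" using chain_at_surj[OF w] unfolding chain_at_def by blast
  have fg: "f (g x) = x" "g (f x) = x" if "x \<in> V" for x
    using f.hom that closure_subset[of V] by (auto simp: homeomorphism_def)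
  have NV: "N j \<subseteq> V" if "N \<in> fundamental_chains V" for N j
  proof -
    obtain A where "crosscut_nbhd V A (N j)" using \<open>N \<in> _\<close> unfolding fundamental_chains_def by blast
    then show ?thesis by (rule preimage_component(3))
  qed
  show "prime_end_map f (end_at \<omega>) = end_at \<omega>'"
  proof
    show "prime_end_map f (end_at \<omega>) \<subseteq> end_at \<omega>'"
      using at f.fundamental_chain_image by (auto simp: prime_end_map_def end_at_def)
    show "end_at \<omega>' \<subseteq> prime_end_map f (end_at \<omega>)"
    proof
      fix M assume "M \<in> end_at \<omega>'"
      then have M: "M \<in> fundamental_chains V" "chain_at M \<omega>'" by (auto simp: end_at_def)
      obtain N where N: "N \<in> fundamental_chains V" "chain_at N \<omega>" using chain_at_surj[OF w] by blast
      define K where "K j = g ` M j" for j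
      have "f ` g ` S = S" "g ` f ` S = S" if "S \<subseteq> V" for S
        using fg subsetD[OF that] by (simp_all add: image_image)
      then have fK: "(\<lambda>j. f ` K j) = M" and gfN: "(\<lambda>j. g ` f ` N j) = N"
        using NV[OF M(1)] NV[OF N(1)] by (simp_all add: K_def)
      have "K \<in> fundamental_chains V" unfolding K_def by (rule g.fundamental_chain_image[OF M(1)])
      have "(M, \<lambda>j. f ` N j) \<in> chain_equiv V"
        using chain_equiv_iff[OF M f.fundamental_chain_image[OF N(1)] at[OF N]] by simp
      from g.chain_equiv_image[OF this] have "(K, N) \<in> chain_equiv V" by (simp add: K_def[abs_def] gfN)
      moreover obtain v where "chain_at K v" using chain_at_exists \<open>K \<in> _\<close> by blast
      ultimately have "chain_at K \<omega>" using chain_equiv_iff[OF \<open>K \<in> _\<close> _ N] by blast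
      then have "K \<in> end_at \<omega>" using \<open>K \<in> _\<close> by (simp add: end_at_def)
      then show "M \<in> prime_end_map f (end_at \<omega>)"
        unfolding prime_end_map_def using fK by (metis imageI)
    qed
  qed
qed

end


section \<open>Koebe's lemma\<close>

lemma not_bounded_imp_log:
  fixes E :: "complex set"
  assumes "compact E" "0 \<notin> E" "\<not> bounded (connected_component_set (- E) 0)"
  obtains g where "continuous_on E g" "\<And>z. z \<in> E \<Longrightarrow> z = of_real (cmod z) * cis (g z)"
proof -
  have "\<exists>c. homotopic_with_canon (\<lambda>x. True) E (sphere 0 1)
     (\<lambda>x. inverse(norm(x - 0)) *\<^sub>R (x - 0)) (\<lambda>x. c)"
    using Borsuk_map_essential_bounded_component[OF assms(1,2)] assms(3) by blast
  then obtain g where g: "continuous_on E g"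
      "\<And>z. z \<in> E \<Longrightarrow> inverse(norm(z - 0)) *\<^sub>R (z - 0) = exp(\<i> * of_real (g z))"
    unfolding inessential_eq_continuous_logarithm_circle by blast
  have "z = of_real (cmod z) * cis (g z)" if "z \<in> E" for z
  proof -
    have "z \<noteq> 0" using that assms(2) by blast
    then show ?thesis using g(2)[OF that] by (simp add: cis_conv_exp scaleR_conv_of_real field_simps)
  qed
  then show ?thesis using g(1) that by blast
qed

text \<open>A continuous argument on a rotation invariant connected set would change by a constant
  \<open>d \<noteq> 0\<close> under the rotation, but by \<open>m d = 0\<close> under its \<open>m\<close>-th iterate.\<close>

lemma rotation_invariant_surrounds:
  fixes E :: "complex set"
  assumes E: "compact E" "connected E" "E \<noteq> {}" "0 \<notin> E"
    and m: "m \<ge> 2" and inv: "\<And>z. z \<in> E \<Longrightarrow> cis (2 * pi / real m) * z \<in> E"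
  shows "bounded (connected_component_set (- E) 0)"
proof (rule ccontr)
  assume "\<not> ?thesis"
  then obtain g where g: "continuous_on E g" "\<And>z. z \<in> E \<Longrightarrow> z = of_real (cmod z) * cis (g z)"
    using not_bounded_imp_log[OF E(1,4)] by metis
  define c where "c = cis (2 * pi / real m)"
  define u where "u z = (g (c * z) - g z - 2 * pi / real m) / (2 * pi)" for z
  have uint: "u z \<in> \<int>" if z: "z \<in> E" for z
  proof -
    have z0: "z \<noteq> 0" using z E(4) by blast
    have cz: "c * z \<in> E" using inv z by (simp add: c_def)
    have "of_real (cmod z) * cis (g (c * z)) = c * z" using g(2)[OF cz] by (simp add: norm_mult c_def)
    also have "\<dots> = of_real (cmod z) * (c * cis (g z))" using g(2)[OF z] by (metis mult.left_commute)
    finally have "cis (g (c * z)) = cis (2 * pi / real m + g z)"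
      using z0 by (simp add: c_def cis_mult)
    then have "sin (g (c * z)) = sin (2 * pi / real m + g z)" "cos (g (c * z)) = cos (2 * pi / real m + g z)"
      by (auto simp: complex_eq_iff)
    then obtain k where k: "g (c * z) = 2 * pi / real m + g z + 2 * pi * of_int k"
      using sin_cos_eq_iff by metis
    have "u z = of_int k" unfolding u_def k by simp
    then show ?thesis by simp
  qed
  have "u constant_on E"
  proof (rule continuous_discrete_range_constant[OF E(2)])
    have "continuous_on E (\<lambda>z. g (c * z))"
      by (rule continuous_on_compose2[OF g(1)]) (use inv in \<open>auto simp: c_def intro!: continuous_intros\<close>)
    then show "continuous_on E u" unfolding u_def by (intro continuous_intros g(1)) auto
    show "\<exists>e>0. \<forall>y. y \<in> E \<and> u y \<noteq> u x \<longrightarrow> e \<le> norm (u y - u x)" if x: "x \<in> E" for x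
    proof (intro exI[of _ 1] conjI allI impI)
      fix y assume y: "y \<in> E \<and> u y \<noteq> u x"
      then have "u y - u x \<in> \<int>" "u y - u x \<noteq> 0" using uint x by auto
      then show "1 \<le> norm (u y - u x)" using Ints_nonzero_abs_ge1 by force
    qed simp
  qed
  then obtain a where a: "\<And>z. z \<in> E \<Longrightarrow> u z = a" by (auto simp: constant_on_def)
  obtain z where z: "z \<in> E" using E(3) by blast
  have pw: "c ^ j * z \<in> E" for j
    by (induction j) (use z inv in \<open>auto simp: c_def mult.assoc\<close>)
  have "g (c ^ j * z) = g z + real j * (2 * pi * a + 2 * pi / real m)" for j
  proof (induction j)
    case (Suc j)
    have "g (c * (c ^ j * z)) = g (c ^ j * z) + (2 * pi * a + 2 * pi / real m)"
      using a[OF pw[of j]] by (simp add: u_def field_simps)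
    then show ?case using Suc by (simp add: mult.assoc distrib_right)
  qed simp
  from this[of m] have "real m * (2 * pi * a + 2 * pi / real m) = 0"
    using m by (simp add: c_def Complex.DeMoivre)
  then have "2 * pi * a + 2 * pi / real m = 0" using m by simp
  then have "2 * pi * (a + 1 / real m) = 0" by (simp add: distrib_left)
  then have "a = - (1 / real m)" by simp
  then have am: "a * real m = -1" using m by simp
  obtain k where k: "a = of_int k" using uint[OF z] a[OF z] by (auto elim: Ints_cases)
  have "of_int (k * int m) = (of_int (-1) :: real)" using am k by simp
  then have "k * int m = -1" by linarith
  then have "int m dvd 1" by (metis dvd_minus_iff dvd_triv_right)
  then show False using m by auto
qed

text \<open>The component of the complement of \<open>E\<close> that contains the origin stays in the disk and has its frontier
  in \<open>E\<close>.\<close>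

lemma max_modulus_surrounded:
  assumes hol: "f holomorphic_on ball 0 1" and E: "compact E" "E \<subseteq> ball 0 1" "0 \<notin> E"
    and bdd: "bounded (connected_component_set (- E) (0::complex))"
    and le: "\<And>z. z \<in> E \<Longrightarrow> cmod (f z) \<le> B"
  shows "cmod (f 0) \<le> B"
proof -
  define C where "C = connected_component_set (- E) 0"
  obtain r where r: "r < 1" "E \<subseteq> cball 0 r"
  proof (cases "E = {}")
    case False
    obtain x where "x \<in> E" "\<And>y. y \<in> E \<Longrightarrow> cmod y \<le> cmod x"
      using continuous_attains_sup[OF E(1) False, of cmod] by (auto intro: continuous_intros)
    then have "E \<subseteq> cball 0 (cmod x)" "cmod x < 1" using E(2) by auto
    then show ?thesis using that by blast
  qed (use that[of 0] in auto)
  have "C \<subseteq> inside E"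
  proof
    fix x assume "x \<in> C"
    then have "connected_component_set (- E) x = C" unfolding C_def
      by (metis connected_component_eq)
    then show "x \<in> inside E" using bdd \<open>x \<in> C\<close> connected_component_subset[of "- E" 0]
      by (auto simp: inside_def C_def)
  qed
  then have C: "C \<subseteq> cball 0 r" using outside_subset_convex[OF convex_cball r(2)] inside_Int_outside[of E] by blast
  then have clC: "closure C \<subseteq> ball 0 1"
    using closure_minimal[OF C closed_cball] r(1) by auto
  show ?thesis
  proof (rule maximum_modulus_frontier[of f C])
    show "f holomorphic_on interior C"
      using hol clC interior_subset closure_subset by (meson holomorphic_on_subset order_trans)
    show "continuous_on (closure C) f"
      using holomorphic_on_imp_continuous_on[OF hol] clC continuous_on_subset by blast
    show "bounded C" using bdd by (simp add: C_def)
    show "0 \<in> C" using E(3) by (simp add: C_def connected_component_refl)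
    fix z assume "z \<in> frontier C"
    then have "z \<in> frontier (- E)" unfolding C_def using frontier_of_connected_component_subset by blast
    then have "z \<in> E" using E(1) compact_imp_closed frontier_complement frontier_subset_closed by blast
    then show "cmod (f z) \<le> B" by (rule le)
  qed
qed

lemma real_line_fixed:
  assumes "Im (z * cis (- a)) = 0"
  shows "cis (2 * a) * cnj z = z"
proof -
  define t where "t = Re (z * cis (- a))"
  have "z * cis (- a) = of_real t" using assms by (simp add: t_def complex_eq_iff)
  then have "z = of_real t * cis a" by (metis cis_inverse cis_neq_zero divide_inverse inverse_inverse_eq nonzero_eq_divide_eq)
  then show ?thesis by (simp add: cis_cnj cis_mult mult.left_commute)
qed

text \<open>If \<open>K\<close> meets two lines through the origin at angle \<open>\<pi> / m\<close>, its images under the dihedral group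
  generated by the two reflections form a connected set around the origin. On it a product of
  \<open>2 m\<close> copies of \<open>f\<close> is small, since one of the factors is.\<close>

lemma dihedral_estimate:
  fixes f :: "complex \<Rightarrow> complex"
  assumes hol: "f holomorphic_on ball 0 1" and bound: "\<And>z. z \<in> ball 0 1 \<Longrightarrow> cmod (f z) \<le> M"
    and K: "compact K" "connected K" "K \<subseteq> ball 0 1" "0 \<notin> K"
    and small: "\<And>z. z \<in> K \<Longrightarrow> cmod (f z) \<le> e" and m: "m \<ge> 2"
    and x: "x \<in> K" "Im (x * cis (- a)) = 0" and y: "y \<in> K" "Im (y * cis (- (a + pi / real m))) = 0"
  shows "cmod (f 0) ^ (2 * m) \<le> e * M * (M\<^sup>2) ^ (m - 1)"
proof -
  define c where "c = cis (2 * pi / real m)"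
  define s where "s z = cis (2 * a) * cnj z" for z
  define K1 where "K1 = K \<union> s ` K"
  define E where "E = (\<Union>j<m. (\<lambda>z. c ^ j * z) ` K1)"
  have cm: "c ^ m = 1" using m by (simp add: c_def Complex.DeMoivre)
  have nc: "cmod c = 1" by (simp add: c_def)
  have ss: "s (s z) = z" for z by (simp add: s_def cis_cnj cis_mult mult.assoc[symmetric])
  have ns: "cmod (s z) = cmod z" for z by (simp add: s_def norm_mult)
  have sx: "s x = x" using real_line_fixed[OF x(2)] by (simp add: s_def)
  have sy: "c * s y = y"
  proof -
    have "c * cis (2 * a) = cis (2 * (a + pi / real m))" by (simp add: c_def cis_mult algebra_simps)
    then show ?thesis using real_line_fixed[OF y(2)] by (simp add: s_def mult.assoc[symmetric])
  qed
  have conts: "continuous_on S s" for S unfolding s_def by (intro continuous_intros)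
  have K1: "compact K1" "connected K1" "K1 \<subseteq> ball 0 1" "0 \<notin> K1"
  proof -
    show "compact K1" unfolding K1_def using K(1) by (intro compact_Un compact_continuous_image conts)
    show "connected K1" unfolding K1_def
    proof (intro connected_Un connected_continuous_image conts K(2))
      show "K \<inter> s ` K \<noteq> {}" using x(1) sx imageI[of x K s] by auto
    qed
    show "K1 \<subseteq> ball 0 1" using K(3) ns by (auto simp: K1_def)
    show "0 \<notin> K1" using K(4) ns by (auto simp: K1_def) (metis norm_eq_zero)
  qed
  have yK1: "y \<in> K1" "y \<in> (\<lambda>z. c * z) ` K1"
    using y(1) image_eqI[of y "\<lambda>z. c * z" "s y" K1] sy by (auto simp: K1_def)
  have conn: "connected (\<Union>j<Suc k. (\<lambda>z. c ^ j * z) ` K1)" for k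
  proof (induction k)
    case (Suc k)
    have "c ^ Suc k * s y = c ^ k * y" using sy by (metis mult.assoc power_Suc2)
    moreover have "s y \<in> K1" using y(1) by (simp add: K1_def)
    ultimately have "c ^ k * y \<in> (\<lambda>z. c ^ Suc k * z) ` K1" by force
    moreover have "c ^ k * y \<in> (\<Union>j<Suc k. (\<lambda>z. c ^ j * z) ` K1)" using yK1(1) by blast
    ultimately have "(\<lambda>z. c ^ Suc k * z) ` K1 \<inter> (\<Union>j<Suc k. (\<lambda>z. c ^ j * z) ` K1) \<noteq> {}" by blast
    moreover have "connected ((\<lambda>z. c ^ Suc k * z) ` K1)"
      by (intro connected_continuous_image K1(2) continuous_intros)
    ultimately have "connected ((\<lambda>z. c ^ Suc k * z) ` K1 \<union> (\<Union>j<Suc k. (\<lambda>z. c ^ j * z) ` K1))"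
      using Suc by (intro connected_Un)
    then show ?case by (simp add: lessThan_Suc Un_commute Un_left_commute)
  qed (simp add: K1(2) lessThan_Suc)
  have E: "compact E" "connected E" "E \<noteq> {}" "0 \<notin> E" "E \<subseteq> ball 0 1"
  proof -
    show "compact E" unfolding E_def
      by (intro compact_UN compact_continuous_image K1(1) continuous_intros) auto
    show "connected E" using conn[of "m - 1"] m by (simp add: E_def)
    have "x \<in> (\<lambda>z. c ^ 0 * z) ` K1" "0 \<in> {..<m}" using x(1) m by (auto simp: K1_def)
    then show "E \<noteq> {}" unfolding E_def by blast
    show "0 \<notin> E" using K1(4) nc by (auto simp: E_def)
    show "E \<subseteq> ball 0 1" using K1(3) nc by (auto simp: E_def norm_mult norm_power)
  qed
  have inv: "c * z \<in> E" if z: "z \<in> E" for z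
  proof -
    obtain j u where ju: "j < m" "u \<in> K1" "z = c ^ j * u" using z by (auto simp: E_def)
    show ?thesis
    proof (cases "Suc j < m")
      case True
      have "c * z = c ^ Suc j * u" unfolding ju(3) by simp
      then have "c * z \<in> (\<lambda>z. c ^ Suc j * z) ` K1" using ju(2) by blast
      then show ?thesis unfolding E_def using True by blast
    next
      case False
      then have "Suc j = m" using ju(1) by simp
      then have "c * z = c ^ 0 * u" using cm ju(3) by (metis mult.assoc mult_1 power_0 power_Suc)
      then have "c * z \<in> (\<lambda>z. c ^ 0 * z) ` K1" "0 \<in> {..<m}" using ju(2) m by auto
      then show ?thesis unfolding E_def by blast
    qed
  qed
  have surr: "bounded (connected_component_set (- E) 0)"
    using inv by (intro rotation_invariant_surrounds[OF E(1-4) m]) (simp add: c_def)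
  define f2 where "f2 = cnj \<circ> (\<lambda>z. f (cis (2 * a) * z)) \<circ> cnj"
  have f2: "f2 z = cnj (f (s z))" for z by (simp add: f2_def s_def)
  define G where "G k z = f (c ^ k * z) * f2 (c ^ k * z)" for k z
  have rot: "(\<lambda>z. g (w * z)) holomorphic_on ball 0 1" if g: "g holomorphic_on ball 0 1" and w: "cmod w = 1"
    for g and w :: complex
  proof -
    have "(\<lambda>z. w * z) holomorphic_on ball 0 1" by (intro holomorphic_intros)
    moreover have "(\<lambda>z. w * z) ` ball 0 1 \<subseteq> ball (0::complex) 1" using w by (auto simp: norm_mult)
    ultimately show ?thesis using holomorphic_on_compose_gen[OF _ g] by (simp add: o_def)
  qed
  have "cnj ` ball 0 1 \<subseteq> ball 0 1" by auto
  then have f2hol: "f2 holomorphic_on ball 0 1" unfolding f2_def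
    by (intro holomorphic_on_compose_cnj_cnj holomorphic_on_subset[OF rot[OF hol]]) auto
  have G: "G k holomorphic_on ball 0 1" for k
  proof -
    have "cmod (c ^ k) = 1" using nc by (simp add: norm_power)
    then show ?thesis unfolding G_def by (intro holomorphic_on_mult rot hol f2hol)
  qed
  have M0: "0 \<le> M" using order_trans[OF norm_ge_zero bound[of 0]] by simp
  have Gle: "cmod (G k z) \<le> M\<^sup>2" if "z \<in> ball 0 1" for k z
  proof -
    have "c ^ k * z \<in> ball 0 1" "s (c ^ k * z) \<in> ball 0 1" using that nc ns by (auto simp: norm_mult norm_power)
    then have "cmod (f (c ^ k * z)) \<le> M" "cmod (f2 (c ^ k * z)) \<le> M" using bound by (auto simp: f2)
    then show ?thesis unfolding G_def norm_mult power2_eq_square using M0 by (intro mult_mono) auto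
  qed
  have e0: "0 \<le> e" using order_trans[OF norm_ge_zero small[OF x(1)]] .
  have onE: "cmod (\<Prod>k<m. G k z) \<le> e * M * (M\<^sup>2) ^ (m - 1)" if z: "z \<in> E" for z
  proof -
    have zb: "z \<in> ball 0 1" using z E(5) by blast
    obtain j u where ju: "j < m" "u \<in> K1" "z = c ^ j * u" using z by (auto simp: E_def)
    obtain k where k: "k < m" "c ^ k * z = u"
    proof (cases "j = 0")
      case True
      then show ?thesis using that[of 0] ju m by simp
    next
      case False
      have "c ^ (m - j) * z = c ^ (m - j + j) * u" unfolding ju(3) power_add by (simp add: mult.assoc)
      then show ?thesis using that[of "m - j"] False ju(1) cm by simp
    qed
    have ub: "u \<in> ball 0 1" "s u \<in> ball 0 1" using ju(2) K1(3) ns by auto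
    have "cmod (f u) * cmod (f (s u)) \<le> e * M"
    proof (cases "u \<in> K")
      case True
      then show ?thesis using small[of u] bound[OF ub(2)] e0 by (intro mult_mono) auto
    next
      case False
      then obtain v where "v \<in> K" "u = s v" using ju(2) by (auto simp: K1_def)
      then have "cmod (f (s u)) \<le> e" using small ss by simp
      then show ?thesis using bound[OF ub(1)] M0 mult_mono[of "cmod (f u)" M "cmod (f (s u))" e]
        by (simp add: mult.commute)
    qed
    then have Gk: "cmod (G k z) \<le> e * M" by (simp add: G_def k(2) f2 norm_mult)
    have "cmod (\<Prod>k<m. G k z) = cmod (G k z) * (\<Prod>i\<in>{..<m} - {k}. cmod (G i z))"
      using k(1) by (subst prod.remove[of _ k]) (auto simp: norm_mult prod_norm)
    also have "(\<Prod>i\<in>{..<m} - {k}. cmod (G i z)) \<le> (\<Prod>i\<in>{..<m} - {k}. M\<^sup>2)"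
      using Gle[OF zb] by (intro prod_mono) auto
    also have "\<dots> = (M\<^sup>2) ^ (m - 1)" using k(1) by simp
    finally show ?thesis using Gk e0 M0
      by (smt (verit) mult_left_mono mult_right_mono norm_ge_zero zero_le_power zero_le_power2)
  qed
  have "cmod (\<Prod>k<m. G k 0) \<le> e * M * (M\<^sup>2) ^ (m - 1)"
    using E surr onE G by (intro max_modulus_surrounded[of "\<lambda>z. \<Prod>k<m. G k z" E]) (auto intro!: holomorphic_intros)
  moreover have "cmod (\<Prod>k<m. G k 0) = cmod (f 0) ^ (2 * m)"
    by (simp add: G_def f2 s_def norm_mult norm_power power_mult power2_eq_square)
  ultimately show ?thesis by simp
qed

text \<open>Otherwise \<open>K\<close> stays within angle \<open>t\<close> of the ray through \<open>x\<close>, and all points of this sector near the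
  unit circle are close to \<open>x\<close>.\<close>

lemma connected_meets_line:
  fixes K :: "complex set"
  assumes K: "connected K" "0 \<notin> K" "K \<subseteq> ball 0 1" and far: "\<And>z. z \<in> K \<Longrightarrow> cmod z \<ge> 1 - w"
    and t: "0 < t" "t < pi / 2" and xy: "x \<in> K" "y \<in> K" "dist x y > w + 2 * tan t"
  obtains a z1 z2 where "z1 \<in> K" "Im (z1 * cis (- a)) = 0" "z2 \<in> K" "Im (z2 * cis (- (a + t))) = 0"
proof (rule ccontr)
  assume *: "\<not> thesis"
  note meets = that
  define b where "b = Arg x"
  have x: "x * cis (- b) = of_real (cmod x)"
    using Arg_eq[of x] by (cases "x = 0") (auto simp: b_def cis_conv_exp exp_minus field_simps)
  have 1: "Im (z * cis (- (b + t))) \<noteq> 0" if "z \<in> K" for z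
    using * meets[of x b z] x xy(1) \<open>z \<in> K\<close> by (metis Im_complex_of_real)
  have 2: "Im (z * cis (- (b - t))) \<noteq> 0" if "z \<in> K" for z
    using * meets[of z "b - t" x] x xy(1) \<open>z \<in> K\<close> by (metis Im_complex_of_real diff_add_cancel)
  define S where "S = {z. Im (z * cis (- (b + t))) < 0} \<inter> {z. Im (z * cis (- (b - t))) > 0}"
  have "open S" unfolding S_def
    by (intro open_Int open_Collect_less continuous_intros)
  define T where "T = {z. Im (z * cis (- (b + t))) > 0} \<union> {z. Im (z * cis (- (b - t))) < 0}"
  have "open T" unfolding T_def
    by (intro open_Un open_Collect_less continuous_intros)
  have im: "Im (z * cis (- (b + t))) = Im (z * cis (- b)) * cos t - Re (z * cis (- b)) * sin t"
    "Im (z * cis (- (b - t))) = Im (z * cis (- b)) * cos t + Re (z * cis (- b)) * sin t" for z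
    by (simp_all add: sin_add cos_add sin_diff cos_diff algebra_simps)
  have sc: "sin t > 0" "cos t > 0" using t by (auto intro: sin_gt_zero cos_gt_zero)
  have "x \<noteq> 0" using xy(1) K(2) by blast
  have "x \<in> S" unfolding S_def mem_Collect_eq Int_iff im x using sc \<open>x \<noteq> 0\<close> by simp
  have "K \<subseteq> S \<union> T"
  proof
    fix z assume "z \<in> K"
    then show "z \<in> S \<union> T" using 1[of z] 2[of z] by (auto simp: S_def T_def neq_iff)
  qed
  moreover have "S \<inter> T = {}" by (auto simp: S_def T_def)
  ultimately have "y \<in> S"
    using connectedD[OF K(1) \<open>open S\<close> \<open>open T\<close>] \<open>x \<in> S\<close> xy(1,2) by blast
  define p q where "p = Re (y * cis (- b))" and "q = Im (y * cis (- b))"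
  have ypq: "y * cis (- b) = Complex p q" by (simp only: p_def q_def complex.collapse)
  have "q * cos t < p * sin t" "- q * cos t < p * sin t"
    using \<open>y \<in> S\<close> unfolding S_def Int_iff mem_Collect_eq im p_def[symmetric] q_def[symmetric] by simp_all
  then have "\<bar>q\<bar> * cos t < p * sin t" by (auto simp: abs_if)
  then have qp: "\<bar>q\<bar> < p * tan t" using sc by (simp add: tan_def pos_less_divide_eq)
  have "tan t > 0" using t by (intro tan_gt_zero)
  then have p0: "p > 0" using qp by (metis abs_ge_zero less_le_trans not_le mult_nonpos_nonneg less_imp_le order_less_irrefl)
  have cy: "cmod (Complex p q) = cmod y" unfolding ypq[symmetric] by (simp add: norm_mult)
  have "p \<le> cmod y" using abs_Re_le_cmod[of "Complex p q"] cy by simp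
  then have "p \<le> 1" using xy(2) K(3) by auto
  then have qt: "\<bar>q\<bar> < tan t" using qp \<open>tan t > 0\<close> by (smt (verit) mult_left_le_one_le p0)
  have "cmod y \<le> \<bar>p\<bar> + \<bar>q\<bar>" using cmod_le[of "Complex p q"] cy by simp
  then have "p \<ge> 1 - w - tan t" using far[OF xy(2)] qt p0 by simp
  moreover have "cmod x \<ge> 1 - w" "cmod x \<le> 1" using far[OF xy(1)] xy(1) K(3) by auto
  moreover have "w \<ge> 0" using calculation by linarith
  ultimately have "\<bar>cmod x - p\<bar> \<le> w + tan t" using \<open>p \<le> 1\<close> \<open>tan t > 0\<close> by (simp add: abs_le_iff)
  moreover have "dist x y \<le> \<bar>cmod x - p\<bar> + \<bar>q\<bar>"
  proof -
    have "dist x y = cmod ((x - y) * cis (- b))" by (simp add: dist_norm norm_mult)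
    also have "\<dots> = cmod (of_real (cmod x) - Complex p q)" using x ypq by (simp add: left_diff_distrib)
    also have "\<dots> \<le> \<bar>cmod x - p\<bar> + \<bar>q\<bar>" using cmod_le[of "of_real (cmod x) - Complex p q"] by simp
    finally show ?thesis .
  qed
  ultimately show False using qt xy(3) by linarith
qed

text \<open>The number \<open>m\<close> is chosen from \<open>d\<close> so that a set of diameter more than \<open>d\<close> meets two
  lines at angle \<open>\<pi> / m\<close>; the dihedral estimate then bounds \<open>f 0\<close> in terms of \<open>e\<close>.\<close>

lemma Koebe:
  fixes M d v :: real
  assumes M: "M > 0" and d: "0 < d" "d \<le> 1" and v: "v > 0"
  obtains e where "e > 0" and "\<And>f K x y. f holomorphic_on ball 0 1 \<Longrightarrow>
    (\<And>z. z \<in> ball 0 1 \<Longrightarrow> cmod (f z) \<le> M) \<Longrightarrow> cmod (f 0) \<ge> v \<Longrightarrow> compact K \<Longrightarrow> connected K \<Longrightarrow>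
    K \<subseteq> ball 0 1 \<Longrightarrow> (\<And>z. z \<in> K \<Longrightarrow> cmod (f z) \<le> e \<and> cmod z \<ge> 1 - d / 2) \<Longrightarrow> x \<in> K \<Longrightarrow> y \<in> K \<Longrightarrow>
    dist x y \<le> d"
proof -
  have "(\<lambda>m. pi / real m) \<longlonglongrightarrow> 0" by (rule lim_const_over_n)
  then have "(\<lambda>m. tan (pi / real m)) \<longlonglongrightarrow> tan 0" by (intro isCont_tendsto_compose[OF isCont_tan]) simp
  then have "\<forall>\<^sub>F m in sequentially. tan (pi / real m) < d / 4"
    using d(1) by (intro order_tendstoD(2)[of _ 0]) auto
  then have "\<forall>\<^sub>F m in sequentially. tan (pi / real m) < d / 4 \<and> m \<ge> 3"
    using eventually_ge_at_top[of 3] by eventually_elim auto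
  then obtain m where m: "tan (pi / real m) < d / 4" "m \<ge> 3"
    using eventually_happens'[OF sequentially_bot] by blast
  define e where "e = v ^ (2 * m) / (M * (M\<^sup>2) ^ (m - 1)) / 2"
  have "e > 0" using M v by (simp add: e_def)
  have em: "e * M * (M\<^sup>2) ^ (m - 1) < v ^ (2 * m)"
    using M v by (simp add: e_def)
  show ?thesis
  proof (rule that[OF \<open>e > 0\<close>], rule ccontr)
    fix f K x y
    assume f: "f holomorphic_on ball 0 1" "\<And>z. z \<in> ball 0 1 \<Longrightarrow> cmod (f z) \<le> M" "cmod (f 0) \<ge> v"
      and K: "compact K" "connected K" "K \<subseteq> ball 0 1" "\<And>z. z \<in> K \<Longrightarrow> cmod (f z) \<le> e \<and> cmod z \<ge> 1 - d / 2"
      and xy: "x \<in> K" "y \<in> K" "\<not> dist x y \<le> d"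
    have 0: "0 \<notin> K" using K(4)[of 0] d by auto
    have t: "0 < pi / real m" "pi / real m < pi / 2" using m(2) by (auto simp: field_simps)
    have dist: "dist x y > d / 2 + 2 * tan (pi / real m)" using xy(3) m(1) by simp
    have far: "cmod z \<ge> 1 - d / 2" if "z \<in> K" for z using K(4)[OF that] by simp
    obtain a z1 z2 where z: "z1 \<in> K" "Im (z1 * cis (- a)) = 0" "z2 \<in> K" "Im (z2 * cis (- (a + pi / real m))) = 0"
      using connected_meets_line[OF K(2) 0 K(3) far t xy(1,2) dist] .
    have "cmod (f 0) ^ (2 * m) \<le> e * M * (M\<^sup>2) ^ (m - 1)"
      using m(2) K(4) by (intro dihedral_estimate[OF f(1,2) K(1-3) 0 _ _ z]) auto
    moreover have "v ^ (2 * m) \<le> cmod (f 0) ^ (2 * m)" using v f(3) by (intro power_mono) auto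
    ultimately show False using em by linarith
  qed
qed


section \<open>Boundary values of homeomorphisms of the disk\<close>

text \<open>Homeomorphisms are proper.\<close>

lemma tendsto_bdry_of_homeomorphism_disk:
  assumes hom: "homeomorphism (ball 0 1) (ball 0 1) k k'" and e: "e > 0"
  obtains d where "d > 0" "\<And>z::complex. cmod z < 1 \<Longrightarrow> cmod z > 1 - d \<Longrightarrow> cmod (k z :: complex) > 1 - e"
proof -
  have "compact (k' ` cball 0 (1 - e))"
  proof (intro compact_continuous_image compact_cball)
    have "cball 0 (1 - e) \<subseteq> ball (0::complex) 1" using e by auto
    then show "continuous_on (cball 0 (1 - e)) k'"
      using hom continuous_on_subset by (auto simp: homeomorphism_def)
  qed
  moreover have "k' ` cball 0 (1 - e) \<subseteq> ball 0 1"
  proof -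
    have "cball 0 (1 - e) \<subseteq> ball (0::complex) 1" using e by auto
    then show ?thesis using hom by (metis homeomorphism_def image_mono)
  qed
  ultimately obtain r where r: "r < 1" "k' ` cball 0 (1 - e) \<subseteq> cball 0 r"
  proof (cases "k' ` cball 0 (1 - e) = {}")
    case False
    assume c: "compact (k' ` cball 0 (1 - e))" "k' ` cball 0 (1 - e) \<subseteq> ball 0 1"
    obtain x where x: "x \<in> k' ` cball 0 (1 - e)" "\<And>y. y \<in> k' ` cball 0 (1 - e) \<Longrightarrow> cmod y \<le> cmod x"
      using continuous_attains_sup[OF c(1) False, of cmod] by (auto intro: continuous_intros)
    then have "k' ` cball 0 (1 - e) \<subseteq> cball 0 (cmod x)" "cmod x < 1" using c(2) by auto
    then show ?thesis using that by blast
  qed (use that[of 0] in auto)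
  show ?thesis
  proof (rule that[of "1 - r"])
    fix z :: complex assume z: "cmod z < 1" "1 - (1 - r) < cmod z"
    show "1 - e < cmod (k z)"
    proof (rule ccontr)
      assume "\<not> ?thesis"
      then have "k' (k z) \<in> k' ` cball 0 (1 - e)" by auto
      moreover have "k' (k z) = z" using hom z(1) by (auto simp: homeomorphism_def)
      ultimately show False using r(2) z(2) by auto
    qed
  qed (use r in simp)
qed

text \<open>A crosscut of small diameter cuts off a small piece, because a convex part of the disk lies on
  its other side.\<close>

lemma small_oscillation:
  assumes hom: "homeomorphism (ball 0 1) (ball 0 1) k k'" and w: "cmod \<omega> = 1"
    and arcs: "\<And>e. e > 0 \<Longrightarrow> \<exists>r. 0 < r \<and> r < e \<and>
      (\<forall>x\<in>ball 0 1 \<inter> sphere \<omega> r. \<forall>y\<in>ball 0 1 \<inter> sphere \<omega> r. dist (k x) (k y :: complex) \<le> e)"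
    and e: "e > 0"
  obtains r where "r > 0" "\<And>x y. x \<in> ball 0 1 \<inter> ball \<omega> r \<Longrightarrow> y \<in> ball 0 1 \<inter> ball \<omega> r \<Longrightarrow> dist (k x) (k y) \<le> e"
proof -
  have k0: "cmod (k 0) < 1" using hom by (force simp: homeomorphism_def)
  define c where "c = min (e / 2) ((1 - cmod (k 0)) / 2)"
  have c: "c > 0" "c \<le> e / 2" "c < 1 - cmod (k 0)" "c \<le> 1"
    using e k0 norm_ge_zero[of "k 0"] unfolding c_def by (auto simp: min_def simp del: norm_ge_zero)
  \<comment> \<open>A crosscut in \<open>cball b (2 * a)\<close> cuts off a piece of \<open>cball b c\<close>, which excludes \<open>k 0\<close>.\<close>
  define a where "a = c\<^sup>2 / 4"
  have a: "a > 0" "sqrt (2 * (2 * a)) = c" using c(1) by (auto simp: a_def)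
  have "a < 1" using c(1,4) power_le_one[of c 2] by (simp add: a_def)
  obtain d where d: "d > 0" "\<And>z. cmod z < 1 \<Longrightarrow> cmod z > 1 - d \<Longrightarrow> cmod (k z) > 1 - a"
    using tendsto_bdry_of_homeomorphism_disk[OF hom a(1)] by blast
  obtain r where r: "0 < r" "r < min (min a d) 1"
     "\<And>x y. x \<in> ball 0 1 \<inter> sphere \<omega> r \<Longrightarrow> y \<in> ball 0 1 \<inter> sphere \<omega> r \<Longrightarrow> dist (k x) (k y) \<le> min (min a d) 1"
    using arcs[of "min (min a d) 1"] a(1) d(1) by auto
  define N where "N = ball 0 1 \<inter> ball \<omega> r"
  define B where "B = k ` (ball 0 1 \<inter> sphere \<omega> r)"
  have inj: "inj_on k (ball 0 1)" and kim: "k ` ball 0 1 = ball 0 1"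
    using hom unfolding homeomorphism_def by (auto intro: inj_on_inverseI)
  have "k ` N \<in> components (k ` (ball 0 1 - ball 0 1 \<inter> sphere \<omega> r))"
    unfolding N_def by (rule components_homeomorphic_image[OF hom half_disk_component[OF w r(1)]]) auto
  moreover have "k ` (ball 0 1 - ball 0 1 \<inter> sphere \<omega> r) = ball 0 1 - B"
    using inj_on_image_set_diff[OF inj, of "ball 0 1" "ball 0 1 \<inter> sphere \<omega> r"] kim
    by (simp add: B_def)
  ultimately have comp: "k ` N \<in> components (ball 0 1 - B)" by simp
  have "arc_at \<omega> r (1/2) \<in> arc_at \<omega> r ` {0<..<1}" by (rule imageI) simp
  then obtain x0 where x0: "x0 \<in> ball 0 1" "x0 \<in> sphere \<omega> r"
    using arc_at_image[OF w r(1)] r(2) by auto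
  have "cmod x0 > 1 - d" using x0(2) w r(2) norm_triangle_ineq2[of \<omega> x0] by (simp add: dist_norm)
  then have kx: "cmod (k x0) > 1 - a" using d(2) x0(1) by simp
  have kx1: "cmod (k x0) < 1" using kim x0(1) by force
  have kx0: "k x0 \<noteq> 0" using kx \<open>a < 1\<close> by auto
  define b where "b = k x0 / of_real (cmod (k x0))"
  have b1: "cmod b = 1" using kx0 by (simp add: b_def norm_divide)
  have "k x0 - b = of_real (cmod (k x0) - 1) * b"
    using kx0 by (simp add: b_def field_simps)
  then have "dist (k x0) b = 1 - cmod (k x0)"
    using kx1 b1 by (simp add: dist_norm norm_mult del: of_real_diff)
  then have kb: "dist b (k x0) \<le> a" using kx by (simp add: dist_commute)
  have "B \<subseteq> cball b (2 * a)"
  proof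
    fix y assume "y \<in> B"
    then have "dist (k x0) y \<le> a" using r(3)[of x0] x0 unfolding B_def by fastforce
    then show "y \<in> cball b (2 * a)" using kb dist_triangle[of b y "k x0"] by simp
  qed
  from component_small_or_large[OF b1 this comp]
  have "k ` N \<subseteq> cball b c \<or> ball 0 1 - k ` N \<subseteq> cball b c" unfolding a(2) .
  moreover have "k 0 \<in> ball 0 1 - k ` N"
  proof -
    have "0 \<notin> N" using r(2) w by (auto simp: N_def)
    moreover have "N \<subseteq> ball 0 1" by (simp add: N_def)
    ultimately show ?thesis using inj_on_image_mem_iff[OF inj, of 0 N] k0 by auto
  qed
  moreover have "k 0 \<notin> cball b c" using c(3) b1 norm_triangle_ineq2[of b "k 0"] by (auto simp: dist_norm)
  ultimately have kN: "k ` N \<subseteq> cball b c" by blast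
  show ?thesis
  proof (rule that[OF r(1)])
    fix x y assume "x \<in> ball 0 1 \<inter> ball \<omega> r" "y \<in> ball 0 1 \<inter> ball \<omega> r"
    then have "dist b (k x) \<le> c" "dist b (k y) \<le> c" using kN by (auto simp: N_def image_subset_iff)
    then show "dist (k x) (k y) \<le> e" using dist_triangle3[of "k x" "k y" b] c(2) by simp
  qed
qed

text \<open>Small oscillation near each point of the compact disk gives uniform continuity.\<close>

lemma extension_to_cball:
  assumes hom: "homeomorphism (ball 0 1) (ball 0 1) k k'"
    and arcs: "\<And>\<omega> e. cmod \<omega> = 1 \<Longrightarrow> e > 0 \<Longrightarrow> \<exists>r. 0 < r \<and> r < e \<and>
      (\<forall>x\<in>ball 0 1 \<inter> sphere \<omega> r. \<forall>y\<in>ball 0 1 \<inter> sphere \<omega> r. dist (k x) (k y :: complex) \<le> e)"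
  obtains K where "continuous_on (cball 0 1) K" "\<And>z. z \<in> ball 0 1 \<Longrightarrow> K z = k z"
    "K ` sphere 0 1 = sphere 0 1"
proof -
  have cont: "continuous_on (ball 0 1) k" using hom by (simp add: homeomorphism_def)
  have kim: "k ` ball 0 1 = ball 0 1" using hom by (simp add: homeomorphism_def)
  have "uniformly_continuous_on (ball 0 1) k"
    unfolding uniformly_continuous_on_def
  proof (intro allI impI)
    fix e :: real assume e: "e > 0"
    define G where "G = {T. open T \<and> (\<forall>x\<in>T \<inter> ball 0 1. \<forall>y\<in>T \<inter> ball 0 1. dist (k x) (k y) < e)}"
    have "\<exists>T\<in>G. z \<in> T" if z: "z \<in> cball 0 1" for z
    proof (cases "z \<in> ball 0 1")
      case True
      then have "isCont k z" using cont continuous_on_eq_continuous_at[OF open_ball] by blast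
      then obtain d where d: "d > 0" "\<And>x. dist x z < d \<Longrightarrow> dist (k x) (k z) < e / 2"
        unfolding continuous_at_eps_delta using e half_gt_zero by metis
      have "dist (k x) (k y) < e" if "x \<in> ball z d \<inter> ball 0 1" "y \<in> ball z d \<inter> ball 0 1" for x y
      proof -
        have "dist (k x) (k z) < e / 2" "dist (k y) (k z) < e / 2" using that d(2) by (auto simp: dist_commute)
        then show ?thesis using dist_triangle2[of "k x" "k y" "k z"] by linarith
      qed
      then have "ball z d \<in> G" unfolding G_def by blast
      then show ?thesis using d(1) by (intro bexI[of _ "ball z d"]) auto
    next
      case False
      then have z1: "cmod z = 1" using z by auto
      obtain r where r: "r > 0" "\<And>x y. x \<in> ball 0 1 \<inter> ball z r \<Longrightarrow> y \<in> ball 0 1 \<inter> ball z r \<Longrightarrow> dist (k x) (k y) \<le> e / 2"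
        using small_oscillation[OF hom z1 arcs[OF z1], of "e / 2"] e by auto
      have "dist (k x) (k y) < e" if "x \<in> ball z r \<inter> ball 0 1" "y \<in> ball z r \<inter> ball 0 1" for x y
        using r(2)[of x y] that e by auto
      then have "ball z r \<in> G" unfolding G_def by blast
      then show ?thesis using r(1) by (intro bexI[of _ "ball z r"]) auto
    qed
    then have "cball 0 1 \<subseteq> \<Union> G" by blast
    moreover have "\<And>T. T \<in> G \<Longrightarrow> open T" by (simp add: G_def)
    ultimately obtain d where d: "d > 0" "\<And>x. x \<in> cball 0 1 \<Longrightarrow> \<exists>T\<in>G. ball x d \<subseteq> T"
      using Heine_Borel_lemma[OF compact_cball] by metis
    show "\<exists>d>0. \<forall>x\<in>ball 0 1. \<forall>y\<in>ball 0 1. dist y x < d \<longrightarrow> dist (k y) (k x) < e"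
    proof (intro exI conjI ballI impI)
      fix x y :: complex assume xy: "x \<in> ball 0 1" "y \<in> ball 0 1" "dist y x < d"
      obtain T where T: "T \<in> G" "ball x d \<subseteq> T" using d(2)[of x] xy(1) by auto
      then have "x \<in> T" "y \<in> T" using xy d(1) by (auto simp: dist_commute)
      then show "dist (k y) (k x) < e" using T(1) xy unfolding G_def by blast
    qed (rule d(1))
  qed
  then obtain K where K: "uniformly_continuous_on (closure (ball 0 1)) K" "\<And>x. x \<in> ball 0 1 \<Longrightarrow> k x = K x"
    using uniformly_continuous_on_extension_on_closure by metis
  have contK: "continuous_on (cball 0 1) K" using uniformly_continuous_imp_continuous[OF K(1)] by simp
  have ge1: "cmod (K \<omega>) = 1" if w: "cmod \<omega> = 1" for \<omega>
  proof -
    have "K ` closure (ball 0 1) \<subseteq> cball 0 1"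
      using contK K(2) kim by (intro image_closure_subset) (auto simp: less_imp_le image_subset_iff dest: equalityD1)
    moreover have "\<omega> \<in> closure (ball 0 1)" using w by simp
    ultimately have "K \<omega> \<in> cball 0 1" by blast
    then have "cmod (K \<omega>) \<le> 1" by simp
    moreover have "1 \<le> cmod (K \<omega>) + e" if e: "e > 0" for e
    proof -
      obtain d where d: "d > 0" "\<And>z. cmod z < 1 \<Longrightarrow> cmod z > 1 - d \<Longrightarrow> cmod (k z) > 1 - e / 2"
        using tendsto_bdry_of_homeomorphism_disk[OF hom, of "e / 2"] e by auto
      have "continuous (at \<omega> within cball 0 1) K" using contK w by (simp add: continuous_on_eq_continuous_within)
      then obtain d' where d': "d' > 0" "\<And>x. x \<in> cball 0 1 \<Longrightarrow> dist x \<omega> < d' \<Longrightarrow> dist (K x) (K \<omega>) < e / 2"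
        unfolding continuous_within_eps_delta using e half_gt_zero by metis
      have "ball 0 1 \<inter> ball \<omega> (min d d') \<noteq> {}"
        using d(1) d'(1) by (intro ball_inter_ball_nonempty w) auto
      then obtain z where z: "z \<in> ball 0 1" "dist \<omega> z < d" "dist \<omega> z < d'" by auto
      have "cmod z > 1 - d" using z(2) w norm_triangle_ineq2[of \<omega> z] by (simp add: dist_norm)
      then have "cmod (K z) > 1 - e / 2" using d(2)[of z] z(1) K(2)[of z] by auto
      moreover have "dist (K z) (K \<omega>) < e / 2" using d'(2)[of z] z by (auto simp: dist_commute)
      ultimately show ?thesis using norm_triangle_ineq2[of "K z" "K \<omega>"] by (simp add: dist_norm)
    qed
    then have "1 \<le> cmod (K \<omega>)" by (rule field_le_epsilon)
    ultimately show ?thesis by simp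
  qed
  have "sphere 0 1 \<subseteq> K ` sphere 0 1"
  proof
    fix z assume z: "z \<in> sphere (0::complex) 1"
    have "closed (K ` cball 0 1)" by (intro compact_imp_closed compact_continuous_image contK compact_cball)
    moreover have "ball 0 1 \<subseteq> K ` cball 0 1"
    proof
      fix y assume "y \<in> ball (0::complex) 1"
      then obtain x where "x \<in> ball 0 1" "y = k x" using kim by blast
      then show "y \<in> K ` cball 0 1" using K(2)[of x] by force
    qed
    ultimately have "closure (ball 0 1) \<subseteq> K ` cball 0 1" by (rule closure_minimal[rotated])
    moreover have "z \<in> closure (ball 0 1)" using z by simp
    ultimately obtain x where x: "x \<in> cball 0 1" "z = K x" by blast
    have "x \<notin> ball 0 1"
    proof
      assume "x \<in> ball 0 1"
      then have "K x \<in> ball 0 1" using K(2) kim by (metis imageI)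
      then show False using x(2) z by simp
    qed
    then have "x \<in> sphere 0 1" using x(1) by auto
    then show "z \<in> K ` sphere 0 1" using x(2) by blast
  qed
  then show ?thesis using that[of K] contK K(2) ge1 by force
qed

lemma connected_circle_minus_point:
  assumes "cmod \<zeta> = 1"
  shows "connected (sphere 0 1 - {\<zeta>})"
proof -
  have "sphere 0 1 - {\<zeta>} = (\<lambda>t. \<zeta> * cis t) ` {0<..<2 * pi}"
  proof (intro set_eqI iffI)
    fix z assume z: "z \<in> sphere 0 1 - {\<zeta>}"
    have "cmod (z / \<zeta>) = 1" using z assms by (simp add: norm_divide)
    then have eq: "z / \<zeta> = cis (Arg2pi (z / \<zeta>))" using Arg2pi_eq[of "z / \<zeta>"] by (simp add: cis_conv_exp)
    have "\<zeta> \<noteq> 0" using assms by auto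
    have "Arg2pi (z / \<zeta>) \<noteq> 0"
    proof
      assume "Arg2pi (z / \<zeta>) = 0"
      then have "z / \<zeta> = 1" using eq by simp
      then show False using z \<open>\<zeta> \<noteq> 0\<close> by simp
    qed
    then have "Arg2pi (z / \<zeta>) \<in> {0<..<2 * pi}" using Arg2pi[of "z / \<zeta>"] by auto
    moreover have "z = \<zeta> * cis (Arg2pi (z / \<zeta>))" using eq \<open>\<zeta> \<noteq> 0\<close> by (metis nonzero_mult_div_cancel_left times_divide_eq_right)
    ultimately show "z \<in> (\<lambda>t. \<zeta> * cis t) ` {0<..<2 * pi}" by blast
  next
    fix z assume "z \<in> (\<lambda>t. \<zeta> * cis t) ` {0<..<2 * pi}"
    then obtain t where t: "0 < t" "t < 2 * pi" "z = \<zeta> * cis t" by auto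
    have "cis t \<noteq> 1"
    proof
      assume "cis t = 1"
      then have "cos t = 1" by (simp add: complex_eq_iff)
      then obtain n :: int where "t = of_int n * (2 * pi)" by (auto simp: cos_one_2pi_int)
      then have "0 < n" "n < 1" using t by (auto simp: zero_less_mult_iff)
      then show False by simp
    qed
    then show "z \<in> sphere 0 1 - {\<zeta>}" using assms t by (auto simp: norm_mult)
  qed
  then show ?thesis by (auto intro!: connected_continuous_image continuous_intros)
qed

text \<open>The image of a chord whose end points have the same image \<open>\<zeta>\<close> meets the circle only in \<open>\<zeta>\<close>.
  Near the connected remainder of the circle, the disk lies on one side of this image.\<close>

lemma chord_dichotomy:
  fixes K :: "complex \<Rightarrow> complex" and l :: "complex \<Rightarrow> real"
  assumes cont: "continuous_on (cball 0 1) K" and inj: "inj_on K (ball 0 1)"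
    and open_map: "\<And>S. open S \<Longrightarrow> S \<subseteq> ball 0 1 \<Longrightarrow> open (K ` S)"
    and im: "K ` ball 0 1 = ball 0 1" and bd: "K ` sphere 0 1 \<subseteq> sphere 0 1"
    and l: "continuous_on UNIV l" and z: "cmod \<zeta> = 1"
    and chord: "\<And>\<omega>. cmod \<omega> = 1 \<Longrightarrow> l \<omega> = 0 \<Longrightarrow> K \<omega> = \<zeta>"
    and a: "cmod \<alpha> = 1" "l \<alpha> > 0" and b: "cmod \<beta> = 1" "l \<beta> < 0"
  shows "K \<alpha> = \<zeta> \<or> K \<beta> = \<zeta>"
proof (rule ccontr)
  assume neg: "\<not> ?thesis"
  define Wp Wm Q where "Wp = ball 0 1 \<inter> {x. 0 < l x}" and "Wm = ball 0 1 \<inter> {x. l x < 0}"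
    and "Q = K ` (cball 0 1 \<inter> {x. l x = 0})"
  have op: "open Wp" "open Wm" unfolding Wp_def Wm_def
    by (intro open_Int open_ball open_Collect_less l continuous_intros)+
  then have opK: "open (K ` Wp)" "open (K ` Wm)" using open_map by (auto simp: Wp_def Wm_def)
  have disj: "K ` Wp \<inter> K ` Wm = {}"
    using inj_on_image_Int[OF inj, of Wp Wm] by (force simp: Wp_def Wm_def)
  have "closed {x. l x = 0}" by (intro closed_Collect_eq l continuous_intros)
  then have "compact Q" unfolding Q_def
    by (intro compact_continuous_image continuous_on_subset[OF cont] compact_Int_closed) auto
  have cover: "x \<in> K ` Wp \<union> K ` Wm \<union> Q" if x: "x \<in> ball 0 1" for x
  proof -
    obtain y where "y \<in> ball 0 1" "x = K y" using x im by blast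
    then show ?thesis unfolding Wp_def Wm_def Q_def using linorder_less_linear[of "l y" 0] by auto
  qed
  have side: "\<exists>d>0. ball 0 1 \<inter> ball c d \<subseteq> K ` Wp \<or> ball 0 1 \<inter> ball c d \<subseteq> K ` Wm"
    if c: "cmod c = 1" "c \<noteq> \<zeta>" for c
  proof -
    have "c \<notin> Q"
    proof
      assume "c \<in> Q"
      then obtain x where x: "x \<in> cball 0 1" "l x = 0" "c = K x" by (auto simp: Q_def)
      then have "x \<notin> ball 0 1" using im c(1) by (metis imageI less_irrefl mem_ball_0)
      then have "cmod x = 1" using x(1) by auto
      then show False using chord x c by blast
    qed
    then obtain d where d: "d > 0" "ball c d \<subseteq> - Q"
      using \<open>compact Q\<close> compact_imp_closed open_Compl open_contains_ball by (metis ComplI)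
    have "connected (ball 0 1 \<inter> ball c d)" by (intro convex_connected convex_Int convex_ball)
    moreover have "ball 0 1 \<inter> ball c d \<subseteq> K ` Wp \<union> K ` Wm" using cover d(2) by blast
    ultimately have "K ` Wp \<inter> (ball 0 1 \<inter> ball c d) = {} \<or> K ` Wm \<inter> (ball 0 1 \<inter> ball c d) = {}"
      using connectedD[OF _ opK] disj by blast
    then show ?thesis using \<open>ball 0 1 \<inter> ball c d \<subseteq> K ` Wp \<union> K ` Wm\<close> d(1) by blast
  qed
  define P where "P W = {c. \<exists>d>0. ball 0 1 \<inter> ball c d \<subseteq> K ` W}" for W
  have opP: "open (P W)" for W
  proof (subst open_contains_ball, intro ballI)
    fix c assume "c \<in> P W"
    then obtain d where d: "d > 0" "ball 0 1 \<inter> ball c d \<subseteq> K ` W" by (auto simp: P_def)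
    have "x \<in> P W" if x: "x \<in> ball c d" for x
    proof -
      obtain d' where "d' > 0" "ball x d' \<subseteq> ball c d" using openE[OF open_ball x] .
      then show ?thesis using d(2) unfolding P_def by blast
    qed
    then show "\<exists>e>0. ball c e \<subseteq> P W" using d(1) by blast
  qed
  have "P Wp \<inter> P Wm \<inter> (sphere 0 1 - {\<zeta>}) = {}"
  proof (rule ccontr)
    assume "\<not> ?thesis"
    then obtain c where c0: "c \<in> P Wp" "c \<in> P Wm" "c \<in> sphere 0 1" by blast
    then have "cmod c = 1" by simp
    with c0 obtain d d' where c: "cmod c = 1" "d > 0" "d' > 0"
        "ball 0 1 \<inter> ball c d \<subseteq> K ` Wp" "ball 0 1 \<inter> ball c d' \<subseteq> K ` Wm" unfolding P_def by blast
    have "ball 0 1 \<inter> ball c (min d d') \<noteq> {}" using c by (intro ball_inter_ball_nonempty) auto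
    then obtain x where "x \<in> ball 0 1" "x \<in> ball c (min d d')" by blast
    then have "x \<in> ball 0 1 \<inter> ball c d" "x \<in> ball 0 1 \<inter> ball c d'" by auto
    then show False using c disj by blast
  qed
  moreover have "sphere 0 1 - {\<zeta>} \<subseteq> P Wp \<union> P Wm" using side by (fastforce simp: P_def)
  ultimately have one: "P Wp \<inter> (sphere 0 1 - {\<zeta>}) = {} \<or> P Wm \<inter> (sphere 0 1 - {\<zeta>}) = {}"
    using connectedD[OF connected_circle_minus_point[OF z] opP opP] by blast
  have mem: "K \<gamma> \<in> P W'" if g: "cmod \<gamma> = 1" "K \<gamma> \<noteq> \<zeta>" and W: "\<gamma> \<in> T" "open T" "ball 0 1 \<inter> T \<subseteq> W'"
      and W': "(W', W'') = (Wp, Wm) \<or> (W', W'') = (Wm, Wp)" for \<gamma> T W' W''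
  proof -
    have "\<gamma> \<in> sphere 0 1" using g(1) by simp
    then have "K \<gamma> \<in> sphere 0 1" using bd by blast
    then have "cmod (K \<gamma>) = 1" by simp
    then obtain d where d: "d > 0" "ball 0 1 \<inter> ball (K \<gamma>) d \<subseteq> K ` W' \<or> ball 0 1 \<inter> ball (K \<gamma>) d \<subseteq> K ` W''"
      using side[of "K \<gamma>"] g(2) W' by auto
    have "continuous (at \<gamma> within cball 0 1) K" using cont g(1) by (simp add: continuous_on_eq_continuous_within)
    then obtain d' where d': "d' > 0" "\<And>x. x \<in> cball 0 1 \<Longrightarrow> dist x \<gamma> < d' \<Longrightarrow> dist (K x) (K \<gamma>) < d"
      unfolding continuous_within_eps_delta using d(1) by metis
    obtain t where t: "t > 0" "ball \<gamma> t \<subseteq> T" using W openE by blast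
    have "ball 0 1 \<inter> ball \<gamma> (min d' t) \<noteq> {}" using d' t by (intro ball_inter_ball_nonempty g) auto
    then obtain x where x: "x \<in> ball 0 1" "dist \<gamma> x < d'" "x \<in> ball \<gamma> t" by auto
    have "K x \<in> ball 0 1" using x(1) im by blast
    moreover have "K x \<in> ball (K \<gamma>) d" using d'(2)[of x] x by (auto simp: dist_commute)
    moreover have "K x \<in> K ` W'" using x t(2) W(3) by blast
    ultimately have "\<not> ball 0 1 \<inter> ball (K \<gamma>) d \<subseteq> K ` W''" using disj W' by blast
    then show ?thesis using d unfolding P_def by blast
  qed
  have "K \<alpha> \<in> P Wp"
    by (rule mem[of \<alpha> "{x. 0 < l x}" Wp Wm])
      (use a neg in \<open>auto simp: Wp_def intro!: open_Collect_less l continuous_intros\<close>)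
  moreover have "K \<beta> \<in> P Wm"
    by (rule mem[of \<beta> "{x. l x < 0}" Wm Wp])
      (use b neg in \<open>auto simp: Wm_def intro!: open_Collect_less l continuous_intros\<close>)
  moreover have "K \<alpha> \<in> sphere 0 1 - {\<zeta>}" "K \<beta> \<in> sphere 0 1 - {\<zeta>}"
    using neg a(1) b(1) bd by (auto simp: image_subset_iff)
  ultimately show False using one by blast
qed

text \<open>If \<open>K\<close> identifies two boundary points, the chord between them has two sides, and by the dichotomy \<open>K\<close>
  is constant on the boundary arc on one of them.\<close>

lemma injective_extension:
  fixes K :: "complex \<Rightarrow> complex"
  assumes cont: "continuous_on (cball 0 1) K" and inj: "inj_on K (ball 0 1)"
    and open_map: "\<And>S. open S \<Longrightarrow> S \<subseteq> ball 0 1 \<Longrightarrow> open (K ` S)"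
    and im: "K ` ball 0 1 = ball 0 1" and bd: "K ` sphere 0 1 \<subseteq> sphere 0 1"
    and nocollapse: "\<And>T \<zeta>. open T \<Longrightarrow> T \<inter> sphere 0 1 \<noteq> {} \<Longrightarrow> \<exists>\<omega>\<in>T \<inter> sphere 0 1. K \<omega> \<noteq> \<zeta>"
  shows "inj_on K (cball 0 1)"
proof -
  have sph: "inj_on K (sphere 0 1)"
  proof (rule inj_onI, rule ccontr)
    fix u v assume uv: "u \<in> sphere 0 1" "v \<in> sphere 0 1" "K u = K v" "u \<noteq> v"
    define l where "l x = Im ((x - u) * cnj (v - u))" for x
    have l: "continuous_on UNIV l" unfolding l_def by (intro continuous_intros)
    have u1: "cmod u = 1" and v1: "cmod v = 1" using uv by auto
    define D where "D = cmod (v - u)"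
    have D: "D > 0" using uv(4) by (simp add: D_def)
    have chord: "\<omega> = u \<or> \<omega> = v" if w: "cmod \<omega> = 1" "l \<omega> = 0" for \<omega>
    proof -
      define s where "s = Re ((\<omega> - u) * cnj (v - u)) / D\<^sup>2"
      have "(\<omega> - u) * cnj (v - u) = of_real (s * D\<^sup>2)"
        using w(2) D by (simp add: complex_eq_iff s_def l_def)
      moreover have "(v - u) * cnj (v - u) = of_real (D\<^sup>2)"
        by (simp add: D_def complex_norm_square[symmetric] del: complex_cnj_diff)
      ultimately have "(\<omega> - u) * cnj (v - u) = of_real s * (v - u) * cnj (v - u)"
        by (simp add: mult.assoc)
      then have "\<omega> - u = of_real s * (v - u)" using uv(4) by simp
      then have wu: "\<omega> = u + s *\<^sub>R (v - u)" by (simp add: scaleR_conv_of_real algebra_simps)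
      have "(cmod \<omega>)\<^sup>2 = (cmod u)\<^sup>2 + 2 * s * (u \<bullet> (v - u)) + s\<^sup>2 * (cmod (v - u))\<^sup>2"
        unfolding wu power2_norm_eq_inner by (simp add: inner_add_left inner_add_right inner_commute power2_eq_square algebra_simps)
      moreover have "(cmod v)\<^sup>2 = (cmod u)\<^sup>2 + 2 * (u \<bullet> (v - u)) + (cmod (v - u))\<^sup>2"
        unfolding power2_norm_eq_inner by (simp add: inner_diff_left inner_diff_right inner_commute)
      ultimately have "2 * s * (u \<bullet> (v - u)) + s\<^sup>2 * D\<^sup>2 = 0" "2 * (u \<bullet> (v - u)) = - (D\<^sup>2)"
        using w(1) u1 v1 by (simp_all add: D_def)
      then have "s\<^sup>2 * D\<^sup>2 = s * D\<^sup>2" by algebra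
      then have "s * (s - 1) = 0" using D by (simp add: power2_eq_square algebra_simps)
      then have "s = 0 \<or> s = 1" by simp
      then show ?thesis using wu by auto
    qed
    have ends: "\<exists>x. cmod x = 1 \<and> t * l x > 0" if t: "t = 1 \<or> t = -1" for t :: real
    proof -
      define x where "x = of_real t * \<i> * (v - u) / of_real D"
      have "l x = t * D - Im (u * cnj (v - u))"
      proof -
        have "x * cnj (v - u) = of_real t * \<i> * ((v - u) * cnj (v - u)) / of_real D" by (simp add: x_def)
        also have "(v - u) * cnj (v - u) = of_real (D\<^sup>2)"
          by (simp add: D_def complex_norm_square[symmetric] del: complex_cnj_diff)
        finally have "x * cnj (v - u) = of_real t * \<i> * of_real D" using D by (simp add: power2_eq_square)
        then show ?thesis unfolding l_def left_diff_distrib by simp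
      qed
      moreover have "\<bar>Im (u * cnj (v - u))\<bar> < D"
      proof -
        have "Re (u * cnj (v - u)) = u \<bullet> v - u \<bullet> u" by (simp add: inner_complex_def algebra_simps)
        moreover have "(cmod (v - u))\<^sup>2 = v \<bullet> v + u \<bullet> u - 2 * (u \<bullet> v)"
          unfolding power2_norm_eq_inner by (simp add: inner_diff_left inner_diff_right inner_commute)
        moreover have "v \<bullet> v = 1" "u \<bullet> u = 1" using u1 v1 by (simp_all add: dot_square_norm)
        ultimately have "Re (u * cnj (v - u)) \<noteq> 0" using D unfolding D_def[symmetric] by (auto simp: power2_eq_square)
        then have "(Re (u * cnj (v - u)))\<^sup>2 > 0" by simp
        moreover have "(Re (u * cnj (v - u)))\<^sup>2 + (Im (u * cnj (v - u)))\<^sup>2 = D\<^sup>2"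
          unfolding cmod_power2[symmetric] norm_mult complex_mod_cnj u1 D_def by simp
        ultimately have "(Im (u * cnj (v - u)))\<^sup>2 < D\<^sup>2" by linarith
        then have "\<bar>Im (u * cnj (v - u))\<bar>\<^sup>2 < D\<^sup>2" by simp
        then show ?thesis using D power2_less_imp_less less_imp_le by blast
      qed
      moreover have "cmod x = 1" using D t by (auto simp: x_def norm_mult norm_divide D_def)
      ultimately show ?thesis using t by (intro exI[of _ x]) (auto simp: abs_less_iff)
    qed
    obtain xp where xp: "cmod xp = 1" "l xp > 0" using ends[of 1] by auto
    obtain xm where xm: "cmod xm = 1" "l xm < 0" using ends[of "-1"] by auto
    have z: "cmod (K u) = 1" using subsetD[OF bd imageI[OF uv(1)]] by simp
    have "\<exists>\<omega>\<in>{x. 0 < l x} \<inter> sphere 0 1. K \<omega> \<noteq> K u"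
      using xp by (intro nocollapse open_Collect_less l continuous_intros) auto
    moreover have "\<exists>\<omega>\<in>{x. l x < 0} \<inter> sphere 0 1. K \<omega> \<noteq> K u"
      using xm by (intro nocollapse open_Collect_less l continuous_intros) auto
    ultimately obtain \<alpha> \<beta> where ab: "cmod \<alpha> = 1" "0 < l \<alpha>" "cmod \<beta> = 1" "l \<beta> < 0" "K \<alpha> \<noteq> K u" "K \<beta> \<noteq> K u"
      by auto
    have "K \<omega> = K u" if "cmod \<omega> = 1" "l \<omega> = 0" for \<omega> using chord[OF that] uv(3) by auto
    then show False
      using chord_dichotomy[OF cont inj open_map im bd l z _ ab(1-4)] ab(5,6) by blast
  qed
  have "cball 0 1 = ball 0 1 \<union> sphere (0::complex) 1" by auto
  moreover have "K ` ball 0 1 \<inter> K ` sphere 0 1 = {}" using im bd by force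
  ultimately show ?thesis using inj sph by (simp add: inj_on_Un) blast
qed

section \<open>A holomorphic function is not constant along the boundary\<close>

lemma cis_close:
  "cmod (cis a - cis b) \<le> \<bar>a - b\<bar>"
proof -
  have "cis a - cis b = cis b * (exp (\<i> * of_real (a - b)) - 1)"
    by (simp add: cis_conv_exp exp_diff ring_distribs field_simps)
  then have "cmod (cis a - cis b) = 2 * \<bar>sin ((a - b) / 2)\<bar>"
    by (simp add: norm_mult dist_exp_i_1 del: of_real_diff)
  also have "\<dots> \<le> 2 * \<bar>(a - b) / 2\<bar>" using abs_sin_x_le_abs_x[of "(a - b) / 2"] by (intro mult_left_mono) auto
  finally show ?thesis by simp
qed

lemma root_of_unity_close:
  assumes "cmod u = 1" "m > 0"
  obtains j where "j < m" "cmod (cis (2 * pi * real j / real m) - u) \<le> 2 * pi / real m"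
proof -
  define a where "a = Arg2pi u"
  have u: "u = cis a" using Arg2pi_eq[of u] assms(1) by (simp add: a_def cis_conv_exp)
  have a: "0 \<le> a" "a < 2 * pi" using Arg2pi[of u] by (auto simp: a_def)
  define x where "x = a * real m / (2 * pi)"
  have x: "0 \<le> x" "x < real m" using a assms(2) by (auto simp: x_def pos_divide_less_eq mult.commute mult_strict_left_mono)
  define j where "j = nat \<lfloor>x\<rfloor>"
  have "real j = of_int \<lfloor>x\<rfloor>" using x(1) by (simp add: j_def)
  then have j: "real j \<le> x" "x < real j + 1" by linarith+
  have "j < m" using j(1) x(2) by linarith
  have ax: "a = 2 * pi * x / real m" using assms(2) by (simp add: x_def)
  have "\<bar>2 * pi * real j / real m - a\<bar> = 2 * pi / real m * (x - real j)"
    unfolding ax using j(1) assms(2) by (simp add: abs_if field_simps)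
  also have "\<dots> \<le> 2 * pi / real m * 1" using j by (intro mult_left_mono) auto
  finally show ?thesis
    using that[OF \<open>j < m\<close>] cis_close[of "2 * pi * real j / real m" a] u by simp
qed

text \<open>The function is extended by zero beyond the boundary arc. The product of its rotations about
  a point \<open>q\<close> near the arc vanishes on the boundary of a neighbourhood of \<open>q\<close>.\<close>

lemma boundary_uniqueness:
  fixes U :: "complex set"
  assumes U: "open U" and hol: "f holomorphic_on U" and s: "s > 0"
    and p0: "p0 \<in> closure U" and ext: "p0 \<in> closure (- closure U)"
    and lim: "\<And>p. p \<in> frontier U \<Longrightarrow> dist p0 p < s \<Longrightarrow> (f \<longlongrightarrow> 0) (at p within U)"
  shows "\<exists>q\<in>U. f q = 0"
proof -
  define H where "H z = (if z \<in> U then f z else 0)" for z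
  have contH: "isCont H z" if z: "dist p0 z < s" for z
  proof (cases "z \<in> U")
    case True
    have "isCont f z" using True U hol holomorphic_on_imp_continuous_on continuous_on_eq_continuous_at by blast
    moreover have "\<forall>\<^sub>F x in nhds z. H x = f x"
      using eventually_nhds_in_open[OF U True] by eventually_elim (simp add: H_def)
    ultimately show ?thesis using isCont_cong by blast
  next
    case False
    show ?thesis
    proof (cases "z \<in> closure U")
      case True
      then have "z \<in> frontier U" using False U by (simp add: frontier_def interior_open)
      then have l: "(f \<longlongrightarrow> 0) (at z within U)" using lim z by blast
      have "(H \<longlongrightarrow> 0) (at z within UNIV)"
        unfolding Lim_within
      proof (intro allI impI)
        fix e :: real assume "e > 0"
        then obtain d where d: "d > 0" "\<forall>x\<in>U. 0 < dist x z \<and> dist x z < d \<longrightarrow> dist (f x) 0 < e"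
          using l unfolding Lim_within by blast
        then show "\<exists>d>0. \<forall>x\<in>UNIV. 0 < dist x z \<and> dist x z < d \<longrightarrow> dist (H x) 0 < e"
          using \<open>e > 0\<close> by (intro exI[of _ d]) (auto simp: H_def)
      qed
      moreover have "H z = 0" using False by (simp add: H_def)
      ultimately show ?thesis by (simp add: isCont_def)
    next
      case out: False
      have "\<forall>\<^sub>F x in nhds z. H x = 0"
      proof -
        have "\<forall>\<^sub>F x in nhds z. x \<in> - closure U" using out by (intro eventually_nhds_in_open) auto
        then show ?thesis
          by eventually_elim (use closure_subset[of U] in \<open>auto simp: H_def\<close>)
      qed
      then show ?thesis using isCont_cong[of H "\<lambda>_. 0" z] by simp
    qed
  qed
  obtain e where e: "e \<notin> closure U" "dist e p0 < s / 4"
    using ext s closure_approachable[of p0 "- closure U"] by (metis ComplD zero_less_divide_iff zero_less_numeral)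
  obtain q where q: "q \<in> U" "dist q p0 < s / 4"
    using p0 s closure_approachable[of p0 U] by (metis zero_less_divide_iff zero_less_numeral)
  have "\<exists>d>0. ball e d \<subseteq> - closure U"
    using e(1) by (intro open_contains_ball[THEN iffD1, rule_format]) auto
  then obtain d where d: "d > 0" "ball e d \<inter> closure U = {}" by blast
  define t where "t = dist q e"
  have t: "t > 0" "t < s / 2"
    using q e closure_subset[of U] dist_triangle2[of q e p0] by (auto simp: t_def)
  have near: "dist p0 z < s" if "dist q z \<le> t" for z
    using that t(2) q(2) dist_triangle[of p0 z q] s by (simp add: dist_commute)
  obtain m :: nat where "2 * pi * t / d < real m" using reals_Archimedean2 by blast
  then have m0: "2 * pi * t < real m * d" using d(1) by (simp add: pos_divide_less_eq)
  have "0 < 2 * pi * t" using t(1) by simp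
  then have "0 < real m * d" using m0 by linarith
  then have "m > 0" using d(1) by (auto simp: zero_less_mult_iff)
  then have m: "m > 0" "t * (2 * pi / real m) < d"
    using m0 by (simp_all add: pos_divide_less_eq mult.commute mult.left_commute)
  define w where "w j z = q + cis (2 * pi * real j / real m) * (z - q)" for j z
  have dw: "dist q (w j z) = dist q z" for j z by (simp add: w_def dist_norm norm_mult norm_minus_commute)
  define G where "G z = (\<Prod>j<m. H (w j z))" for z
  define S where "S = {z \<in> ball q t. \<forall>j<m. w j z \<in> U}"
  have contw: "continuous_on T (w j)" for T j unfolding w_def by (intro continuous_intros)
  have "open (w j -` U)" for j using U contw by (simp add: open_vimage)
  then have "open (ball q t \<inter> (\<Inter>j\<in>{..<m}. w j -` U))" by (intro open_Int open_ball open_INT) auto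
  moreover have "S = ball q t \<inter> (\<Inter>j\<in>{..<m}. w j -` U)" by (auto simp: S_def)
  ultimately have opS: "open S" by simp
  have clS: "closure S \<subseteq> cball q t" by (intro closure_minimal) (auto simp: S_def)
  have qS: "q \<in> S" using t(1) q(1) by (simp add: S_def w_def)
  have "cmod (G q) \<le> 0"
  proof (rule maximum_modulus_frontier[of G S])
    have "(\<lambda>z. H (w j z)) holomorphic_on S" if "j < m" for j
    proof -
      have "f \<circ> w j holomorphic_on S"
        unfolding w_def
        by (rule holomorphic_on_compose_gen[OF _ hol]) (use \<open>j < m\<close> in \<open>auto simp: S_def w_def intro!: holomorphic_intros\<close>)
      then show ?thesis
        by (rule holomorphic_transform) (use \<open>j < m\<close> in \<open>auto simp: H_def S_def\<close>)
    qed
    then show "G holomorphic_on interior S"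
      unfolding G_def interior_open[OF opS] by (intro holomorphic_intros) auto
    have "isCont G z" if "z \<in> closure S" for z
    proof -
      have "dist p0 (w j z) < s" for j using near[of "w j z"] dw clS that by auto
      then have "isCont (\<lambda>z. H (w j z)) z" for j
        using contH[of "w j z"] contw[of UNIV j]
        by (intro isCont_o2[of z "w j" H]) (simp_all add: continuous_on_eq_continuous_at)
      then show ?thesis unfolding G_def by (intro continuous_prod)
    qed
    then show "continuous_on (closure S) G" by (simp add: continuous_at_imp_continuous_on)
    show "bounded S" using clS closure_subset bounded_cball bounded_subset by (metis order_trans)
    show "q \<in> S" by (rule qS)
    fix z assume z: "z \<in> frontier S"
    then have zc: "z \<in> closure S" "z \<notin> S" using opS by (auto simp: frontier_def interior_open)
    have "\<exists>j<m. w j z \<notin> U"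
    proof (cases "z \<in> ball q t")
      case True
      then show ?thesis using zc(2) by (auto simp: S_def)
    next
      case False
      then have zt: "dist q z = t" using zc(1) clS by auto
      then have "z \<noteq> q" using t(1) by auto
      have "cmod ((e - q) / (z - q)) = 1" using zt t(1) by (simp add: norm_divide t_def dist_norm norm_minus_commute)
      then obtain j where j: "j < m" "cmod (cis (2 * pi * real j / real m) - (e - q) / (z - q)) \<le> 2 * pi / real m"
        using root_of_unity_close m(1) by blast
      have "w j z - e = (cis (2 * pi * real j / real m) - (e - q) / (z - q)) * (z - q)"
        using \<open>z \<noteq> q\<close> by (simp add: w_def field_simps)
      then have "dist (w j z) e = cmod (cis (2 * pi * real j / real m) - (e - q) / (z - q)) * t"
        using zt by (simp add: dist_norm norm_mult norm_minus_commute)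
      also have "\<dots> \<le> 2 * pi / real m * t" using j(2) t(1) by (intro mult_right_mono) auto
      also have "\<dots> < d" using m(2) by (simp add: mult.commute)
      finally have "w j z \<in> ball e d" by (simp add: dist_commute)
      then show ?thesis using j(1) d(2) closure_subset[of U] by blast
    qed
    then have "G z = 0" by (auto simp: G_def H_def)
    then show "cmod (G z) \<le> 0" by simp
  qed
  then have "G q = 0" by simp
  then obtain j where "j < m" "H (w j q) = 0" by (auto simp: G_def)
  then have "f q = 0" using q(1) by (simp add: w_def H_def)
  then show ?thesis using q(1) by blast
qed


section \<open>Star domains with a continuous gauge\<close>

lemma to_sphere_continuous: "continuous_on S to_sphere"
proof -
  have "1 + (cmod z)\<^sup>2 \<noteq> 0" "(cmod z)\<^sup>2 + 1 \<noteq> 0" for z :: complex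
    using zero_le_power2[of "cmod z"] by linarith+
  then show ?thesis unfolding to_sphere_def by (intro continuous_intros) auto
qed

lemma snd_to_sphere_less: "snd (to_sphere z) < 1"
proof -
  have "(cmod z)\<^sup>2 + 1 > 0" using zero_le_power2[of "cmod z"] by linarith
  then show ?thesis by (simp add: to_sphere_def pos_divide_less_eq)
qed

lemma inj_to_sphere: "inj to_sphere"
proof (rule injI)
  fix x y assume eq: "to_sphere x = to_sphere y"
  have pos: "(cmod z)\<^sup>2 + 1 > 0" for z :: complex using zero_le_power2[of "cmod z"] by linarith
  have "((cmod z)\<^sup>2 - 1) / ((cmod z)\<^sup>2 + 1) = 1 - 2 / ((cmod z)\<^sup>2 + 1)" for z :: complex
    using pos[of z] by (simp add: field_simps)
  then have "2 / ((cmod x)\<^sup>2 + 1) = 2 / ((cmod y)\<^sup>2 + 1)" using eq by (simp add: to_sphere_def)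
  then have "(2 / (1 + (cmod x)\<^sup>2)) *\<^sub>R x = (2 / (1 + (cmod x)\<^sup>2)) *\<^sub>R y"
    using eq by (simp add: to_sphere_def add.commute)
  then show "x = y" using pos[of x] by (simp add: add.commute)
qed

lemma dist_to_sphere_pole:
  assumes "z \<noteq> 0"
  shows "dist (to_sphere z) (0, 1) \<le> 4 / cmod z"
proof -
  have p: "cmod z > 0" "1 + (cmod z)\<^sup>2 > 0" using assms by (auto intro: add_pos_nonneg)
  have "dist (to_sphere z) (0, 1) \<le> dist (fst (to_sphere z)) 0 + dist (snd (to_sphere z)) 1"
    unfolding dist_prod_def by (simp add: sqrt_sum_squares_le_sum)
  also have "dist (fst (to_sphere z)) 0 = 2 * cmod z / (1 + (cmod z)\<^sup>2)"
    using p by (simp add: to_sphere_def dist_norm)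
  also have "\<dots> \<le> 2 / cmod z"
    using p by (simp add: divide_le_eq field_simps power2_eq_square)
  also have "dist (snd (to_sphere z)) 1 = 2 / (1 + (cmod z)\<^sup>2)"
  proof -
    have "snd (to_sphere z) - 1 = - (2 / (1 + (cmod z)\<^sup>2))"
      using p by (simp add: to_sphere_def field_simps)
    then show ?thesis using p by (simp add: dist_real_def abs_if)
  qed
  also have "\<dots> \<le> 2 / cmod z"
  proof (rule divide_left_mono)
    have "0 \<le> (cmod z - 1)\<^sup>2 + (cmod z)\<^sup>2 + 1" by (intro add_nonneg_nonneg) auto
    then show "cmod z \<le> 1 + (cmod z)\<^sup>2" by (simp add: power2_diff power2_eq_square algebra_simps)
  qed (use p in auto)
  finally show ?thesis by simp
qed

text \<open>The domain is \<open>m z < 1\<close>, and \<open>1 / m\<close> is its radial function; the domain is unbounded exactly in the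
  finitely many directions in which \<open>m\<close> vanishes.\<close>

locale gauge_domain =
  fixes m :: "complex \<Rightarrow> real"
  assumes cont_m: "continuous_on UNIV m"
    and homog: "\<And>t z. 0 \<le> t \<Longrightarrow> m (t *\<^sub>R z) = t * m z"
    and nonneg: "\<And>z. 0 \<le> m z"
    and finite_zeros: "finite {z. cmod z = 1 \<and> m z = 0}"
begin

definition U :: "complex set" where "U = {z. m z < 1}"

text \<open>Under the radial compression \<open>z / (1 + |z|)\<close> of the plane to the disk, the domain becomes the star domain
  with radial function \<open>1 / (1 + m)\<close>. Dividing by this function gives the homeomorphism \<open>psi\<close> from the domain to
  the disk, and \<open>B\<close> is its inverse. On the unit circle, \<open>B\<close> gives the boundary point \<open>w / m w\<close>
  in the direction \<open>w\<close>.\<close>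

definition B :: "complex \<Rightarrow> complex" where
  "B w = (cmod w / (cmod w + m w - (cmod w)\<^sup>2)) *\<^sub>R w"

definition psi :: "complex \<Rightarrow> complex" where
  "psi z = ((cmod z + m z) / (cmod z * (1 + cmod z))) *\<^sub>R z"

definition P :: "complex \<Rightarrow> complex \<times> real" where
  "P w = (if cmod w = 1 \<and> m w = 0 then (0, 1) else to_sphere (B w))"

lemma m_0: "m 0 = 0" using homog[of 0 0] by simp

lemma isCont_m: "isCont m z" using cont_m by (simp add: continuous_on_eq_continuous_at)

lemma zero_in_U: "0 \<in> U" by (simp add: U_def m_0)

lemma open_U: "open U"
  unfolding U_def by (intro open_Collect_less cont_m continuous_intros)

lemma starlike_U: "simply_connected U"
proof (rule starlike_imp_simply_connected)
  have "closed_segment 0 x \<subseteq> U" if x: "x \<in> U" for x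
  proof
    fix y assume "y \<in> closed_segment 0 x"
    then obtain t where t: "0 \<le> t" "t \<le> 1" "y = t *\<^sub>R x"
      by (auto simp: closed_segment_def)
    then have "m y \<le> m x" using homog[of t x] nonneg[of x] by (simp add: mult_left_le_one_le)
    then show "y \<in> U" using x by (simp add: U_def)
  qed
  then show "starlike U" unfolding starlike_def using zero_in_U by blast
qed

lemma denominator_pos:
  assumes "w \<noteq> 0" "cmod w \<le> 1" "cmod w < 1 \<or> m w \<noteq> 0"
  shows "cmod w + m w - (cmod w)\<^sup>2 > 0"
proof -
  have "cmod w + m w - (cmod w)\<^sup>2 = cmod w * (1 - cmod w) + m w" by (simp add: power2_eq_square algebra_simps)
  moreover have "cmod w * (1 - cmod w) > 0 \<or> m w > 0" using assms nonneg[of w] by auto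
  moreover have "cmod w * (1 - cmod w) \<ge> 0" using assms by simp
  ultimately show ?thesis using nonneg[of w] by linarith
qed

lemma cmod_B:
  assumes "w \<noteq> 0" "cmod w \<le> 1" "cmod w < 1 \<or> m w \<noteq> 0"
  shows "cmod (B w) = (cmod w)\<^sup>2 / (cmod w + m w - (cmod w)\<^sup>2)"
  using denominator_pos[OF assms] by (simp add: B_def power2_eq_square)

lemma isCont_B:
  assumes "cmod w < 1 \<or> cmod w = 1 \<and> m w \<noteq> 0"
  shows "isCont B w"
proof (cases "w = 0")
  case True
  have "((\<lambda>w. cmod w / (1 - cmod w)) \<longlongrightarrow> cmod 0 / (1 - cmod 0)) (at 0)" for w :: complex
    by (intro tendsto_intros) auto
  then have lim: "((\<lambda>w. cmod w / (1 - cmod w)) \<longlongrightarrow> 0) (at (0::complex))" by simp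
  have "cmod (B w) \<le> cmod w / (1 - cmod w)" if w: "w \<in> ball 0 1" "w \<noteq> 0" for w
  proof -
    have a: "cmod w * (1 - cmod w) > 0" using w by simp
    have "cmod (B w) = (cmod w)\<^sup>2 / (cmod w + m w - (cmod w)\<^sup>2)"
      using cmod_B[of w] w by simp
    also have "\<dots> \<le> (cmod w)\<^sup>2 / (cmod w * (1 - cmod w))"
      using a w nonneg[of w] denominator_pos[of w] by (intro divide_left_mono mult_pos_pos) (auto simp: power2_eq_square algebra_simps)
    also have "\<dots> = cmod w / (1 - cmod w)" using w by (simp add: power2_eq_square)
    finally show ?thesis .
  qed
  then have "\<forall>\<^sub>F w in at 0. norm (B w) \<le> cmod w / (1 - cmod w)"
    unfolding eventually_at_topological using open_ball[of "0::complex" 1] by (metis centre_in_ball zero_less_one)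
  then have "(B \<longlongrightarrow> 0) (at 0)" by (rule Lim_null_comparison[OF _ lim])
  moreover have "B 0 = 0" by (simp add: B_def)
  ultimately show ?thesis using True by (simp add: isCont_def)
next
  case False
  then show ?thesis unfolding B_def using denominator_pos[of w] assms
    by (intro continuous_intros isCont_m) (auto simp: less_imp_neq)
qed

lemma cmod_psi: "z \<noteq> 0 \<Longrightarrow> cmod (psi z) = (cmod z + m z) / (1 + cmod z)"
  using abs_of_nonneg[OF add_nonneg_nonneg[OF norm_ge_zero[of z] nonneg[of z]]]
  by (simp add: psi_def)

lemma isCont_psi: "isCont psi z"
proof (cases "z = 0")
  case True
  have "(m \<longlongrightarrow> 0) (at 0)" using isCont_m[of 0] by (simp add: isCont_def m_0)
  then have "((\<lambda>z. cmod z + m z) \<longlongrightarrow> cmod 0 + 0) (at 0)" by (intro tendsto_intros)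
  then have lim: "((\<lambda>z. cmod z + m z) \<longlongrightarrow> 0) (at 0)" by simp
  have "cmod (psi z) \<le> cmod z + m z" for z
  proof (cases "z = 0")
    case False
    have "cmod (psi z) = (cmod z + m z) / (1 + cmod z)"
      by (rule cmod_psi[OF False])
    also have "\<dots> \<le> (cmod z + m z) / 1"
      using nonneg[of z] by (intro divide_left_mono) (auto simp: add_pos_nonneg)
    also have "\<dots> = cmod z + m z" by simp
    finally show ?thesis .
  qed (simp add: psi_def m_0)
  then have "(psi \<longlongrightarrow> 0) (at 0)" by (intro Lim_null_comparison[OF _ lim]) auto
  moreover have "psi 0 = 0" by (simp add: psi_def)
  ultimately show ?thesis using True by (simp add: isCont_def)
next
  case False
  have "1 + cmod z \<noteq> 0" using norm_ge_zero[of z] by linarith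
  then show ?thesis unfolding psi_def using False
    by (intro continuous_intros isCont_m) auto
qed

lemma psi_B:
  assumes "cmod w < 1 \<or> cmod w = 1 \<and> m w \<noteq> 0"
  shows "psi (B w) = w"
proof (cases "w = 0")
  case False
  define N where "N = cmod w + m w - (cmod w)\<^sup>2"
  have N: "N > 0" using denominator_pos[of w] assms False by (auto simp: N_def)
  define t where "t = cmod w / N"
  have t: "t > 0" using N False by (simp add: t_def)
  have w: "B w = t *\<^sub>R w" by (simp add: B_def t_def N_def)
  have mB: "m (B w) = t * m w" and cB: "cmod (B w) = t * cmod w" using t by (simp_all add: w homog)
  have sm: "cmod w + m w > 0" using False nonneg[of w] by (simp add: add_pos_nonneg)
  have eq: "1 + t * cmod w = (cmod w + m w) / N" using N by (simp add: t_def N_def field_simps power2_eq_square)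
  have "psi (B w) = ((t * cmod w + t * m w) / (t * cmod w * ((cmod w + m w) / N)) * t) *\<^sub>R w"
    unfolding psi_def mB cB eq unfolding w by simp
  also have "(t * cmod w + t * m w) / (t * cmod w * ((cmod w + m w) / N)) * t = 1"
  proof -
    define X where "X = cmod w + m w"
    have "t * X / (t * cmod w * (X / N)) * t = 1"
      using sm N False by (simp add: t_def X_def[symmetric])
    moreover have "t * cmod w + t * m w = t * X" by (simp add: X_def distrib_left)
    ultimately show ?thesis unfolding X_def[symmetric] by (simp only:)
  qed
  finally show ?thesis by simp
qed (simp add: psi_def B_def)

lemma psi_ball_iff: "cmod (psi z) < 1 \<longleftrightarrow> z \<in> U"
proof (cases "z = 0")
  case False
  then have "1 + cmod z > 0" by (simp add: add_pos_pos)
  then show ?thesis using cmod_psi[OF False] by (simp add: U_def pos_divide_less_eq)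
qed (simp add: psi_def U_def m_0)

lemma psi_sphere: "m z = 1 \<Longrightarrow> cmod (psi z) = 1"
proof -
  assume "m z = 1"
  then have "z \<noteq> 0" using m_0 by auto
  then show ?thesis using cmod_psi[of z] \<open>m z = 1\<close> by (simp add: add.commute add_pos_pos less_imp_neq[symmetric])
qed

lemma B_psi: "B (psi z) = z"
proof (cases "z = 0")
  case False
  define a where "a = (cmod z + m z) / (cmod z * (1 + cmod z))"
  have z: "cmod z > 0" "cmod z + m z > 0" "1 + cmod z > 0" using False nonneg[of z] by (auto intro: add_pos_nonneg add_pos_pos)
  then have a: "a > 0" by (simp add: a_def)
  have p: "psi z = a *\<^sub>R z" by (simp add: psi_def a_def)
  have mp: "m (psi z) = a * m z" "cmod (psi z) = a * cmod z" using a by (simp_all add: p homog)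
  have az: "a * cmod z = (cmod z + m z) / (1 + cmod z)" using z by (simp add: a_def)
  have "cmod z + m z - cmod z * (a * cmod z) = a * cmod z"
    unfolding az using z by (simp add: field_simps)
  then have D: "a * cmod z + a * m z - (a * cmod z)\<^sup>2 = a * (a * cmod z)"
    by (simp add: power2_eq_square) (metis (no_types, opaque_lifting) distrib_left mult.assoc mult.commute right_diff_distrib)
  have "B (psi z) = (a * cmod z / (a * (a * cmod z)) * a) *\<^sub>R z"
    unfolding B_def mp D unfolding p by simp
  also have "a * cmod z / (a * (a * cmod z)) * a = 1" using a z by simp
  finally show ?thesis by simp
qed (simp add: psi_def B_def)

lemma homeomorphism_B: "homeomorphism (ball 0 1) U B psi"
proof (rule homeomorphismI)
  show "continuous_on (ball 0 1) B" using isCont_B by (auto intro: continuous_at_imp_continuous_on)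
  show "continuous_on U psi" using isCont_psi by (auto intro: continuous_at_imp_continuous_on)
  show "B ` ball 0 1 \<subseteq> U" using psi_ball_iff psi_B by (metis image_subsetI mem_ball_0)
  show "psi ` U \<subseteq> ball 0 1" using psi_ball_iff by auto
qed (use psi_B B_psi in auto)

lemma m_B: "cmod w = 1 \<Longrightarrow> m w \<noteq> 0 \<Longrightarrow> m (B w) = 1"
  using homog[of "1 / m w" w] nonneg[of w] by (simp add: B_def)

lemma dist_P_pole:
  assumes "w \<noteq> 0" "cmod w \<le> 1"
  shows "dist (P w) (0, 1) \<le> 4 * (cmod w + m w - (cmod w)\<^sup>2) / (cmod w)\<^sup>2"
proof (cases "cmod w = 1 \<and> m w = 0")
  case False
  then have N: "cmod w + m w - (cmod w)\<^sup>2 > 0" using denominator_pos assms by auto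
  have "cmod (B w) = (cmod w)\<^sup>2 / (cmod w + m w - (cmod w)\<^sup>2)"
    using cmod_B assms False by auto
  moreover then have "B w \<noteq> 0" using N assms(1) by auto
  ultimately show ?thesis using dist_to_sphere_pole[of "B w"] False by (auto simp: P_def)
qed (simp add: P_def)

sublocale disk_parametrization P "to_sphere ` U" "{z. cmod z = 1 \<and> m z = 0}"
proof
  let ?Z = "{z. cmod z = 1 \<and> m z = 0}"
  have PB: "P w = to_sphere (B w)" if "w \<notin> ?Z" for w using that by (auto simp: P_def)
  show "continuous_on (cball 0 1) P"
    unfolding continuous_on_eq_continuous_within
  proof
    fix w assume w: "w \<in> cball (0::complex) 1"
    show "continuous (at w within cball 0 1) P"
    proof (cases "w \<in> ?Z")
      case True
      define N where "N w = 4 * (cmod w + m w - (cmod w)\<^sup>2) / (cmod w)\<^sup>2" for w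
      have "isCont N w" unfolding N_def using True by (intro continuous_intros isCont_m) auto
      moreover have "N w = 0" using True by (simp add: N_def)
      ultimately have lim: "(N \<longlongrightarrow> 0) (at w within cball 0 1)"
        by (metis isCont_def tendsto_within_subset subset_UNIV)
      have ev: "\<forall>\<^sub>F x in at w within cball 0 1. dist (P x) (0, 1) \<le> N x"
      proof -
        have "\<forall>\<^sub>F x in at w within cball 0 1. x \<in> - {0}"
          using True by (intro eventually_at_in_open'[THEN filter_leD[OF at_le[OF subset_UNIV]]]) auto
        moreover have "\<forall>\<^sub>F x in at w within cball 0 1. x \<in> cball 0 1" by (simp add: eventually_at_filter)
        ultimately show ?thesis by eventually_elim (use dist_P_pole in \<open>auto simp: N_def\<close>)
      qed
      have "((\<lambda>x. dist (P x) (0, 1)) \<longlongrightarrow> 0) (at w within cball 0 1)"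
        by (rule tendsto_sandwich[OF _ ev tendsto_const lim]) simp
      then have "(P \<longlongrightarrow> (0, 1)) (at w within cball 0 1)" by (rule tendsto_dist_iff[THEN iffD2])
      moreover have "P w = (0, 1)" using True by (simp add: P_def)
      ultimately show ?thesis by (simp add: continuous_within)
    next
      case False
      have "closed ?Z" by (rule finite_imp_closed[OF finite_zeros])
      then have "\<forall>\<^sub>F x in nhds w. x \<in> - ?Z" using False by (intro eventually_nhds_in_open) auto
      then have "\<forall>\<^sub>F x in nhds w. P x = to_sphere (B x)" by eventually_elim (use PB in blast)
      moreover have "isCont (\<lambda>x. to_sphere (B x)) w"
      proof (rule isCont_o2[of w B to_sphere])
        show "isCont B w" using isCont_B[of w] w False by (auto simp: less_le)
        show "isCont to_sphere (B w)" using to_sphere_continuous[of UNIV] by (simp add: continuous_on_eq_continuous_at)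
      qed
      ultimately have "isCont P w" by (simp add: isCont_cong)
      then show ?thesis by (rule continuous_at_imp_continuous_at_within)
    qed
  qed
  have Pball: "P w = to_sphere (B w)" if "w \<in> ball 0 1" for w using that by (simp add: P_def)
  show "inj_on P (ball 0 1)"
  proof (rule inj_onI)
    fix x y assume "x \<in> ball (0::complex) 1" "y \<in> ball 0 1" "P x = P y"
    then show "x = y" using Pball inj_to_sphere psi_B by (metis injD mem_ball_0)
  qed
  have "P ` ball 0 1 = to_sphere ` B ` ball 0 1" unfolding image_image using Pball by (intro image_cong) auto
  then show "P ` ball 0 1 = to_sphere ` U" using homeomorphism_B by (simp add: homeomorphism_def)
  show "P ` sphere 0 1 \<inter> to_sphere ` U = {}"
  proof (rule ccontr)
    assume "\<not> ?thesis"
    then obtain w z where wz: "w \<in> sphere 0 1" "z \<in> U" "P w = to_sphere z" by blast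
    show False
    proof (cases "m w = 0")
      case True
      then have "to_sphere z = (0, 1)" using wz by (simp add: P_def)
      then show ?thesis using snd_to_sphere_less[of z] by simp
    next
      case False
      then have "to_sphere (B w) = to_sphere z" using wz PB[of w] by simp
      then have "B w = z" by (rule injD[OF inj_to_sphere])
      then show ?thesis using m_B[of w] False wz by (auto simp: U_def)
    qed
  qed
  show "finite ?Z" by (rule finite_zeros)
  show "inj_on P (sphere 0 1 - ?Z)"
  proof (rule inj_onI)
    fix x y assume xy: "x \<in> sphere 0 1 - ?Z" "y \<in> sphere 0 1 - ?Z" "P x = P y"
    then have "to_sphere (B x) = to_sphere (B y)" using PB[of x] PB[of y] by simp
    then have "B x = B y" by (rule injD[OF inj_to_sphere])
    moreover have "psi (B x) = x" "psi (B y) = y" using xy(1,2) by (auto intro: psi_B)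
    ultimately show "x = y" by metis
  qed
qed

lemma q_to_sphere: "z \<in> U \<Longrightarrow> q (to_sphere z) = psi z"
  using q(3)[of "psi z"] psi_ball_iff[of z] B_psi[of z] by (auto simp: P_def)

text \<open>An open set that meets the circle contains infinitely many of its points.\<close>

lemma exists_regular_direction:
  assumes T: "open T" "\<omega> \<in> T" "cmod \<omega> = 1"
  shows "\<exists>z\<in>T. cmod z = 1 \<and> m z \<noteq> 0"
proof -
  have "open ((\<lambda>t. \<omega> * cis t) -` T)" using T(1) by (intro open_vimage continuous_intros)
  moreover have "0 \<in> (\<lambda>t. \<omega> * cis t) -` T" using T(2) by simp
  ultimately obtain d where d: "d > 0" "ball 0 d \<subseteq> (\<lambda>t. \<omega> * cis t) -` T" by (rule openE)
  have "inj_on (\<lambda>t. \<omega> * cis t) {0<..<min d 1}"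
  proof (rule inj_onI)
    fix s t :: real assume st: "s \<in> {0<..<min d 1}" "t \<in> {0<..<min d 1}" "\<omega> * cis s = \<omega> * cis t"
    have "\<omega> \<noteq> 0" using T(3) by auto
    then have "Arg (cis s) = Arg (cis t)" using st by simp
    moreover have "Arg (cis u) = u" if "u \<in> {0<..<min d 1}" for u
      using that pi_gt3 by (intro cis_Arg_unique) auto
    ultimately show "s = t" using st by simp
  qed
  moreover have "infinite {0<..<min d 1}" using d(1) by simp
  ultimately have "infinite ((\<lambda>t. \<omega> * cis t) ` {0<..<min d 1})" by (simp add: finite_image_iff)
  then obtain z where z: "z \<in> (\<lambda>t. \<omega> * cis t) ` {0<..<min d 1}" "z \<notin> {z. cmod z = 1 \<and> m z = 0}"
    using finite_zeros by (meson finite_subset subsetI)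
  then show ?thesis using d(2) T(3) by (force simp: norm_mult)
qed

lemma exterior: "open {z. m z > 1}" "{z. m z > 1} \<inter> closure U = {}"
proof -
  show "open {z. m z > 1}" by (intro open_Collect_less cont_m continuous_intros)
  have "closed {z. m z \<le> 1}" by (intro closed_Collect_le cont_m continuous_intros)
  then have "closure U \<subseteq> {z. m z \<le> 1}" by (intro closure_minimal) (auto simp: U_def)
  then show "{z. m z > 1} \<inter> closure U = {}" by auto
qed

lemma exterior_point:
  "\<exists>p. \<exists>d>0. \<forall>u\<in>U. cmod (u - p) \<ge> d"
proof -
  obtain z where z: "cmod z = 1" "m z \<noteq> 0" using exists_regular_direction[of UNIV 1] by auto
  have "m ((2 / m z) *\<^sub>R z) = 2" using homog[of "2 / m z" z] nonneg[of z] z(2) by simp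
  then have "(2 / m z) *\<^sub>R z \<in> {z. m z > 1}" by simp
  then obtain d where d: "d > 0" "ball ((2 / m z) *\<^sub>R z) d \<subseteq> {z. m z > 1}"
    using exterior(1) openE by blast
  show ?thesis
  proof (rule exI[of _ "(2 / m z) *\<^sub>R z"], rule exI[of _ d], intro conjI ballI d(1), rule ccontr)
    fix u assume u: "u \<in> U" "\<not> d \<le> cmod (u - (2 / m z) *\<^sub>R z)"
    then have "u \<in> ball ((2 / m z) *\<^sub>R z) d" by (simp add: dist_norm norm_minus_commute)
    then show False using d(2) u(1) by (auto simp: U_def)
  qed
qed

lemma tendsto_inverse_B:
  assumes "cmod \<omega> = 1" "m \<omega> = 0"
  shows "((\<lambda>w. inverse (B w)) \<longlongrightarrow> 0) (at \<omega> within ball 0 1)"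
proof -
  define N where "N w = (cmod w + m w - (cmod w)\<^sup>2) / (cmod w)\<^sup>2" for w
  have "isCont N \<omega>" unfolding N_def using assms by (intro continuous_intros isCont_m) auto
  moreover have "N \<omega> = 0" using assms by (simp add: N_def)
  ultimately have "(N \<longlongrightarrow> 0) (at \<omega> within ball 0 1)"
    by (metis isCont_def tendsto_within_subset subset_UNIV)
  moreover have "norm (inverse (B w)) \<le> N w" if "w \<in> ball 0 1" for w
  proof (cases "w = 0")
    case False
    then show ?thesis using cmod_B[of w] that by (simp add: norm_inverse N_def)
  qed (simp add: B_def N_def)
  then have "\<forall>\<^sub>F w in at \<omega> within ball 0 1. norm (inverse (B w)) \<le> N w"
    by (simp add: eventually_at_filter)
  ultimately show ?thesis by (rule Lim_null_comparison[rotated])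
qed

text \<open>With \<open>p\<close> outside the closure of the domain, the function is \<open>(u - c) / (u - p)\<close> for a finite boundary point
  \<open>c\<close>, and \<open>1 / (u - p)\<close> for the point at infinity.\<close>

lemma vanishing_function:
  assumes w: "cmod (\<omega>::complex) = 1"
  obtains g M where "g holomorphic_on U" "M > 0" "\<And>u. u \<in> U \<Longrightarrow> cmod (g u) \<le> M" "\<And>u. u \<in> U \<Longrightarrow> g u \<noteq> 0"
    "((\<lambda>w. g (B w)) \<longlongrightarrow> 0) (at \<omega> within ball 0 1)"
proof -
  obtain p d where p: "d > 0" "\<And>u. u \<in> U \<Longrightarrow> cmod (u - p) \<ge> d"
    using exterior_point by blast
  have up: "u \<noteq> p" if "u \<in> U" for u using p(1) p(2)[OF that] by auto
  show ?thesis
  proof (cases "m \<omega> = 0")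
    case True
    show ?thesis
    proof (rule that[of "\<lambda>u. 1 / (u - p)" "1 / d"])
      show "(\<lambda>u. 1 / (u - p)) holomorphic_on U" using up by (intro holomorphic_intros) auto
      show "1 / d > 0" using p(1) by simp
      show "cmod (1 / (u - p)) \<le> 1 / d" if "u \<in> U" for u
        using p(1) p(2)[OF that] by (simp add: norm_divide frac_le)
      show "1 / (u - p) \<noteq> 0" if "u \<in> U" for u using up[OF that] by simp
      have "((\<lambda>w. inverse (B w) / (1 - p * inverse (B w))) \<longlongrightarrow> 0 / (1 - p * 0)) (at \<omega> within ball 0 1)"
        by (intro tendsto_intros tendsto_inverse_B w True) auto
      then have lim: "((\<lambda>w. inverse (B w) / (1 - p * inverse (B w))) \<longlongrightarrow> 0) (at \<omega> within ball 0 1)" by simp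
      have "\<forall>\<^sub>F x in at \<omega> within ball 0 1. x \<in> - {0}"
        using w by (intro eventually_at_in_open'[THEN filter_leD[OF at_le[OF subset_UNIV]]]) auto
      moreover have "\<forall>\<^sub>F x in at \<omega> within ball 0 1. x \<in> ball 0 1" by (simp add: eventually_at_filter)
      ultimately have "\<forall>\<^sub>F x in at \<omega> within ball 0 1. inverse (B x) / (1 - p * inverse (B x)) = 1 / (B x - p)"
      proof eventually_elim
        case (elim x)
        then have "B x \<noteq> 0" using psi_B[of x] by (auto simp: psi_def)
        then show ?case by (simp add: field_simps)
      qed
      then show "((\<lambda>w. 1 / (B w - p)) \<longlongrightarrow> 0) (at \<omega> within ball 0 1)"
        using lim by (rule Lim_transform_eventually[rotated])
    qed
  next
    case False
    define c where "c = B \<omega>"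
    have mc: "m c = 1" using m_B[OF w False] by (simp add: c_def)
    show ?thesis
    proof (rule that[of "\<lambda>u. (u - c) / (u - p)" "1 + cmod (p - c) / d"])
      show "(\<lambda>u. (u - c) / (u - p)) holomorphic_on U" using up by (intro holomorphic_intros) auto
      show "1 + cmod (p - c) / d > 0" using p(1) by (simp add: add_pos_nonneg)
      show "cmod ((u - c) / (u - p)) \<le> 1 + cmod (p - c) / d" if "u \<in> U" for u
      proof -
        have "(u - c) / (u - p) = 1 + (p - c) / (u - p)" using up[OF that] by (simp add: field_simps)
        then have "cmod ((u - c) / (u - p)) \<le> 1 + cmod (p - c) / cmod (u - p)"
          using norm_triangle_ineq[of 1 "(p - c) / (u - p)"] by (simp add: norm_divide)
        also have "\<dots> \<le> 1 + cmod (p - c) / d" using p(1) p(2)[OF that] by (simp add: frac_le)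
        finally show ?thesis .
      qed
      show "(u - c) / (u - p) \<noteq> 0" if "u \<in> U" for u using up[OF that] mc that by (auto simp: U_def)
      have "(B \<longlongrightarrow> c) (at \<omega> within ball 0 1)"
        using isCont_B[of \<omega>] w False unfolding c_def isCont_def by (meson tendsto_within_subset subset_UNIV)
      moreover have "c \<noteq> p"
      proof
        assume "c = p"
        have "B ` ball 0 1 \<subseteq> U" using homeomorphism_B by (simp add: homeomorphism_def)
        obtain d' where d': "d' > 0" "\<forall>x\<in>ball 0 1. 0 < dist x \<omega> \<and> dist x \<omega> < d' \<longrightarrow> dist (B x) c < d"
          using \<open>(B \<longlongrightarrow> c) _\<close> p(1) unfolding Lim_within by blast
        obtain x where x: "x \<in> ball 0 1" "x \<in> ball \<omega> d'" using ball_inter_ball_nonempty[OF w d'(1)] by blast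
        then have "x \<noteq> \<omega>" using w by auto
        then have "dist (B x) c < d" using d'(2) x by (auto simp: dist_commute)
        then show False using p(2)[of "B x"] \<open>B ` ball 0 1 \<subseteq> U\<close> x(1) \<open>c = p\<close> by (auto simp: dist_norm image_subset_iff)
      qed
      ultimately have "((\<lambda>w. (B w - c) / (B w - p)) \<longlongrightarrow> (c - c) / (c - p)) (at \<omega> within ball 0 1)"
        by (intro tendsto_intros) auto
      then show "((\<lambda>w. (B w - c) / (B w - p)) \<longlongrightarrow> 0) (at \<omega> within ball 0 1)" by simp
    qed
  qed
qed

end


section \<open>The Riemann map of a star domain up to the boundary\<close>

locale gauge_riemann = gauge_domain +
  fixes \<phi> f :: "complex \<Rightarrow> complex"
  assumes hol: "\<phi> holomorphic_on U" and holf: "f holomorphic_on ball 0 1"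
    and f_phi: "\<And>z. z \<in> U \<Longrightarrow> \<phi> z \<in> ball 0 1 \<and> f (\<phi> z) = z"
    and phi_f: "\<And>w. w \<in> ball 0 1 \<Longrightarrow> f w \<in> U \<and> \<phi> (f w) = w"
begin

lemma homeomorphism_phi: "homeomorphism U (ball 0 1) \<phi> f"
  by (rule homeomorphismI)
    (use holomorphic_on_imp_continuous_on[OF hol] holomorphic_on_imp_continuous_on[OF holf] f_phi phi_f in auto)

lemma homeomorphism_phi_B: "homeomorphism (ball 0 1) (ball 0 1) (\<phi> \<circ> B) (psi \<circ> f)"
  by (rule homeomorphism_compose[OF homeomorphism_B homeomorphism_phi])

lemma B_in_U: "w \<in> ball 0 1 \<Longrightarrow> B w \<in> U"
  using homeomorphism_B by (auto simp: homeomorphism_def)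

text \<open>By Koebe's lemma, images of short circular arcs are small: a bounded function vanishing at the
  boundary point is small on them.\<close>

lemma small_arcs:
  assumes w: "cmod \<omega> = 1" and e: "e > 0"
  shows "\<exists>r. 0 < r \<and> r < e \<and> (\<forall>x\<in>ball 0 1 \<inter> sphere \<omega> r. \<forall>y\<in>ball 0 1 \<inter> sphere \<omega> r.
    dist ((\<phi> \<circ> B) x) ((\<phi> \<circ> B) y) \<le> e)"
proof -
  obtain g M where g: "g holomorphic_on U" "M > 0" "\<And>u. u \<in> U \<Longrightarrow> cmod (g u) \<le> M" "\<And>u. u \<in> U \<Longrightarrow> g u \<noteq> 0"
    "((\<lambda>w. g (B w)) \<longlongrightarrow> 0) (at \<omega> within ball 0 1)"
    using vanishing_function[OF w] by metis
  define d where "d = min e 1"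
  have d: "0 < d" "d \<le> 1" "d \<le> e" using e by (auto simp: d_def)
  define v where "v = cmod (g (f 0))"
  have "v > 0" using g(4)[of "f 0"] phi_f[of 0] by (simp add: v_def)
  obtain e' where e': "e' > 0" "\<And>f K x y. f holomorphic_on ball 0 1 \<Longrightarrow>
    (\<And>z. z \<in> ball 0 1 \<Longrightarrow> cmod (f z) \<le> M) \<Longrightarrow> cmod (f 0) \<ge> v \<Longrightarrow> compact K \<Longrightarrow> connected K \<Longrightarrow>
    K \<subseteq> ball 0 1 \<Longrightarrow> (\<And>z. z \<in> K \<Longrightarrow> cmod (f z) \<le> e' \<and> cmod z \<ge> 1 - d / 2) \<Longrightarrow> x \<in> K \<Longrightarrow> y \<in> K \<Longrightarrow>
    dist x y \<le> d"
    using Koebe[OF g(2) d(1,2) \<open>v > 0\<close>] by blast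
  obtain d1 where d1: "d1 > 0" "\<forall>x\<in>ball 0 1. 0 < dist x \<omega> \<and> dist x \<omega> < d1 \<longrightarrow> dist (g (B x)) 0 < e'"
    using g(5) e'(1) unfolding Lim_within by blast
  obtain d2 where d2: "d2 > 0" "\<And>z. cmod z < 1 \<Longrightarrow> cmod z > 1 - d2 \<Longrightarrow> cmod ((\<phi> \<circ> B) z) > 1 - d / 2"
    using tendsto_bdry_of_homeomorphism_disk[OF homeomorphism_phi_B, of "d / 2"] d(1) by auto
  define r where "r = min (min e 1) (min d1 d2) / 2"
  have r: "0 < r" "r < e" "r < 1" "r < d1" "r < d2" using e d1(1) d2(1) by (auto simp: r_def)
  have holg: "g \<circ> f holomorphic_on ball 0 1"
    using phi_f by (intro holomorphic_on_compose_gen[OF holf g(1)]) auto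
  have "dist ((\<phi> \<circ> B) x) ((\<phi> \<circ> B) y) \<le> e"
    if x: "x \<in> ball 0 1 \<inter> sphere \<omega> r" and y: "y \<in> ball 0 1 \<inter> sphere \<omega> r" for x y
  proof -
    have r2: "r < 2" using r by simp
    note arc = arc_at[OF w r(1) r2]
    obtain s t where st: "s \<in> {0<..<1}" "t \<in> {0<..<1}" "x = arc_at \<omega> r s" "y = arc_at \<omega> r t"
      using x y unfolding arc(1)[symmetric] by blast
    define C where "C = arc_at \<omega> r ` {min s t..max s t}"
    have "{min s t..max s t} \<subseteq> {0<..<1}" using st by auto
    then have C: "C \<subseteq> ball 0 1 \<inter> sphere \<omega> r" unfolding C_def arc(1)[symmetric] by (rule image_mono)
    have xyC: "x \<in> C" "y \<in> C" unfolding C_def st by auto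
    have cont: "continuous_on C (\<phi> \<circ> B)"
      using homeomorphism_phi_B C by (auto simp: homeomorphism_def intro: continuous_on_subset)
    define K where "K = (\<phi> \<circ> B) ` C"
    have K: "compact K" "connected K" unfolding K_def C_def
      by (intro compact_continuous_image connected_continuous_image cont[unfolded C_def] arc(5)
          compact_Icc connected_Icc)+
    have K1: "K \<subseteq> ball 0 1" using C f_phi B_in_U by (auto simp: K_def)
    have near: "cmod ((g \<circ> f) z) \<le> e' \<and> cmod z \<ge> 1 - d / 2" if z: "z \<in> K" for z
    proof -
      obtain u where u: "u \<in> C" "z = \<phi> (B u)" using z by (auto simp: K_def)
      then have ub: "u \<in> ball 0 1" "dist \<omega> u = r" using C by auto
      have "f z = B u" using f_phi B_in_U ub(1) u(2) by simp
      moreover have "dist u \<omega> = r" using ub(2) by (simp add: dist_commute)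
      then have "dist (g (B u)) 0 < e'" using d1(2) ub(1) r by auto
      moreover have "cmod u > 1 - d2" using ub(2) w r norm_triangle_ineq2[of \<omega> u] by (simp add: dist_norm)
      then have "cmod z > 1 - d / 2" using d2(2)[of u] ub(1) u(2) by simp
      ultimately show ?thesis by simp
    qed
    have "dist ((\<phi> \<circ> B) x) ((\<phi> \<circ> B) y) \<le> d"
      using e'(2)[OF holg _ _ K K1 near, of "(\<phi> \<circ> B) x" "(\<phi> \<circ> B) y"] g(3) phi_f xyC
      by (simp add: K_def v_def)
    then show ?thesis using d(3) by simp
  qed
  then show ?thesis using r by blast
qed

lemma closure_U_boundary:
  assumes "m p = 1"
  shows "p \<in> closure U" and "p \<in> closure (- closure U)"
proof -
  have "((\<lambda>t. t *\<^sub>R p) \<longlongrightarrow> 1 *\<^sub>R p) (at 1 within S)" for S by (intro tendsto_intros)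
  then have lim: "((\<lambda>t. t *\<^sub>R p) \<longlongrightarrow> p) (at 1 within S)" for S by simp
  have m: "m (t *\<^sub>R p) = t" if "t \<ge> 0" for t using homog[OF that] assms by simp
  have pos: "\<forall>\<^sub>F t in at (1::real) within S. t > 0" for S
    using order_tendstoD(1)[OF tendsto_ident_at[of "1::real" S], of 0] by simp
  have "\<forall>\<^sub>F t in at (1::real) within {..<1}. t < 1" by (simp add: eventually_at_filter)
  then have "\<forall>\<^sub>F t in at 1 within {..<1}. t *\<^sub>R p \<in> closure U"
    using pos[of "{..<1}"] by eventually_elim (use m closure_subset[of U] in \<open>auto simp: U_def\<close>)
  then show "p \<in> closure U"
    by (rule Lim_in_closed_set[OF closed_closure _ trivial_limit_at_left_real lim])
  have "\<forall>\<^sub>F t in at (1::real) within {1<..}. t > 1" by (simp add: eventually_at_filter)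
  then have "\<forall>\<^sub>F t in at 1 within {1<..}. t *\<^sub>R p \<in> closure (- closure U)"
    using pos[of "{1<..}"]
  proof eventually_elim
    case (elim t)
    then have "t *\<^sub>R p \<in> {z. 1 < m z}" using m[of t] by simp
    then have "t *\<^sub>R p \<in> - closure U" using exterior(2) by blast
    then show ?case by (rule subsetD[OF closure_subset])
  qed
  then show "p \<in> closure (- closure U)"
    by (rule Lim_in_closed_set[OF closed_closure _ trivial_limit_at_right_real lim])
qed

text \<open>If the extension were constant on an arc of directions, the Riemann map would tend to a constant along
  the corresponding boundary arc of the domain; such an arc has finite points with the exterior of the domain
  nearby.\<close>

theorem extends_to_circle:
  obtains K L where "homeomorphism (cball 0 1) (cball 0 1) K L" "\<And>w. w \<in> ball 0 1 \<Longrightarrow> K w = \<phi> (B w)"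
    "K ` sphere 0 1 = sphere 0 1"
proof -
  obtain K where K: "continuous_on (cball 0 1) K" "\<And>z. z \<in> ball 0 1 \<Longrightarrow> K z = (\<phi> \<circ> B) z"
    "K ` sphere 0 1 = sphere 0 1"
    using extension_to_cball[OF homeomorphism_phi_B small_arcs] by metis
  have inj: "inj_on (\<phi> \<circ> B) (ball 0 1)" and im: "(\<phi> \<circ> B) ` ball 0 1 = ball 0 1"
    using homeomorphism_phi_B inj_on_inverseI[of "ball 0 1" "psi \<circ> f" "\<phi> \<circ> B"]
    unfolding homeomorphism_def by blast+
  have injK: "inj_on K (ball 0 1)" using inj K(2) inj_on_cong[of "ball 0 1" K "\<phi> \<circ> B"] by blast
  have imK: "K ` ball 0 1 = ball 0 1" using im K(2) by (metis image_cong)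
  have "open (K ` S)" if S: "open S" "S \<subseteq> ball 0 1" for S
  proof -
    have "openin (top_of_set (ball 0 1)) ((\<phi> \<circ> B) ` S)"
      using homeomorphism_imp_open_map[OF homeomorphism_phi_B] S by (simp add: open_subset)
    moreover have "(\<phi> \<circ> B) ` S = K ` S" using K(2) S(2) by (intro image_cong) auto
    ultimately show ?thesis by (simp add: openin_open_eq)
  qed
  moreover have "\<exists>\<omega>\<in>T \<inter> sphere 0 1. K \<omega> \<noteq> \<zeta>" if T: "open T" "T \<inter> sphere 0 1 \<noteq> {}" for T \<zeta>
  proof (rule ccontr)
    assume "\<not> ?thesis"
    then have const: "K \<omega> = \<zeta>" if "\<omega> \<in> T" "cmod \<omega> = 1" for \<omega> using that by auto
    obtain \<omega>' where "\<omega>' \<in> T" "\<omega>' \<in> sphere 0 1" using T(2) by blast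
    then obtain \<omega> where w: "\<omega> \<in> T" "cmod \<omega> = 1" "m \<omega> \<noteq> 0"
      using exists_regular_direction[OF T(1), of \<omega>'] by auto
    have z1: "cmod \<zeta> = 1" using const[OF w(1,2)] K(3) w(2) by (metis imageI mem_sphere_0)
    define p where "p = B \<omega>"
    have mp: "m p = 1" using m_B w by (simp add: p_def)
    have "psi p = \<omega>" using psi_B w by (simp add: p_def)
    have "open (psi -` T)" using T(1) isCont_psi by (intro open_vimage continuous_at_imp_continuous_on) auto
    moreover have "p \<in> psi -` T" using w(1) \<open>psi p = \<omega>\<close> by simp
    ultimately obtain s where s: "s > 0" "ball p s \<subseteq> psi -` T" by (rule openE)
    have "\<exists>q\<in>U. \<phi> q - \<zeta> = 0"
    proof (rule boundary_uniqueness[OF open_U _ s(1) closure_U_boundary[OF mp]])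
      show "(\<lambda>z. \<phi> z - \<zeta>) holomorphic_on U" by (intro holomorphic_intros hol)
      fix z assume z: "z \<in> frontier U" "dist p z < s"
      have "z \<in> closure U" "z \<notin> U" using z(1) open_U by (auto simp: frontier_def interior_open)
      then have "z \<notin> {z. 1 < m z}" using exterior(2) by blast
      then have "m z = 1" using \<open>z \<notin> U\<close> by (simp add: U_def)
      then have pz: "cmod (psi z) = 1" by (rule psi_sphere)
      moreover have "psi z \<in> T" using z(2) s(2) by auto
      ultimately have Kz: "K (psi z) = \<zeta>" using const by blast
      have "(psi \<longlongrightarrow> psi z) (at z within U)"
        using isCont_psi[of z] unfolding isCont_def by (meson tendsto_within_subset subset_UNIV)
      moreover have "\<forall>\<^sub>F x in at z within U. psi x \<in> cball 0 1"
        using psi_ball_iff by (auto simp: eventually_at_filter less_imp_le)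
      ultimately have "((\<lambda>x. K (psi x)) \<longlongrightarrow> K (psi z)) (at z within U)"
        using K(1) pz by (intro continuous_on_tendsto_compose[OF K(1)]) auto
      moreover have "\<forall>\<^sub>F x in at z within U. K (psi x) = \<phi> x"
        using psi_ball_iff B_psi K(2) by (auto simp: eventually_at_filter)
      ultimately have "(\<phi> \<longlongrightarrow> \<zeta>) (at z within U)" using Kz by (simp add: tendsto_cong)
      then have "((\<lambda>z. \<phi> z - \<zeta>) \<longlongrightarrow> \<zeta> - \<zeta>) (at z within U)" by (intro tendsto_intros)
      then show "((\<lambda>z. \<phi> z - \<zeta>) \<longlongrightarrow> 0) (at z within U)" by simp
    qed
    then obtain q where "q \<in> U" "\<phi> q = \<zeta>" by auto
    then show False using f_phi[of q] z1 by simp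
  qed
  ultimately have "inj_on K (cball 0 1)"
    using K(3) by (intro injective_extension[OF K(1) injK _ imK]) auto
  moreover have "K ` cball 0 1 = cball 0 1"
  proof -
    have "cball 0 1 = ball 0 1 \<union> sphere (0::complex) 1" by auto
    then show ?thesis using imK K(3) by (metis image_Un)
  qed
  ultimately obtain L where "homeomorphism (cball 0 1) (cball 0 1) K L"
    using homeomorphism_compact[OF compact_cball K(1)] by blast
  then show ?thesis using that K by simp
qed

lemma uniformization:
  assumes K: "homeomorphism (cball 0 1) (cball 0 1) K L" "\<And>w. w \<in> ball 0 1 \<Longrightarrow> K w = \<phi> (B w)"
  shows "prime_end_uniformization U (K \<circ> disk_coordinate)"
  unfolding prime_end_uniformization_def
proof (intro conjI exI[of _ \<phi>] ballI)
  have "homeomorphic_maps (top_of_set (cball 0 1)) (top_of_set (cball 0 1)) K L"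
    using K(1) by (auto simp: homeomorphic_maps_def homeomorphism_def continuous_map_in_subtopology)
  then have "homeomorphic_map (top_of_set (cball 0 1)) (top_of_set (cball 0 1)) K"
    using homeomorphic_map_maps by blast
  then show "homeomorphic_map (caratheodory_compactification (to_sphere ` U)) (top_of_set (cball 0 1)) (K \<circ> disk_coordinate)"
    using homeomorphic_map_compose homeomorphic_map_disk_coordinate by blast
  show "\<phi> holomorphic_on U" by (rule hol)
  show "bij_betw \<phi> U (ball 0 1)"
    using homeomorphism_phi by (intro bij_betwI[of _ _ _ f]) (auto simp: homeomorphism_def)
  fix z assume z: "z \<in> U"
  then show "(K \<circ> disk_coordinate) (Inl (to_sphere z)) = \<phi> z"
    using K(2)[of "psi z"] psi_ball_iff[of z] B_psi[of z] by (simp add: disk_coordinate_Inl q_to_sphere)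
qed

end


section \<open>The dynamics in polar coordinates\<close>

text \<open>A pair \<open>(s, r)\<close> consists of the phase \<open>(1 + cos (n \<theta>)) / 2\<close> and the radius of a point with direction \<open>\<theta>\<close>. The
  radius is multiplied by \<open>growth k s r\<close>, which for large \<open>r\<close> ranges from about \<open>k / 2 < 1\<close> at \<open>s = 0\<close> to
  about \<open>k > 1\<close> at \<open>s = 1\<close>.\<close>

definition growth :: "real \<Rightarrow> real \<Rightarrow> real \<Rightarrow> real" where
  "growth k s r = k * (sqrt (1 + 3 * s) / 2) * (r\<^sup>2 / (1 + r\<^sup>2))"

definition step :: "real \<Rightarrow> real \<times> real \<Rightarrow> real \<times> real" where
  "step k = (\<lambda>(s, r). (s * ((3 + s) / (1 + 3 * s))\<^sup>2, growth k s r * r))"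

definition state_space :: "(real \<times> real) set" where
  "state_space = {0..1} \<times> {0..}"

lemma one_plus_sq_pos: "1 + r\<^sup>2 > (0::real)"
  using zero_le_power2[of r] by linarith

lemma fraction_mono: "0 \<le> r \<Longrightarrow> r \<le> r' \<Longrightarrow> r\<^sup>2 / (1 + r\<^sup>2) \<le> r'\<^sup>2 / (1 + r'\<^sup>2)" for r r' :: real
proof -
  assume r: "0 \<le> r" "r \<le> r'"
  have "x / (1 + x) = 1 - 1 / (1 + x)" if "1 + x > 0" for x :: real using that by (simp add: field_simps)
  moreover have "1 / (1 + r'\<^sup>2) \<le> 1 / (1 + r\<^sup>2)"
    using r one_plus_sq_pos by (intro divide_left_mono) (auto intro!: power_mono mult_pos_pos)
  ultimately show ?thesis using one_plus_sq_pos by simp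
qed

text \<open>The upper bound is equivalent to \<open>0 \<le> (1 - s) ^ 3\<close>.\<close>

lemma phase_step:
  assumes "0 \<le> s" "s \<le> (1::real)"
  shows "0 \<le> s * ((3 + s) / (1 + 3 * s))\<^sup>2" and "s * ((3 + s) / (1 + 3 * s))\<^sup>2 \<le> 1"
    and "s \<le> s * ((3 + s) / (1 + 3 * s))\<^sup>2"
proof -
  show "0 \<le> s * ((3 + s) / (1 + 3 * s))\<^sup>2" using assms by simp
  have "1 \<le> (3 + s) / (1 + 3 * s)" using assms by (simp add: pos_le_divide_eq)
  then have "1 \<le> ((3 + s) / (1 + 3 * s))\<^sup>2" by (simp add: one_le_power)
  then show "s \<le> s * ((3 + s) / (1 + 3 * s))\<^sup>2" using assms by (simp add: mult_le_cancel_left1)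
  have "0 \<le> (1 - s) ^ 3" using assms by simp
  then have "s * (3 + s)\<^sup>2 \<le> (1 + 3 * s)\<^sup>2" by (simp add: power2_eq_square power3_eq_cube algebra_simps)
  then show "s * ((3 + s) / (1 + 3 * s))\<^sup>2 \<le> 1"
    using assms by (simp add: power_divide divide_le_eq)
qed

context
  fixes k :: real
  assumes k: "1 < k" "k < 2"
begin

lemma growth_mono:
  assumes "0 \<le> s" "s \<le> s'" "0 \<le> r" "r \<le> r'"
  shows "growth k s r \<le> growth k s' r'"
  unfolding growth_def using assms k one_plus_sq_pos
  by (intro mult_mono fraction_mono) auto

lemma growth_nonneg: "0 \<le> s \<Longrightarrow> 0 \<le> growth k s r"
  unfolding growth_def using k one_plus_sq_pos[of r] by (intro mult_nonneg_nonneg) auto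

lemma growth_le: "0 \<le> s \<Longrightarrow> s \<le> 1 \<Longrightarrow> growth k s r \<le> k * r\<^sup>2"
proof -
  assume s: "0 \<le> s" "s \<le> 1"
  have "sqrt (1 + 3 * s) \<le> sqrt 4" using s by (intro real_sqrt_le_mono) simp
  then have "k * (sqrt (1 + 3 * s) / 2) \<le> k * 1" using k by (intro mult_left_mono) auto
  moreover have "r\<^sup>2 / (1 + r\<^sup>2) \<le> r\<^sup>2 / 1" by (intro divide_left_mono) (auto simp: one_plus_sq_pos)
  ultimately show ?thesis unfolding growth_def
    using mult_mono[of "k * (sqrt (1 + 3 * s) / 2)" "k * 1" "r\<^sup>2 / (1 + r\<^sup>2)" "r\<^sup>2 / 1"] k one_plus_sq_pos[of r]
    by simp
qed

lemma step_state_space: "p \<in> state_space \<Longrightarrow> step k p \<in> state_space"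
  using phase_step growth_nonneg by (auto simp: state_space_def step_def)

lemma iterate_state_space: "p \<in> state_space \<Longrightarrow> (step k ^^ j) p \<in> state_space"
  by (induction j) (auto simp: step_state_space)

lemma continuous_step: "continuous_on state_space (step k)"
proof -
  have "1 + 3 * fst p \<noteq> 0" if "p \<in> state_space" for p using that by (auto simp: state_space_def)
  moreover have "1 + (snd p)\<^sup>2 \<noteq> 0" for p :: "real \<times> real" using one_plus_sq_pos[of "snd p"] by simp
  ultimately show ?thesis unfolding step_def growth_def case_prod_beta
    by (intro continuous_intros) auto
qed

lemma continuous_iterate: "continuous_on state_space (step k ^^ j)"
proof (induction j)
  case (Suc j)
  have "continuous_on state_space (step k \<circ> (step k ^^ j))"
    using Suc iterate_state_space
    by (intro continuous_on_compose continuous_on_subset[OF continuous_step]) auto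
  then show ?case by simp
qed (simp add: id_def)

definition rad :: "nat \<Rightarrow> real \<times> real \<Rightarrow> real" where "rad j p = snd ((step k ^^ j) p)"
definition phase :: "nat \<Rightarrow> real \<times> real \<Rightarrow> real" where "phase j p = fst ((step k ^^ j) p)"

lemma rad_0 [simp]: "rad 0 (s, r) = r" and phase_0 [simp]: "phase 0 (s, r) = s"
  by (simp_all add: rad_def phase_def)

lemma rad_Suc: "rad (Suc j) p = growth k (phase j p) (rad j p) * rad j p"
  and phase_Suc: "phase (Suc j) p = phase j p * ((3 + phase j p) / (1 + 3 * phase j p))\<^sup>2"
  by (simp_all add: rad_def phase_def step_def case_prod_beta)

lemma rad_nonneg: "p \<in> state_space \<Longrightarrow> 0 \<le> rad j p"
  and phase_bounds: "p \<in> state_space \<Longrightarrow> 0 \<le> phase j p" "p \<in> state_space \<Longrightarrow> phase j p \<le> 1"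
  using iterate_state_space[of p j] by (auto simp: rad_def phase_def state_space_def)

lemma phase_mono: "p \<in> state_space \<Longrightarrow> phase j p \<le> phase (Suc j) p"
  using phase_step(3) phase_bounds by (simp add: phase_Suc)

lemma phase_eq: "phase j (s, r) = phase j (s, r')"
  by (induction j) (auto simp: phase_Suc)

lemma continuous_rad: "continuous_on state_space (rad j)"
  unfolding rad_def by (intro continuous_intros continuous_iterate)

lemma rad_mono:
  assumes "0 \<le> s" "s \<le> 1" "0 \<le> r" "r \<le> r'"
  shows "rad j (s, r) \<le> rad j (s, r')"
proof (induction j)
  case (Suc j)
  have st: "(s, r) \<in> state_space" "(s, r') \<in> state_space" using assms by (auto simp: state_space_def)
  have "growth k (phase j (s, r)) (rad j (s, r)) \<le> growth k (phase j (s, r')) (rad j (s, r'))"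
    using Suc st rad_nonneg phase_bounds phase_eq[of j s r r'] by (intro growth_mono) auto
  then show ?case unfolding rad_Suc using Suc st rad_nonneg growth_nonneg phase_bounds
    by (intro mult_mono) auto
qed (use assms in simp)

text \<open>Both conditions can be detected at a finite time, by a small radius or by an increase of the radius.
  Hence both are open.\<close>

definition attracted :: "real \<times> real \<Rightarrow> bool" where "attracted p \<longleftrightarrow> (\<lambda>j. rad j p) \<longlonglongrightarrow> 0"
definition escapes :: "real \<times> real \<Rightarrow> bool" where "escapes p \<longleftrightarrow> (\<exists>j. rad (Suc j) p > rad j p)"

lemma attracted_iff:
  assumes p: "p \<in> state_space"
  shows "attracted p \<longleftrightarrow> (\<exists>j. k * (rad j p)\<^sup>2 < 1 / 2)"
proof
  assume "attracted p"
  then have "(\<lambda>j. k * (rad j p)\<^sup>2) \<longlonglongrightarrow> k * 0\<^sup>2" unfolding attracted_def by (intro tendsto_intros)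
  then have "\<forall>\<^sub>F j in sequentially. k * (rad j p)\<^sup>2 < 1 / 2" by (intro order_tendstoD(2)) auto
  then show "\<exists>j. k * (rad j p)\<^sup>2 < 1 / 2" using eventually_happens'[OF sequentially_bot] by blast
next
  assume "\<exists>j. k * (rad j p)\<^sup>2 < 1 / 2"
  then obtain j where j: "k * (rad j p)\<^sup>2 < 1 / 2" by blast
  have "rad (j + i) p \<le> rad j p * (1 / 2) ^ i \<and> rad (j + i) p \<le> rad j p" for i
  proof (induction i)
    case (Suc i)
    have nn: "0 \<le> rad (j + i) p" using rad_nonneg p by blast
    have "k * (rad (j + i) p)\<^sup>2 \<le> k * (rad j p)\<^sup>2"
      using Suc k nn by (intro mult_left_mono power_mono) auto
    moreover have "growth k (phase (j + i) p) (rad (j + i) p) \<le> k * (rad (j + i) p)\<^sup>2"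
      by (intro growth_le phase_bounds p)
    ultimately have "growth k (phase (j + i) p) (rad (j + i) p) \<le> 1 / 2" using j by linarith
    then have "rad (Suc (j + i)) p \<le> 1 / 2 * rad (j + i) p"
      unfolding rad_Suc using nn by (rule mult_right_mono)
    then show ?case using Suc nn by auto
  qed simp
  then have le: "rad (i + j) p \<le> rad j p * (1 / 2) ^ i" for i by (simp add: add.commute)
  have "(\<lambda>i. rad j p * (1 / 2) ^ i) \<longlonglongrightarrow> rad j p * 0" by (intro tendsto_intros LIMSEQ_realpow_zero) auto
  then have "(\<lambda>i. rad (i + j) p) \<longlonglongrightarrow> 0"
    using tendsto_sandwich[of "\<lambda>_. 0" "\<lambda>i. rad (i + j) p" sequentially "\<lambda>i. rad j p * (1 / 2) ^ i" 0]
      le rad_nonneg[OF p] by simp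
  then show "attracted p" unfolding attracted_def by (rule LIMSEQ_offset)
qed

lemma open_attracted: "openin (top_of_set state_space) {p \<in> state_space. attracted p}"
proof -
  have "openin (top_of_set state_space) (state_space \<inter> (\<lambda>p. k * (rad j p)\<^sup>2) -` {..<1/2})" for j
    by (intro continuous_openin_preimage_gen continuous_intros continuous_rad)
  then have "openin (top_of_set state_space) (\<Union>j. state_space \<inter> (\<lambda>p. k * (rad j p)\<^sup>2) -` {..<1/2})" by blast
  moreover have "{p \<in> state_space. attracted p} = (\<Union>j. state_space \<inter> (\<lambda>p. k * (rad j p)\<^sup>2) -` {..<1/2})"
    using attracted_iff by auto
  ultimately show ?thesis by simp
qed

lemma open_escapes: "openin (top_of_set state_space) {p \<in> state_space. escapes p}"
proof -
  have "openin (top_of_set state_space) (state_space \<inter> (\<lambda>p. rad (Suc j) p - rad j p) -` {0<..})" for j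
    by (intro continuous_openin_preimage_gen continuous_intros continuous_rad)
  then have "openin (top_of_set state_space) (\<Union>j. state_space \<inter> (\<lambda>p. rad (Suc j) p - rad j p) -` {0<..})" by blast
  moreover have "{p \<in> state_space. escapes p} = (\<Union>j. state_space \<inter> (\<lambda>p. rad (Suc j) p - rad j p) -` {0<..})"
    by (auto simp: escapes_def)
  ultimately show ?thesis by simp
qed

text \<open>Neither the phase nor the radius has decreased, and \<open>growth\<close> is monotone in both.\<close>

lemma growing:
  assumes p: "p \<in> state_space" and j: "rad (Suc j) p > rad j p"
  shows "rad (Suc (j + i)) p > rad (j + i) p"
proof (induction i)
  case (Suc i)
  let ?j = "j + i"
  have nn: "0 \<le> rad ?j p" "0 \<le> rad (Suc ?j) p" using rad_nonneg p by auto
  then have "rad ?j p > 0" using Suc by (cases "rad ?j p = 0") (auto simp: rad_Suc)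
  then have "1 < growth k (phase ?j p) (rad ?j p)" using Suc by (simp add: rad_Suc)
  also have "\<dots> \<le> growth k (phase (Suc ?j) p) (rad (Suc ?j) p)"
    using Suc nn phase_mono[OF p] phase_bounds[OF p] by (intro growth_mono) auto
  finally show ?case using \<open>rad ?j p > 0\<close> Suc by (simp add: rad_Suc[of "Suc ?j"])
qed (use j in simp)

lemma escapes_not_attracted:
  assumes p: "p \<in> state_space" and "escapes p"
  shows "\<not> attracted p"
proof
  assume "attracted p"
  obtain j where j: "rad (Suc j) p > rad j p" using assms by (auto simp: escapes_def)
  have mono: "incseq (\<lambda>i. rad (j + i) p)" using growing[OF p j] by (auto intro!: incseq_SucI less_imp_le)
  have "(\<lambda>i. rad (i + j) p) \<longlonglongrightarrow> 0" using \<open>attracted p\<close> unfolding attracted_def by (rule LIMSEQ_ignore_initial_segment)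
  then have "(\<lambda>i. rad (j + i) p) \<longlonglongrightarrow> 0" by (simp add: add.commute)
  then have "rad (j + Suc 0) p \<le> 0" using incseq_le[OF mono] by blast
  moreover have "rad j p \<ge> 0" using rad_nonneg p by blast
  ultimately show False using j by simp
qed

lemma escapes_mono:
  assumes "0 \<le> s" "s \<le> 1" "0 \<le> r" "r \<le> r'" "escapes (s, r)"
  shows "escapes (s, r')"
proof -
  have st: "(s, r) \<in> state_space" "(s, r') \<in> state_space" using assms by (auto simp: state_space_def)
  obtain j where j: "rad (Suc j) (s, r) > rad j (s, r)" using assms by (auto simp: escapes_def)
  then have pos: "rad j (s, r) > 0" using rad_nonneg[OF st(1), of j] by (cases "rad j (s, r) = 0") (auto simp: rad_Suc)
  then have "1 < growth k (phase j (s, r)) (rad j (s, r))" using j by (simp add: rad_Suc)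
  also have "\<dots> \<le> growth k (phase j (s, r')) (rad j (s, r'))"
    using rad_mono[OF assms(1-4)] st rad_nonneg phase_bounds phase_eq[of j s r r'] by (intro growth_mono) auto
  finally have "rad (Suc j) (s, r') > rad j (s, r')"
    using pos rad_mono[OF assms(1-4), of j] by (simp add: rad_Suc)
  then show ?thesis by (auto simp: escapes_def)
qed

lemma attracted_mono:
  assumes "0 \<le> s" "s \<le> 1" "0 \<le> r" "r \<le> r'" "attracted (s, r')"
  shows "attracted (s, r)"
proof -
  have st: "(s, r) \<in> state_space" using assms by (auto simp: state_space_def)
  show ?thesis unfolding attracted_def
    by (rule tendsto_sandwich[OF _ _ tendsto_const assms(5)[unfolded attracted_def]])
      (use rad_nonneg[OF st] rad_mono[OF assms(1-4)] in auto)
qed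

lemma phase_limit:
  assumes "0 < s" "s \<le> 1" "0 \<le> r"
  shows "(\<lambda>j. phase j (s, r)) \<longlonglongrightarrow> 1"
proof -
  have st: "(s, r) \<in> state_space" using assms by (auto simp: state_space_def)
  have inc: "incseq (\<lambda>j. phase j (s, r))" using phase_mono[OF st] by (rule incseq_SucI)
  obtain L where L: "(\<lambda>j. phase j (s, r)) \<longlonglongrightarrow> L" "\<And>j. phase j (s, r) \<le> L"
    using incseq_convergent[OF inc, of 1] phase_bounds[OF st] by blast
  have L0: "L > 0" using L(2)[of 0] assms(1) by simp
  have "(\<lambda>j. phase (Suc j) (s, r)) \<longlonglongrightarrow> L * ((3 + L) / (1 + 3 * L))\<^sup>2"
    unfolding phase_Suc using L0 by (intro tendsto_intros L(1)) auto
  moreover have "(\<lambda>j. phase (Suc j) (s, r)) \<longlonglongrightarrow> L" using L(1) by (rule LIMSEQ_Suc)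
  ultimately have "L * ((3 + L) / (1 + 3 * L))\<^sup>2 = L" using LIMSEQ_unique by blast
  then have "((3 + L) / (1 + 3 * L))\<^sup>2 = 1" using L0 by simp
  then have "(3 + L) / (1 + 3 * L) = 1" using L0 by (simp add: power2_eq_1_iff)
     (smt (verit) divide_nonneg_pos)
  then have "L = 1" using L0 by simp
  then show ?thesis using L(1) by simp
qed

text \<open>On a ray the ratio of two orbits does not decrease, so at most one orbit tends to the
  repelling fixed radius.\<close>

lemma threshold_unique:
  assumes s: "0 < s" "s \<le> 1" and r: "0 < r" "r < r'"
    and n1: "\<not> attracted (s, r)" and n2: "\<not> escapes (s, r')"
  shows False
proof -
  have st: "(s, r) \<in> state_space" "(s, r') \<in> state_space" using s r by (auto simp: state_space_def)
  have ne1: "\<not> escapes (s, r)" using escapes_mono[of s r r'] n2 s r by auto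
  have na2: "\<not> attracted (s, r')" using attracted_mono[of s r r'] n1 s r by auto
  have lim: "\<exists>L>0. (\<lambda>j. rad j (s, u)) \<longlonglongrightarrow> L \<and> L\<^sup>2 * (k - 1) = 1"
    if u: "0 < u" "\<not> escapes (s, u)" "\<not> attracted (s, u)" for u
  proof -
    have su: "(s, u) \<in> state_space" using s u by (auto simp: state_space_def)
    have "decseq (\<lambda>j. rad j (s, u))" using u(2) by (intro decseq_SucI) (auto simp: escapes_def not_less)
    then obtain L where L: "(\<lambda>j. rad j (s, u)) \<longlonglongrightarrow> L" "\<And>j. L \<le> rad j (s, u)"
      using decseq_convergent[of "\<lambda>j. rad j (s, u)" 0] rad_nonneg[OF su] by blast
    have "L \<ge> 0" using L(1) rad_nonneg[OF su] by (intro LIMSEQ_le_const) auto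
    moreover have "L \<noteq> 0" using u(3) L(1) by (auto simp: attracted_def)
    ultimately have L0: "L > 0" by simp
    have "(\<lambda>j. rad (Suc j) (s, u)) \<longlonglongrightarrow> k * (sqrt (1 + 3 * 1) / 2) * (L\<^sup>2 / (1 + L\<^sup>2)) * L"
      unfolding rad_Suc growth_def using one_plus_sq_pos[of L] s u
      by (intro tendsto_intros L(1) phase_limit) auto
    moreover have "(\<lambda>j. rad (Suc j) (s, u)) \<longlonglongrightarrow> L" using L(1) by (rule LIMSEQ_Suc)
    ultimately have "k * (sqrt (1 + 3 * 1) / 2) * (L\<^sup>2 / (1 + L\<^sup>2)) * L = L" using LIMSEQ_unique by blast
    then have "k * (L\<^sup>2 / (1 + L\<^sup>2)) * L = 1 * L" by simp
    then have "k * (L\<^sup>2 / (1 + L\<^sup>2)) = 1" using L0 by (simp only: mult_right_cancel)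
    then have "k * L\<^sup>2 = 1 + L\<^sup>2" using one_plus_sq_pos[of L] by (simp add: field_simps)
    then have "L\<^sup>2 * (k - 1) = 1" by (simp add: algebra_simps)
    then show ?thesis using L0 L(1) by blast
  qed
  obtain L where L: "L > 0" "(\<lambda>j. rad j (s, r)) \<longlonglongrightarrow> L" "L\<^sup>2 * (k - 1) = 1"
    using lim[OF r(1) ne1 n1] by blast
  obtain L' where L': "L' > 0" "(\<lambda>j. rad j (s, r')) \<longlonglongrightarrow> L'" "L'\<^sup>2 * (k - 1) = 1"
    using lim[OF _ n2 na2] r by auto
  have "L\<^sup>2 = L'\<^sup>2" using L(3) L'(3) k by (metis diff_gt_0_iff_gt less_irrefl mult_right_cancel)
  then have "L = L'" using L(1) L'(1) by (simp add: power2_eq_iff)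
  have "rad j (s, r) * (r' / r) \<le> rad j (s, r')" for j
  proof (induction j)
    case (Suc j)
    have "growth k (phase j (s, r)) (rad j (s, r)) \<le> growth k (phase j (s, r')) (rad j (s, r'))"
      using rad_mono[of s r r'] s r st rad_nonneg phase_bounds phase_eq[of j s r r'] by (intro growth_mono) auto
    then have "growth k (phase j (s, r)) (rad j (s, r)) * (rad j (s, r) * (r' / r))
        \<le> growth k (phase j (s, r')) (rad j (s, r')) * rad j (s, r')"
      using Suc st r rad_nonneg growth_nonneg phase_bounds by (intro mult_mono) auto
    then show ?case by (simp add: rad_Suc mult.assoc)
  qed (use r in simp)
  then have "L * (r' / r) \<le> L'"
    using L(2) L'(2) by (intro LIMSEQ_le[of "\<lambda>j. rad j (s, r) * (r' / r)" _ "\<lambda>j. rad j (s, r')"] tendsto_intros) auto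
  then have "L * (r' / r) \<le> L * 1" using \<open>L = L'\<close> by simp
  then have "r' / r \<le> 1" using L(1) by (rule mult_left_le_imp_le)
  then show False using r by simp
qed

text \<open>At phase \<open>0\<close> the radius shrinks by a factor of at most \<open>k / 2\<close> in each step.\<close>

lemma attracted_diagonal: "0 \<le> r \<Longrightarrow> attracted (0, r)"
proof -
  assume r: "0 \<le> r"
  then have st: "(0, r) \<in> state_space" by (simp add: state_space_def)
  have ph: "phase j (0, r) = 0" for j by (induction j) (auto simp: phase_Suc)
  have "rad j (0, r) \<le> r * (k / 2) ^ j" for j
  proof (induction j)
    case (Suc j)
    have "growth k 0 (rad j (0, r)) \<le> k / 2 * 1"
      unfolding growth_def using k one_plus_sq_pos[of "rad j (0, r)"]
      by (intro mult_mono) (auto simp: divide_le_eq)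
    then have "rad (Suc j) (0, r) \<le> k / 2 * (r * (k / 2) ^ j)"
      unfolding rad_Suc ph using Suc k rad_nonneg[OF st] by (intro mult_mono) auto
    then show ?case by (simp add: algebra_simps)
  qed simp
  moreover have "(\<lambda>j. r * (k / 2) ^ j) \<longlonglongrightarrow> r * 0" using k by (intro tendsto_intros LIMSEQ_realpow_zero) auto
  ultimately show ?thesis unfolding attracted_def
    using tendsto_sandwich[of "\<lambda>_. 0" "\<lambda>j. rad j (0, r)" sequentially "\<lambda>j. r * (k / 2) ^ j" 0]
      rad_nonneg[OF st] by simp
qed

lemma growth_ge: "0 \<le> s \<Longrightarrow> 1 \<le> r \<Longrightarrow> growth k s r \<ge> k / 4"
proof -
  assume s: "0 \<le> s" "1 \<le> r"
  have "1 / 2 \<le> sqrt (1 + 3 * s) / 2" using s by simp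
  moreover have "1 / 2 \<le> r\<^sup>2 / (1 + r\<^sup>2)"
    using s(2) one_le_power[of r 2] one_plus_sq_pos[of r] by (simp add: pos_le_divide_eq)
  ultimately have "k * (1 / 2) * (1 / 2) \<le> growth k s r"
    unfolding growth_def using k by (intro mult_mono) auto
  then show ?thesis by simp
qed

lemma rad_large:
  assumes "0 \<le> s" "s \<le> 1" "1 \<le> L" "(4 / k) ^ j * L \<le> r"
  shows "L \<le> rad j (s, r)"
  using assms(3,4)
proof (induction j arbitrary: L)
  case (Suc j)
  have k4: "1 \<le> 4 / k" using k by simp
  have L': "1 \<le> 4 / k * L" using mult_mono[OF k4 Suc.prems(1)] k by simp
  moreover have "(4 / k) ^ j * (4 / k * L) \<le> r" using Suc.prems(2) by (simp add: mult_ac)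
  ultimately have IH: "4 / k * L \<le> rad j (s, r)" using Suc.IH by blast
  have "r \<ge> 0"
  proof -
    have "0 \<le> (4 / k) ^ Suc j * L" using k Suc.prems(1) by (intro mult_nonneg_nonneg) auto
    then show ?thesis using Suc.prems(2) by linarith
  qed
  then have st: "(s, r) \<in> state_space" using assms by (simp add: state_space_def)
  have rad1: "1 \<le> rad j (s, r)" using IH L' by linarith
  have "k / 4 * (4 / k * L) \<le> rad (Suc j) (s, r)"
    unfolding rad_Suc using IH rad1 k Suc.prems(1) phase_bounds[OF st] growth_nonneg
    by (intro mult_mono growth_ge) auto
  then show ?case using k by simp
qed (use assms in simp)

text \<open>After finitely many steps the phase is so close to \<open>1\<close> that large radii grow, and
  sufficiently large initial radii are still large at that time.\<close>

lemma some_escapes: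
  assumes s: "0 < s" "s \<le> 1"
  shows "\<exists>r>0. escapes (s, r)"
proof -
  have "(\<lambda>j. k * (sqrt (1 + 3 * phase j (s, 0)) / 2)) \<longlonglongrightarrow> k * (sqrt (1 + 3 * 1) / 2)"
    using s by (intro tendsto_intros phase_limit) auto
  then have "\<forall>\<^sub>F j in sequentially. k * (sqrt (1 + 3 * phase j (s, 0)) / 2) > 1"
    using k by (intro order_tendstoD(1)) auto
  then obtain j where j: "k * (sqrt (1 + 3 * phase j (s, 0)) / 2) > 1"
    using eventually_happens'[OF sequentially_bot] by blast
  define c where "c = k * (sqrt (1 + 3 * phase j (s, 0)) / 2)"
  \<comment> \<open>The inequality \<open>c L\<^sup>2 / (1 + L\<^sup>2) > 1\<close> follows from \<open>L (c - 1) > 1\<close> and \<open>L \<ge> 1\<close>.\<close>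
  define L where "L = 1 + 1 / (c - 1)"
  have c: "c > 1" using j by (simp add: c_def)
  have L: "1 \<le> L" using c by (simp add: L_def)
  define r where "r = (4 / k) ^ j * L"
  have r: "r > 0" using k L by (simp add: r_def)
  have rl: "L \<le> rad j (s, r)" using rad_large[of s L j r] s L by (simp add: r_def)
  have "L * (c - 1) > 1" using c by (simp add: L_def distrib_right)
  moreover have "L\<^sup>2 \<ge> L" using L by (simp add: power2_eq_square mult_le_cancel_left1)
  ultimately have "L\<^sup>2 * (c - 1) > 1" using c by (smt (verit) mult_right_mono)
  moreover have "(rad j (s, r))\<^sup>2 \<ge> L\<^sup>2" using rl L by (intro power_mono) auto
  ultimately have "(rad j (s, r))\<^sup>2 * (c - 1) > 1" using c by (smt (verit) mult_right_mono)
  then have "c * (rad j (s, r))\<^sup>2 > 1 + (rad j (s, r))\<^sup>2" by (simp add: algebra_simps)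
  then have "growth k (phase j (s, r)) (rad j (s, r)) > 1"
    unfolding growth_def phase_eq[of j s r 0] c_def[symmetric]
    using one_plus_sq_pos[of "rad j (s, r)"] by (simp add: pos_less_divide_eq)
  then have "rad (Suc j) (s, r) > rad j (s, r)" using rl L by (simp add: rad_Suc)
  then show ?thesis using r by (auto simp: escapes_def)
qed

text \<open>The value \<open>0\<close> at \<open>s = 0\<close> corresponds to an infinite threshold.\<close>

definition \<mu> :: "real \<Rightarrow> real" where
  "\<mu> s = (if s = 0 then 0 else 1 / Sup {r. 0 \<le> r \<and> attracted (s, r)})"

lemma threshold:
  assumes s: "0 < s" "s \<le> 1"
  shows "\<mu> s > 0" and "\<And>r. 0 \<le> r \<Longrightarrow> attracted (s, r) \<longleftrightarrow> r * \<mu> s < 1"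
    and "\<And>r. 0 \<le> r \<Longrightarrow> escapes (s, r) \<longleftrightarrow> r * \<mu> s > 1"
proof -
  define A where "A = {r. 0 \<le> r \<and> attracted (s, r)}"
  define \<rho> where "\<rho> = Sup A"
  obtain r1 where r1: "r1 > 0" "escapes (s, r1)" using some_escapes[OF s] by blast
  have st: "(s, r) \<in> state_space" if "0 \<le> r" for r using s that by (auto simp: state_space_def)
  have A1: "r < r1" if "r \<in> A" for r
  proof (rule ccontr)
    assume "\<not> r < r1"
    then have "escapes (s, r)" using escapes_mono[of s r1 r] r1 s by auto
    then show False using escapes_not_attracted[OF st] that by (auto simp: A_def)
  qed
  have bdd: "bdd_above A" using A1 by (meson bdd_aboveI less_imp_le)
  have "continuous_on {0..} (\<lambda>r. (s, r))" by (intro continuous_intros)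
  moreover have "(\<lambda>r. (s, r)) \<in> {0..} \<rightarrow> state_space" using st by auto
  ultimately have opA: "openin (top_of_set {0..}) ({0..} \<inter> (\<lambda>r. (s, r)) -` {p \<in> state_space. attracted p})"
    and opE: "openin (top_of_set {0..}) ({0..} \<inter> (\<lambda>r. (s, r)) -` {p \<in> state_space. escapes p})"
    using open_attracted open_escapes by (blast intro: continuous_openin_preimage)+
  have eqA: "{0..} \<inter> (\<lambda>r. (s, r)) -` {p \<in> state_space. attracted p} = A"
    using st by (auto simp: A_def)
  have "0 \<in> A"
  proof -
    have "rad j (s, 0) = 0" for j by (induction j) (auto simp: rad_Suc)
    then show ?thesis by (simp add: A_def attracted_def)
  qed
  have up: "\<exists>r'>r. r' \<in> A" if r: "r \<in> A" for r
  proof -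
    obtain e where e: "e > 0" "\<And>x. x \<in> {0..} \<Longrightarrow> dist x r < e \<Longrightarrow> x \<in> A"
      using opA[unfolded eqA] r unfolding openin_euclidean_subtopology_iff by blast
    have "r + e / 2 \<in> A" using r e(1) by (intro e(2)) (auto simp: A_def dist_real_def)
    then show ?thesis using e(1) by (intro exI[of _ "r + e/2"]) auto
  qed
  have lt: "r < \<rho>" if r: "r \<in> A" for r
    using up[OF r] cSup_upper[OF _ bdd] unfolding \<rho>_def by (meson less_le_trans)
  have \<rho>0: "\<rho> > 0" using lt[OF \<open>0 \<in> A\<close>] .
  have inA: "r \<in> A" if r: "0 \<le> r" "r < \<rho>" for r
  proof -
    obtain r' where "r' \<in> A" "r < r'" using less_cSupD[of A r] r \<open>0 \<in> A\<close> unfolding \<rho>_def by blast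
    then show ?thesis using attracted_mono[of s r r'] s r by (auto simp: A_def)
  qed
  have \<rho>nE: "\<not> escapes (s, \<rho>)"
  proof
    assume E: "escapes (s, \<rho>)"
    have "\<rho> \<in> {0..} \<inter> (\<lambda>r. (s, r)) -` {p \<in> state_space. escapes p}" using E st \<rho>0 by auto
    then obtain e where e: "e > 0" "\<And>x. x \<in> {0..} \<Longrightarrow> dist x \<rho> < e \<Longrightarrow> escapes (s, x)"
      using opE unfolding openin_euclidean_subtopology_iff by blast
    define x where "x = max 0 (\<rho> - e / 2)"
    have x: "0 \<le> x" "x < \<rho>" "dist x \<rho> < e" using e(1) \<rho>0 by (auto simp: x_def dist_real_def)
    then have "escapes (s, x)" using e(2) by simp
    then show False using inA[OF x(1,2)] escapes_not_attracted[OF st[OF x(1)]] by (simp add: A_def)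
  qed
  have esc: "escapes (s, r)" if r: "\<rho> < r" for r
  proof (rule ccontr)
    assume n: "\<not> escapes (s, r)"
    have "\<not> attracted (s, \<rho>)" using lt[of \<rho>] \<rho>0 by (auto simp: A_def)
    then show False using threshold_unique[OF s \<rho>0 r _ n] by blast
  qed
  have mu: "\<mu> s = 1 / \<rho>" using s by (simp add: \<mu>_def \<rho>_def A_def)
  show "\<mu> s > 0" using \<rho>0 by (simp add: mu)
  show "attracted (s, r) \<longleftrightarrow> r * \<mu> s < 1" if "0 \<le> r" for r
    using lt[of r] inA[of r] that \<rho>0 by (auto simp: mu A_def)
  show "escapes (s, r) \<longleftrightarrow> r * \<mu> s > 1" if "0 \<le> r" for r
  proof -
    have "escapes (s, r) \<longleftrightarrow> \<rho> < r"
      using esc[of r] \<rho>nE escapes_mono[of s r \<rho>] s that by (cases "\<rho> < r") auto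
    then show ?thesis using \<rho>0 by (simp add: mu)
  qed
qed

lemma attracted_iff_\<mu>:
  assumes "0 \<le> s" "s \<le> 1" "0 \<le> r"
  shows "attracted (s, r) \<longleftrightarrow> r * \<mu> s < 1"
  using threshold(2)[of s r] attracted_diagonal[of r] assms by (cases "s = 0") (auto simp: \<mu>_def)

lemma \<mu>_nonneg: "0 \<le> s \<Longrightarrow> s \<le> 1 \<Longrightarrow> \<mu> s \<ge> 0"
  using threshold(1)[of s] by (cases "s = 0") (auto simp: \<mu>_def less_le)

text \<open>Openness of attraction bounds \<open>\<mu>\<close> from above near \<open>s\<close>, and openness of escape from below.\<close>

lemma continuous_\<mu>: "continuous_on {0..1} \<mu>"
  unfolding continuous_on_def
proof
  fix s :: real assume s: "s \<in> {0..1}"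
  have sec: "\<forall>\<^sub>F t in at s within {0..1}. (t, r) \<in> S"
    if S: "openin (top_of_set state_space) S" and sr: "(s, r) \<in> S" and r: "0 \<le> r" for S r
  proof -
    have "continuous_on {0..1} (\<lambda>t. (t, r))" by (intro continuous_intros)
    moreover have "(\<lambda>t. (t, r)) \<in> {0..1} \<rightarrow> state_space" using r by (auto simp: state_space_def)
    ultimately have "openin (top_of_set {0..1}) ({0..1} \<inter> (\<lambda>t. (t, r)) -` S)"
      using S by (rule continuous_openin_preimage)
    then obtain e where e: "e > 0" "\<And>t. t \<in> {0..1} \<Longrightarrow> dist t s < e \<Longrightarrow> (t, r) \<in> S"
      using s sr unfolding openin_euclidean_subtopology_iff by blast
    then show ?thesis unfolding eventually_at by blast
  qed
  have in01: "\<forall>\<^sub>F t in at s within {0..1}. t \<in> {0..1}" by (simp add: eventually_at_filter)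
  show "(\<mu> \<longlongrightarrow> \<mu> s) (at s within {0..1})"
  proof (rule order_tendstoI)
    fix a assume a: "\<mu> s < a"
    then have a0: "a > 0" using \<mu>_nonneg[of s] s by auto
    have "attracted (s, 1 / a)" using attracted_iff_\<mu>[of s "1 / a"] a a0 s by simp
    then have "\<forall>\<^sub>F t in at s within {0..1}. (t, 1 / a) \<in> {p \<in> state_space. attracted p}"
      using s a0 by (intro sec[OF open_attracted]) (auto simp: state_space_def)
    then show "\<forall>\<^sub>F t in at s within {0..1}. \<mu> t < a"
      using in01 by eventually_elim (use attracted_iff_\<mu> a0 in \<open>auto simp: divide_less_eq\<close>)
  next
    fix a assume a: "a < \<mu> s"
    show "\<forall>\<^sub>F t in at s within {0..1}. a < \<mu> t"
    proof (cases "a < 0")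
      case True
      show ?thesis using in01 by eventually_elim (use \<mu>_nonneg True in force)
    next
      case False
      then have "\<mu> s > 0" using a by simp
      then have s0: "s > 0" using s by (cases "s = 0") (auto simp: \<mu>_def)
      define b where "b = (a + \<mu> s) / 2"
      have b: "a < b" "b < \<mu> s" "b > 0" using a False by (auto simp: b_def)
      have "escapes (s, 1 / b)" using threshold(3)[of s "1 / b"] s s0 b by simp
      then have "\<forall>\<^sub>F t in at s within {0..1}. (t, 1 / b) \<in> {p \<in> state_space. escapes p}"
        using s b by (intro sec[OF open_escapes]) (auto simp: state_space_def)
      then show ?thesis using in01
      proof eventually_elim
        case (elim t)
        then have "\<not> attracted (t, 1 / b)" using escapes_not_attracted by auto
        then have "b \<le> \<mu> t" using attracted_iff_\<mu>[of t "1 / b"] elim b by (simp add: not_less le_divide_eq)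
        then show ?case using b(1) by simp
      qed
    qed
  qed
qed

end


section \<open>The maps in polar coordinates\<close>

text \<open>On the first sector, conjugated to a quadrant, the direction map is \<open>x \<mapsto> arctan (tan x ^ 3) + \<pi> / 2\<close>. The
  expression \<open>x - arctan (sin (4 x) / (3 + cos (4 x)))\<close> for the arctangent is smooth on the whole line and
  commutes with the translation by \<open>\<pi> / 2\<close>, so that one formula serves all sectors.\<close>

definition angle :: "nat \<Rightarrow> real \<Rightarrow> real" where
  "angle n \<theta> = \<theta> + 2 * pi / real n - 4 / real n * arctan (sin (real n * \<theta>) / (3 + cos (real n * \<theta>)))"

definition phase_of :: "nat \<Rightarrow> real \<Rightarrow> real" where
  "phase_of n \<theta> = (1 + cos (real n * \<theta>)) / 2"

lemma three_plus_cos_pos: "3 + cos x > (0::real)" "5 + 3 * cos x > (0::real)"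
  using cos_ge_minus_one[of x] by linarith+

lemma twist_norm: "1 + (sin x / (3 + cos x))\<^sup>2 = (10 + 6 * cos x) / (3 + cos x)\<^sup>2" for x :: real
proof -
  have "1 + (sin x / (3 + cos x))\<^sup>2 = ((3 + cos x)\<^sup>2 + (sin x)\<^sup>2) / (3 + cos x)\<^sup>2"
    using three_plus_cos_pos(1)[of x] by (simp add: power_divide add_divide_distrib)
  also have "(3 + cos x)\<^sup>2 + (sin x)\<^sup>2 = 10 + 6 * cos x"
    unfolding sin_squared_eq by (simp add: power2_eq_square algebra_simps)
  finally show ?thesis .
qed

lemma polar_Arg2pi: "rcis (cmod z) (Arg2pi z) = z"
  using Arg2pi_eq[of z] by (simp add: rcis_def cis_conv_exp)

text \<open>This gives modulus and argument of \<open>3 + cis (- x)\<close>.\<close>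

lemma cis_twist:
  "of_real (sqrt ((5 + 3 * cos x) / 8)) * cis (- arctan (sin x / (3 + cos x))) = (3 + cis (- x)) / 4"
proof -
  define D where "D = 10 + 6 * cos x"
  have D: "D > 0" using three_plus_cos_pos(2)[of x] by (simp add: D_def)
  have sq: "sqrt (1 + (sin x / (3 + cos x))\<^sup>2) = sqrt D / (3 + cos x)"
    unfolding twist_norm D_def using three_plus_cos_pos(1)[of x] by (simp add: real_sqrt_divide)
  have c: "cos (arctan (sin x / (3 + cos x))) = (3 + cos x) / sqrt D"
    by (simp add: cos_arctan sq)
  have s: "sin (arctan (sin x / (3 + cos x))) = sin x / sqrt D"
    using three_plus_cos_pos(1)[of x] by (simp add: sin_arctan sq)
  have "sqrt ((5 + 3 * cos x) / 8) = sqrt (D / 16)" by (simp add: D_def)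
  also have "\<dots> = sqrt D / 4" by (simp add: real_sqrt_divide)
  finally have e: "sqrt ((5 + 3 * cos x) / 8) = sqrt D / 4" .
  show ?thesis unfolding e using D by (simp add: complex_eq_iff c s)
qed

text \<open>The triple angle formulas in complex form.\<close>

lemma cis_cube: "Complex (cos x ^ 3) (sin x ^ 3) = cis x * ((3 + cis (- (4 * x))) / 4)"
proof -
  have "cis x * cis (- (4 * x)) = cis (- (3 * x))" by (simp add: cis_mult)
  then have "cis x * ((3 + cis (- (4 * x))) / 4) = (3 * cis x + cis (- (3 * x))) / 4"
    by (simp add: distrib_left)
  moreover have "cos (3 * x) = 4 * cos x ^ 3 - 3 * cos x" by (rule cos_treble_cos)
  moreover have "sin (3 * x) = 3 * sin x - 4 * sin x ^ 3"
  proof -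
    have "sin (3 * x) = sin (2 * x + x)" by simp
    also have "\<dots> = 2 * sin x * (cos x)\<^sup>2 + (1 - 2 * (sin x)\<^sup>2) * sin x"
      unfolding sin_add sin_double cos_double_sin by (simp add: power2_eq_square)
    also have "(cos x)\<^sup>2 = 1 - (sin x)\<^sup>2" by (rule cos_squared_eq)
    finally show ?thesis by (simp add: power2_eq_square power3_eq_cube algebra_simps)
  qed
  ultimately show ?thesis by (simp add: complex_eq_iff)
qed

lemma growth_phase:
  "growth k ((1 + cos x) / 2) r * r = k * r ^ 3 / (1 + r\<^sup>2) * sqrt ((5 + 3 * cos x) / 8)"
proof -
  have "sqrt (1 + 3 * ((1 + cos x) / 2)) = sqrt (4 * ((5 + 3 * cos x) / 8))" by (simp add: field_simps)
  also have "\<dots> = 2 * sqrt ((5 + 3 * cos x) / 8)" unfolding real_sqrt_mult by simp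
  finally have "sqrt (1 + 3 * ((1 + cos x) / 2)) / 2 = sqrt ((5 + 3 * cos x) / 8)" by simp
  then show ?thesis by (simp add: growth_def power2_eq_square power3_eq_cube)
qed

lemma F4_rcis:
  "F4 k (rcis r x) = rcis (growth k ((1 + cos (4 * x)) / 2) r * r)
     (x + pi / 2 - arctan (sin (4 * x) / (3 + cos (4 * x))))"
proof -
  have "(r * cos x)\<^sup>2 + (r * sin x)\<^sup>2 = r\<^sup>2 * ((sin x)\<^sup>2 + (cos x)\<^sup>2)" by algebra
  then have r2: "1 + (r * cos x)\<^sup>2 + (r * sin x)\<^sup>2 = 1 + r\<^sup>2" by simp
  have "F4 k (rcis r x) = Complex (- (k * (r * sin x) ^ 3) / (1 + r\<^sup>2)) (k * (r * cos x) ^ 3 / (1 + r\<^sup>2))"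
    unfolding F4_def Let_def Re_rcis Im_rcis r2 ..
  also have "\<dots> = of_real (k * r ^ 3 / (1 + r\<^sup>2)) * \<i> * Complex (cos x ^ 3) (sin x ^ 3)"
    by (simp add: complex_eq_iff power_mult_distrib)
  also have "\<dots> = of_real (k * r ^ 3 / (1 + r\<^sup>2)) * \<i> * (cis x *
      (of_real (sqrt ((5 + 3 * cos (4 * x)) / 8)) * cis (- arctan (sin (4 * x) / (3 + cos (4 * x))))))"
    unfolding cis_cube cis_twist ..
  also have "\<dots> = of_real (growth k ((1 + cos (4 * x)) / 2) r * r) *
      (cis (pi / 2) * cis x * cis (- arctan (sin (4 * x) / (3 + cos (4 * x)))))"
    unfolding growth_phase by (simp add: mult_ac)
  also have "\<dots> = rcis (growth k ((1 + cos (4 * x)) / 2) r * r)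
     (x + pi / 2 - arctan (sin (4 * x) / (3 + cos (4 * x))))"
    unfolding cis_mult rcis_def by (simp only: add.commute[of "pi / 2" x] diff_conv_add_uminus)
  finally show ?thesis .
qed

text \<open>The closed sector is an intersection of two half planes, also in the case \<open>n = 2\<close>, where these
  coincide.\<close>

lemma closure_sector_0:
  assumes n: "n \<ge> 2" and z: "z \<in> closure (sector n 0)" "z \<noteq> 0"
  shows "Arg2pi z \<le> 2 * pi / real n"
proof -
  define b where "b = 2 * pi / real n"
  have b: "0 < b" "b \<le> pi" using n by (auto simp: b_def field_simps)
  define C where "C = {z. Im z \<ge> 0} \<inter> {z. Im (z * cis (- b)) \<le> 0}"
  have "closed C" unfolding C_def
    by (intro closed_Int closed_Collect_le continuous_intros)
  moreover have "sector n 0 \<subseteq> C"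
  proof
    fix x assume "x \<in> sector n 0"
    then obtain r t where rt: "x = rcis r t" "0 < r" "0 < t" "t < b" by (auto simp: b_def)
    have "sin t > 0" using rt b by (intro sin_gt_zero) auto
    moreover have "sin (b - t) > 0" using rt b by (intro sin_gt_zero) auto
    moreover have "Im (x * cis (- b)) = - (r * sin (b - t))"
      unfolding rt(1) by (simp add: sin_diff algebra_simps)
    ultimately show "x \<in> C" unfolding C_def Int_iff mem_Collect_eq using rt(1,2) by (simp only: Im_rcis) simp
  qed
  ultimately have zC: "z \<in> C" using closure_minimal z(1) by blast
  define t where "t = Arg2pi z"
  have t: "0 \<le> t" "t < 2 * pi" "z = rcis (cmod z) t"
    using Arg2pi[of z] polar_Arg2pi[of z] by (auto simp: t_def)
  have "Im z = cmod z * sin t" by (subst t(3)) simp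
  then have s1: "sin t \<ge> 0" using zC z(2) by (simp add: C_def zero_le_mult_iff)
  have "Im (z * cis (- b)) = - (cmod z * sin (b - t))"
    by (subst t(3)) (simp add: sin_diff algebra_simps)
  moreover have "Im (z * cis (- b)) \<le> 0" using zC unfolding C_def by blast
  ultimately have "0 \<le> cmod z * sin (b - t)" by linarith
  then have s2: "sin (b - t) \<ge> 0" using z(2) by (simp add: zero_le_mult_iff)
  have "t \<le> pi" using s1 t sin_lt_zero[of t] by force
  have "t \<le> b"
  proof (rule ccontr)
    assume "\<not> t \<le> b"
    then have "sin (t - b) > 0" using b t \<open>t \<le> pi\<close> by (intro sin_gt_zero) auto
    moreover have "sin (b - t) = - sin (t - b)" by (metis minus_diff_eq sin_minus)
    ultimately show False using s2 by simp
  qed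
  then show ?thesis by (simp add: t_def b_def)
qed

lemma rcis_in_closure_sector_0:
  assumes n: "n \<ge> 2" and "0 \<le> r" "0 \<le> t" "t \<le> 2 * pi / real n"
  shows "rcis r t \<in> closure (sector n 0)"
proof -
  let ?f = "\<lambda>p. rcis (fst p) (snd p)"
  have b: "0 < 2 * pi / real n" using n by simp
  have "?f ` closure ({0<..} \<times> {0<..<2 * pi / real n}) \<subseteq> closure (?f ` ({0<..} \<times> {0<..<2 * pi / real n}))"
    unfolding rcis_def
    by (rule image_closure_subset[OF _ closed_closure closure_subset]) (intro continuous_intros)
  moreover have "?f ` ({0<..} \<times> {0<..<2 * pi / real n}) = sector n 0" by force
  moreover have "(r, t) \<in> closure ({0<..} \<times> {0<..<2 * pi / real n})"
    using assms b by (simp add: closure_Times)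
  then have "?f (r, t) \<in> ?f ` closure ({0<..} \<times> {0<..<2 * pi / real n})" by (rule imageI)
  ultimately show ?thesis by auto
qed

lemma closure_sector_Suc: "closure (sector n (Suc j)) = rot n ` closure (sector n j)"
proof -
  have "linear (rot n)" unfolding rot_def[abs_def] by (simp add: linear_times)
  moreover have "inj (rot n)" unfolding rot_def[abs_def] by (simp add: inj_on_def)
  ultimately show ?thesis using closure_injective_linear_image by auto
qed

lemma in_some_closed_sector:
  assumes n: "n \<ge> 2" and r: "0 \<le> r" and t: "2 * pi * real j / real n \<le> t" "t \<le> 2 * pi * real (Suc j) / real n"
  shows "rcis r t \<in> closure (sector n j)"
  using t
proof (induction j arbitrary: t)
  case 0
  then show ?case using rcis_in_closure_sector_0[OF n r] by simp
next
  case (Suc j)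
  have "rcis r (t - 2 * pi / real n) \<in> closure (sector n j)"
    using Suc.prems by (intro Suc.IH) (auto simp: add_divide_distrib distrib_left)
  moreover have "rot n (rcis r (t - 2 * pi / real n)) = rcis r t"
    by (simp add: rot_def rcis_def cis_mult mult.left_commute)
  ultimately show ?case unfolding closure_sector_Suc by (metis imageI)
qed

lemma angle_shift:
  assumes "n > 0"
  shows "angle n (\<theta> + 2 * pi * of_int l / real n) = angle n \<theta> + 2 * pi * of_int l / real n"
    and "phase_of n (\<theta> + 2 * pi * of_int l / real n) = phase_of n \<theta>"
proof -
  have "real n * (\<theta> + 2 * pi * of_int l / real n) = real n * \<theta> + of_int l * (2 * pi)"
    using assms by (simp add: distrib_left)
  moreover have "sin (x + of_int l * (2 * pi)) = sin x" "cos (x + of_int l * (2 * pi)) = cos x" for x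
    using sin.plus_of_int[of x l] cos.plus_of_int[of x l] by auto
  ultimately show "angle n (\<theta> + 2 * pi * of_int l / real n) = angle n \<theta> + 2 * pi * of_int l / real n"
    "phase_of n (\<theta> + 2 * pi * of_int l / real n) = phase_of n \<theta>"
    by (simp_all add: angle_def phase_of_def)
qed

lemma angle_2pi:
  assumes "n > 0"
  shows "angle n (\<theta> + 2 * pi * of_int l) = angle n \<theta> + 2 * pi * of_int l"
    and "phase_of n (\<theta> + 2 * pi * of_int l) = phase_of n \<theta>"
  using angle_shift[OF assms, of \<theta> "int n * l"] assms by (simp_all add: mult_ac)

lemma rcis_eq_shift:
  assumes "rcis r t = rcis r t'" "r \<noteq> 0"
  obtains l :: int where "t = t' + 2 * pi * of_int l"
proof -
  have "cis t = cis t'" using assms by (simp add: rcis_def)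
  then have "sin t = sin t' \<and> cos t = cos t'" by (simp add: complex_eq_iff)
  then obtain l :: int where "t = t' + 2 * pi * of_int l" using sin_cos_eq_iff by metis
  then show ?thesis using that by blast
qed

lemma F_sector_rcis:
  assumes n: "n \<ge> 2" and "k > 0" and r: "0 \<le> r" and z: "rcis r \<theta> \<in> closure (sector n j)"
  shows "F_sector k n j (rcis r \<theta>) = rcis (growth k (phase_of n \<theta>) r * r) (angle n \<theta>)"
  using z
proof (induction j arbitrary: \<theta>)
  case 0
  show ?case
  proof (cases "r = 0")
    case True
    then show ?thesis by (simp add: h_inv_def h_def F4_def Complex_eq_0)
  next
    case False
    define t where "t = Arg2pi (rcis r \<theta>)"
    have z: "rcis r \<theta> = rcis r t"
      using polar_Arg2pi[of "rcis r \<theta>"] r by (simp add: t_def)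
    have t: "0 \<le> t" "t \<le> 2 * pi / real n"
      using closure_sector_0[OF n 0(1)] False Arg2pi[of "rcis r \<theta>"] by (auto simp: t_def)
    define x where "x = real n * t / 4"
    have x: "0 \<le> x" "x \<le> pi / 2" "4 * x = real n * t" using t n by (auto simp: x_def field_simps)
    define y where "y = x + pi / 2 - arctan (sin (4 * x) / (3 + cos (4 * x)))"
    define g where "g = growth k (phase_of n t) r * r"
    have y: "0 \<le> y" "y < 2 * pi"
      using x arctan_lbound[of "sin (4 * x) / (3 + cos (4 * x))"] arctan_ubound[of "sin (4 * x) / (3 + cos (4 * x))"]
      by (auto simp: y_def)
    have "5 + 3 * cos (real n * t) > 0" by (rule three_plus_cos_pos)
    then have g: "g > 0" unfolding g_def phase_of_def growth_phase
      using \<open>k > 0\<close> r False one_plus_sq_pos[of r] by simp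
    have 1: "h_inv n (rcis r \<theta>) = rcis r x" using r by (simp add: h_inv_def x_def t_def)
    have 2: "F4 k (rcis r x) = rcis g y" unfolding F4_rcis x(3) by (simp add: g_def phase_of_def y_def x(3))
    have "Arg2pi (rcis g y) = y" using g y
      by (intro Arg2pi_unique[of g]) (auto simp: rcis_def cis_conv_exp)
    then have 3: "h n (rcis g y) = rcis g (4 * y / real n)" using g by (simp add: h_def)
    have "4 * y / real n = angle n t"
      using n by (simp add: y_def x(3) angle_def) (simp add: x_def field_simps)
    then have "F_sector k n 0 (rcis r \<theta>) = rcis g (angle n t)" using 1 2 3 by simp
    moreover obtain l :: int where l: "\<theta> = t + 2 * pi * of_int l"
      using rcis_eq_shift[OF z False] by blast
    moreover have "rcis g (u + 2 * pi * of_int l) = rcis g u" for u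
      by (simp add: rcis_def cis_mult[symmetric] cis_multiple_2pi)
    ultimately show ?thesis using n angle_2pi[of n t l] by (simp add: g_def)
  qed
next
  case (Suc j)
  have inv: "rot_inv n (rot n w) = w" for w by (simp add: rot_def rot_inv_def mult.assoc[symmetric] cis_mult)
  obtain w where w: "w \<in> closure (sector n j)" "rcis r \<theta> = rot n w"
    using Suc.prems unfolding closure_sector_Suc by blast
  have ri: "rot_inv n (rcis r \<theta>) = rcis r (\<theta> - 2 * pi / real n)"
    by (simp add: rot_inv_def rcis_def cis_mult mult.left_commute)
  have "rot_inv n (rcis r \<theta>) = w" using w(2) inv by simp
  then have "F_sector k n j (rcis r (\<theta> - 2 * pi / real n)) =
      rcis (growth k (phase_of n (\<theta> - 2 * pi / real n)) r * r) (angle n (\<theta> - 2 * pi / real n))"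
    using w(1) ri by (intro Suc.IH) simp
  moreover have "angle n (\<theta> - 2 * pi / real n) = angle n \<theta> - 2 * pi / real n"
    "phase_of n (\<theta> - 2 * pi / real n) = phase_of n \<theta>"
    using angle_shift[of n \<theta> "-1"] n by simp_all
  ultimately show ?case using ri
    by (simp add: rot_def rcis_def cis_mult mult.left_commute)
qed

lemma F_rcis:
  assumes n: "n \<ge> 2" and k: "k > 0" and r: "0 \<le> r"
  shows "F k n (rcis r \<theta>) = rcis (growth k (phase_of n \<theta>) r * r) (angle n \<theta>)"
proof -
  define t where "t = Arg2pi (rcis r \<theta>)"
  have t: "0 \<le> t" "rcis r \<theta> = rcis r t"
    using Arg2pi[of "rcis r \<theta>"] polar_Arg2pi[of "rcis r \<theta>"] r by (auto simp: t_def)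
  define j where "j = nat \<lfloor>real n * t / (2 * pi)\<rfloor>"
  have "real j = of_int \<lfloor>real n * t / (2 * pi)\<rfloor>" using t(1) by (simp add: j_def)
  then have "real j \<le> real n * t / (2 * pi)" "real n * t / (2 * pi) \<le> real (Suc j)" by linarith+
  then have "2 * pi * real j / real n \<le> t" "t \<le> 2 * pi * real (Suc j) / real n"
    using n by (auto simp: field_simps)
  then have "rcis r \<theta> \<in> closure (sector n j)" unfolding t(2) by (intro in_some_closed_sector n r)
  then have "rcis r \<theta> \<in> closure (sector n (LEAST j. rcis r \<theta> \<in> closure (sector n j)))" by (rule LeastI)
  then show ?thesis unfolding F_def by (rule F_sector_rcis[OF n k r])
qed

text \<open>Multiplied by \<open>w ^ 4\<close>, where \<open>w\<close> is the modulus in \<open>cis_twist\<close>, both sides are polynomials in \<open>cos (n \<theta>)\<close>.\<close>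

lemma phase_of_angle:
  assumes "n > 0"
  shows "phase_of n (angle n \<theta>) = phase_of n \<theta> * ((3 + phase_of n \<theta>) / (1 + 3 * phase_of n \<theta>))\<^sup>2"
proof -
  define x where "x = real n * \<theta>"
  define a where "a = arctan (sin x / (3 + cos x))"
  have "real n * angle n \<theta> = x - 4 * a + 2 * pi"
    using assms by (simp add: angle_def x_def a_def field_simps)
  then have c: "cos (real n * angle n \<theta>) = cos (x - 4 * a)" by simp
  define C S where "C = cos x" and "S = sin x"
  have CS: "S\<^sup>2 = 1 - C\<^sup>2" by (simp add: C_def S_def sin_squared_eq)
  have C5: "5 + 3 * C > 0" using three_plus_cos_pos(2) by (simp add: C_def)
  define w where "w = sqrt ((5 + 3 * C) / 8)"
  have w: "w > 0" "w\<^sup>2 = (5 + 3 * C) / 8" using C5 by (simp_all add: w_def)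
  have tw: "of_real w * cis (- a) = (3 + cis (- x)) / 4" using cis_twist[of x] by (simp add: w_def a_def C_def)
  have ca: "w * cos a = (3 + C) / 4" and sa: "w * sin a = S / 4"
    using arg_cong[OF tw, of Re] arg_cong[OF tw, of Im] by (simp_all add: C_def S_def)
  have "w\<^sup>2 * cos (2 * a) = (w * cos a)\<^sup>2 - (w * sin a)\<^sup>2" unfolding cos_double by (simp add: power2_eq_square algebra_simps)
  then have c2: "w\<^sup>2 * cos (2 * a) = ((3 + C)\<^sup>2 - S\<^sup>2) / 16" unfolding ca sa by (simp add: power_divide diff_divide_distrib)
  have "w\<^sup>2 * sin (2 * a) = 2 * (w * sin a) * (w * cos a)" unfolding sin_double by (simp add: power2_eq_square)
  then have s2: "w\<^sup>2 * sin (2 * a) = S * (3 + C) / 8" unfolding ca sa by simp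
  have a4: "4 * a = 2 * (2 * a)" by simp
  have "(w\<^sup>2)\<^sup>2 * cos (4 * a) = (w\<^sup>2 * cos (2 * a))\<^sup>2 - (w\<^sup>2 * sin (2 * a))\<^sup>2"
    unfolding a4 cos_double[of "2 * a"] by (simp add: power2_eq_square algebra_simps)
  then have c4: "(w\<^sup>2)\<^sup>2 * cos (4 * a) = (((3 + C)\<^sup>2 - S\<^sup>2) / 16)\<^sup>2 - (S * (3 + C) / 8)\<^sup>2" unfolding c2 s2 .
  have "(w\<^sup>2)\<^sup>2 * sin (4 * a) = 2 * (w\<^sup>2 * sin (2 * a)) * (w\<^sup>2 * cos (2 * a))"
    unfolding a4 sin_double[of "2 * a"] by (simp add: power2_eq_square)
  then have s4: "(w\<^sup>2)\<^sup>2 * sin (4 * a) = 2 * (S * (3 + C) / 8) * (((3 + C)\<^sup>2 - S\<^sup>2) / 16)" unfolding c2 s2 .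
  have "(w\<^sup>2)\<^sup>2 * (1 + cos (x - 4 * a)) = (w\<^sup>2)\<^sup>2 + C * ((w\<^sup>2)\<^sup>2 * cos (4 * a)) + S * ((w\<^sup>2)\<^sup>2 * sin (4 * a))"
    by (simp add: cos_diff C_def S_def algebra_simps)
  also have "\<dots> = (1 + C) * (7 + C)\<^sup>2 / 64"
  proof -
    have 1: "(3 + C)\<^sup>2 - S\<^sup>2 = 8 + 6 * C + 2 * C\<^sup>2" unfolding CS by (simp add: power2_eq_square algebra_simps)
    have 2: "(S * (3 + C) / 8)\<^sup>2 = (1 - C\<^sup>2) * (3 + C)\<^sup>2 / 64" unfolding CS[symmetric] by (simp add: power_divide power_mult_distrib)
    have 3: "S * (2 * (S * (3 + C) / 8) * X) = (1 - C\<^sup>2) * (3 + C) / 4 * X" for X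
      unfolding CS[symmetric] by (simp add: power2_eq_square)
    show ?thesis unfolding c4 s4 unfolding w(2) 1 2 3
      by (simp add: power2_eq_square field_simps)
  qed
  finally have "((5 + 3 * C) / 8)\<^sup>2 * (1 + cos (x - 4 * a)) = (1 + C) * (7 + C)\<^sup>2 / 64" unfolding w(2) .
  then have "1 + cos (x - 4 * a) = (1 + C) * ((7 + C) / (5 + 3 * C))\<^sup>2"
    using C5 by (simp add: power_divide field_simps)
  moreover have "(3 + (1 + C) / 2) / (1 + 3 * ((1 + C) / 2)) = (7 + C) / (5 + 3 * C)"
    using C5 by (simp add: field_simps)
  ultimately show ?thesis unfolding phase_of_def c x_def[symmetric] C_def[symmetric] by simp
qed

lemma isCont_angle: "isCont (angle n) \<theta>"
  unfolding angle_def[abs_def] using three_plus_cos_pos(1) by (intro continuous_intros) (auto simp: less_imp_neq[symmetric])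

text \<open>The derivative is nonnegative and vanishes only where \<open>cos (n \<theta>) = 1\<close>, hence on no interval.\<close>

lemma strict_mono_angle:
  assumes n: "n > 0"
  shows "strict_mono (angle n)"
proof -
  define f where "f x = x - 4 * arctan (sin x / (3 + cos x))" for x :: real
  have der: "(f has_real_derivative (6 * (1 - cos x)) / (10 + 6 * cos x)) (at x)" for x
  proof -
    have p: "3 + cos x \<noteq> 0" "5 + 3 * cos x > 0" using three_plus_cos_pos[of x] by auto
    note q = twist_norm[of x]
    have "(f has_real_derivative (1 - 4 * (inverse (1 + (sin x / (3 + cos x))\<^sup>2) *
        ((cos x * (3 + cos x) - sin x * (- sin x)) / ((3 + cos x) * (3 + cos x)))))) (at x)"
      unfolding f_def using p by (auto intro!: derivative_eq_intros)
    moreover have "1 - 4 * (inverse (1 + (sin x / (3 + cos x))\<^sup>2) *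
        ((cos x * (3 + cos x) - sin x * (- sin x)) / ((3 + cos x) * (3 + cos x)))) = (6 * (1 - cos x)) / (10 + 6 * cos x)"
    proof -
      have num: "cos x * (3 + cos x) - sin x * (- sin x) = 1 + 3 * cos x"
        using sin_cos_squared_add[of x] by (simp add: power2_eq_square algebra_simps)
      have gen: "1 - 4 * (inverse (E / u\<^sup>2) * (v / (u * u))) = (E - 4 * v) / E"
        if "u \<noteq> 0" "E \<noteq> 0" for u v E :: real
        using that by (simp add: power2_eq_square divide_simps)
      have "10 + 6 * cos x \<noteq> 0" using p by simp
      from gen[OF p(1) this, of "1 + 3 * cos x"] show ?thesis unfolding q num by (simp only:) simp
    qed
    ultimately show ?thesis by simp
  qed
  have nn: "0 \<le> (6 * (1 - cos x)) / (10 + 6 * cos x)" for x :: real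
    using three_plus_cos_pos(2)[of x] by (intro divide_nonneg_nonneg) auto
  have mono: "f x \<le> f y" if "x \<le> y" for x y
    using DERIV_nonneg_imp_nondecreasing[OF that] der nn by blast
  have strict: "f x < f y" if xy: "x < y" for x y
  proof (rule ccontr)
    assume "\<not> f x < f y"
    then have eq: "f x = f y" using mono[of x y] xy by simp
    have "cos z = 1" if z: "x < z" "z < y" for z
    proof -
      have const: "f u = f x" if "x < u" "u < y" for u using mono[of x u] mono[of u y] eq that by simp
      have "((\<lambda>_. f x) has_real_derivative 0) (at z)" by simp
      then have "(f has_real_derivative 0) (at z)"
        by (rule has_field_derivative_transform_within_open[of _ _ _ "{x<..<y}"]) (use z const in auto)
      then have "(6 * (1 - cos z)) / (10 + 6 * cos z) = 0" using der DERIV_unique by blast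
      then show ?thesis using three_plus_cos_pos(2)[of z] by simp
    qed
    then have c1: "cos z = 1" if "z \<in> {x<..<y}" for z using that by simp
    define z where "z = (x + y) / 2"
    have z: "z \<in> {x<..<y}" using xy by (simp add: z_def)
    have "((\<lambda>_. 1) has_real_derivative 0) (at z)" by simp
    then have "(cos has_real_derivative 0) (at z)"
      by (rule has_field_derivative_transform_within_open[of _ _ _ "{x<..<y}"]) (use z c1 in auto)
    define d where "d = min 1 ((y - z) / 2)"
    have d: "0 < d" "d \<le> 1" "z + d \<in> {x<..<y}" using z by (auto simp: d_def min_def field_simps)
    have "sin z = 0" using c1[OF z] by (metis sin_cos_squared_add add_cancel_left_left one_power2 zero_eq_power2 add.commute)
    then have "cos (z + d) = cos d" using c1[OF z] by (simp add: cos_add)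
    then have "cos d = 1" using c1[OF d(3)] by simp
    moreover have "cos d < cos 0" using d pi_gt3 by (intro cos_monotone_0_pi) auto
    ultimately show False by simp
  qed
  have "angle n t = f (real n * t) / real n + 2 * pi / real n" for t
    using n by (simp add: angle_def f_def field_simps)
  then show ?thesis using strict n by (auto intro!: strict_monoI divide_strict_right_mono)
qed


section \<open>Rotation numbers\<close>

lemma cis_eq_imp_Ints:
  assumes "cis (2 * pi * s) = cis (2 * pi * t)"
  shows "s - t \<in> \<int>"
proof -
  have "rcis 1 (2 * pi * s) = rcis 1 (2 * pi * t)" using assms by (simp add: rcis_def)
  then obtain l :: int where "2 * pi * s = 2 * pi * t + 2 * pi * of_int l"
    using rcis_eq_shift[of 1] by (metis zero_neq_one)
  then have "2 * pi * (s - t) = 2 * pi * of_int l" by (simp add: algebra_simps)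
  then have "s - t = of_int l" by simp
  then show ?thesis by simp
qed

lemma small_int_zero: "x \<in> \<int> \<Longrightarrow> \<bar>x\<bar> < 1 \<Longrightarrow> x = (0::real)"
  by (auto elim!: Ints_cases)

text \<open>The difference of the two functions is continuous with integer values.\<close>

lemma translation_unique:
  fixes \<kappa> \<kappa>' :: "real \<Rightarrow> real"
  assumes "continuous_on UNIV \<kappa>" "continuous_on UNIV \<kappa>'"
    and "\<And>t. cis (2 * pi * \<kappa> t) = cis (2 * pi * \<kappa>' t)"
  obtains l :: int where "\<And>t. \<kappa> t = \<kappa>' t + of_int l"
proof -
  have int: "\<kappa> t - \<kappa>' t \<in> \<int>" for t using assms(3) by (rule cis_eq_imp_Ints)
  have "(\<lambda>t. \<kappa> t - \<kappa>' t) constant_on UNIV"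
  proof (rule continuous_discrete_range_constant)
    show "continuous_on UNIV (\<lambda>t. \<kappa> t - \<kappa>' t)" by (intro continuous_intros assms)
    show "\<exists>e>0. \<forall>y. y \<in> UNIV \<and> \<kappa> y - \<kappa>' y \<noteq> \<kappa> x - \<kappa>' x \<longrightarrow> e \<le> norm ((\<kappa> y - \<kappa>' y) - (\<kappa> x - \<kappa>' x))" for x
    proof (intro exI[of _ 1] conjI allI impI)
      fix y assume "y \<in> UNIV \<and> \<kappa> y - \<kappa>' y \<noteq> \<kappa> x - \<kappa>' x"
      then have "(\<kappa> y - \<kappa>' y) - (\<kappa> x - \<kappa>' x) \<in> \<int>" "(\<kappa> y - \<kappa>' y) - (\<kappa> x - \<kappa>' x) \<noteq> 0"
        using int[of x] int[of y] by (auto intro: Ints_diff)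
      then show "1 \<le> norm ((\<kappa> y - \<kappa>' y) - (\<kappa> x - \<kappa>' x))" using small_int_zero by fastforce
    qed simp
  qed auto
  then obtain c where c: "\<And>t. \<kappa> t - \<kappa>' t = c" by (auto simp: constant_on_def)
  obtain l where "c = of_int l" using int[of 0] c[of 0] by (auto elim: Ints_cases)
  then show ?thesis using that[of l] c by (metis add.commute diff_add_cancel)
qed

text \<open>The lift comes from a continuous logarithm. Its degree \<open>\<sigma>\<close> is \<open>-1\<close> if the orientation is reversed.\<close>

lemma circle_homeo_lift:
  fixes K :: "complex \<Rightarrow> complex"
  assumes cont: "continuous_on (sphere 0 1) K" and inj: "inj_on K (sphere 0 1)"
    and im: "K ` sphere 0 1 \<subseteq> sphere 0 1"
  obtains \<kappa> \<sigma> where "continuous_on UNIV \<kappa>" "inj \<kappa>" "surj \<kappa>"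
    "\<And>t. K (cis (2 * pi * t)) = cis (2 * pi * \<kappa> t)"
    "\<sigma> = 1 \<or> \<sigma> = -1" "\<And>t l. \<kappa> (t + of_int l) = \<kappa> t + \<sigma> * of_int l"
proof -
  define f where "f t = K (cis (2 * pi * t))" for t
  have norm_f: "cmod (f t) = 1" for t
  proof -
    have "K (cis (2 * pi * t)) \<in> sphere 0 1" by (rule subsetD[OF im]) simp
    then show ?thesis by (simp add: f_def)
  qed
  have contf: "continuous_on UNIV f" unfolding f_def
    by (rule continuous_on_compose2[OF cont]) (auto intro!: continuous_intros)
  obtain g where g: "continuous_on UNIV g" "\<And>t. f t = exp (g t)"
  proof (rule continuous_logarithm_on_contractible[OF contf contractible_UNIV])
    show "f t \<noteq> 0" for t using norm_f[of t] by auto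
  qed auto
  define \<kappa> where "\<kappa> t = Im (g t) / (2 * pi)" for t
  have cont\<kappa>: "continuous_on UNIV \<kappa>" unfolding \<kappa>_def by (intro continuous_intros g) auto
  have lift: "f t = cis (2 * pi * \<kappa> t)" for t
  proof -
    have "exp (Re (g t)) = 1" using norm_f[of t] unfolding g(2) by simp
    then have "Re (g t) = 0" by simp
    then have "g t = \<i> * of_real (2 * pi * \<kappa> t)" by (simp add: complex_eq_iff \<kappa>_def)
    then show ?thesis using g(2) by (simp add: cis_conv_exp)
  qed
  have near: "s = t" if st: "\<kappa> s - \<kappa> t \<in> \<int>" "\<bar>s - t\<bar> < 1" for s t
  proof -
    obtain l where "\<kappa> s - \<kappa> t = of_int l" using st(1) by (rule Ints_cases)
    then have "\<kappa> s = \<kappa> t + of_int l" by simp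
    then have "cis (2 * pi * \<kappa> s) = cis (2 * pi * \<kappa> t) * cis (2 * pi * of_int l)"
      by (simp only: cis_mult distrib_left)
    then have "f s = f t" unfolding lift by (simp add: cis_multiple_2pi)
    then have "cis (2 * pi * s) = cis (2 * pi * t)" unfolding f_def by (rule inj_onD[OF inj]) simp_all
    then have "s - t \<in> \<int>" by (rule cis_eq_imp_Ints)
    then show ?thesis using small_int_zero st(2) by fastforce
  qed
  have c1: "continuous_on UNIV (\<lambda>t. \<kappa> (t + 1))"
    by (rule continuous_on_compose2[OF cont\<kappa>]) (auto intro!: continuous_intros)
  have c2: "cis (2 * pi * \<kappa> (t + 1)) = cis (2 * pi * \<kappa> t)" for t
    unfolding lift[symmetric] f_def by (simp add: distrib_left cis_mult[symmetric])
  obtain l where l: "\<And>t. \<kappa> (t + 1) = \<kappa> t + of_int l"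
    using translation_unique[OF c1 cont\<kappa> c2] by blast
  have k1: "\<kappa> 1 = \<kappa> 0 + of_int l" using l[of 0] by simp
  have cont_on: "continuous_on S \<kappa>" for S using cont\<kappa> continuous_on_subset by blast
  have ivt: "\<exists>x. a \<le> x \<and> x \<le> b \<and> \<kappa> x = y" if "a \<le> b" "(\<kappa> a \<le> y \<and> y \<le> \<kappa> b) \<or> (\<kappa> b \<le> y \<and> y \<le> \<kappa> a)" for a b y
    using that IVT'[of \<kappa> a y b] IVT2'[of \<kappa> b y a] cont_on by metis
  \<comment> \<open>Degree \<open>0\<close> and degrees beyond \<open>\<plusminus>1\<close> contradict injectivity on a period, by the intermediate value theorem.\<close>
  have "l \<noteq> 0"
  proof
    assume "l = 0"
    then have eq: "\<kappa> 1 = \<kappa> 0" using k1 by simp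
    define y where "y = (\<kappa> 0 + \<kappa> (1/2)) / 2"
    have ne: "\<kappa> 0 \<noteq> \<kappa> (1/2)" using near[of 0 "1/2"] by force
    obtain s where s: "0 \<le> s" "s \<le> 1/2" "\<kappa> s = y" using ivt[of 0 "1/2" y] by (fastforce simp: y_def)
    obtain t where t: "1/2 \<le> t" "t \<le> 1" "\<kappa> t = y" using ivt[of "1/2" 1 y] eq by (fastforce simp: y_def)
    have "y \<noteq> \<kappa> (1/2)" using ne by (simp add: y_def)
    then have "s \<noteq> 1/2" "t \<noteq> 1/2" using s(3) t(3) by metis+
    moreover have "s \<noteq> 0" using s(3) ne by (auto simp: y_def)
    ultimately have "\<bar>s - t\<bar> < 1" "s \<noteq> t" using s t by auto
    then show False using near[of s t] s t by simp
  qed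
  have "\<bar>l\<bar> \<le> 1"
  proof (rule ccontr)
    assume big: "\<not> \<bar>l\<bar> \<le> 1"
    define y where "y = \<kappa> 0 + sgn (of_int l)"
    have "\<exists>x. 0 \<le> x \<and> x \<le> 1 \<and> \<kappa> x = y"
    proof (rule ivt)
      have "of_int l \<ge> (2::real) \<or> of_int l \<le> (-2::real)" using big by linarith
      then show "(\<kappa> 0 \<le> y \<and> y \<le> \<kappa> 1) \<or> (\<kappa> 1 \<le> y \<and> y \<le> \<kappa> 0)"
        using k1 by (auto simp: y_def sgn_if)
    qed simp
    then obtain x where x: "0 \<le> x" "x \<le> 1" "\<kappa> x = y" by blast
    have "x \<noteq> 0" using x(3) \<open>l \<noteq> 0\<close> by (auto simp: y_def sgn_if split: if_splits)
    moreover have "x \<noteq> 1" using x(3) k1 big by (auto simp: y_def sgn_if split: if_splits)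
    moreover have "\<kappa> x - \<kappa> 0 \<in> \<int>" using x(3) by (auto simp: y_def sgn_if)
    ultimately show False using near[of x 0] x by auto
  qed
  define \<sigma> :: real where "\<sigma> = of_int l"
  have sigma: "\<sigma> = 1 \<or> \<sigma> = -1" using \<open>l \<noteq> 0\<close> \<open>\<bar>l\<bar> \<le> 1\<close> by (auto simp: \<sigma>_def abs_le_iff)
  have shift_nat: "\<kappa> (t + real i) = \<kappa> t + \<sigma> * real i" for t i
  proof (induction i)
    case (Suc i)
    have "\<kappa> (t + real (Suc i)) = \<kappa> ((t + real i) + 1)" by (simp add: add_ac)
    then show ?case using l[of "t + real i"] Suc by (simp add: \<sigma>_def distrib_left)
  qed simp
  have shift: "\<kappa> (t + of_int i) = \<kappa> t + \<sigma> * of_int i" for t i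
  proof (cases "i \<ge> 0")
    case True
    then show ?thesis using shift_nat[of t "nat i"] by simp
  next
    case False
    then show ?thesis using shift_nat[of "t + of_int i" "nat (- i)"] by (simp add: algebra_simps)
  qed
  have "surj \<kappa>" unfolding surj_def
  proof
    fix y
    obtain i :: nat where i: "\<bar>y - \<kappa> 0\<bar> < real i" using reals_Archimedean2 by blast
    have "\<kappa> (real i) = \<kappa> 0 + \<sigma> * real i" "\<kappa> (- real i) = \<kappa> 0 - \<sigma> * real i"
      using shift[of 0 "int i"] shift[of 0 "- int i"] by simp_all
    then have "(\<kappa> (- real i) \<le> y \<and> y \<le> \<kappa> (real i)) \<or> (\<kappa> (real i) \<le> y \<and> y \<le> \<kappa> (- real i))"
      using i sigma by auto
    then show "\<exists>x. y = \<kappa> x" using ivt[of "- real i" "real i" y] by auto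
  qed
  moreover have "inj \<kappa>"
  proof (rule injI)
    fix s t assume eq: "\<kappa> s = \<kappa> t"
    define i where "i = \<lfloor>s - t\<rfloor>"
    have "\<kappa> s - \<kappa> (t + of_int i) \<in> \<int>" unfolding shift eq using sigma by auto
    moreover have "\<bar>s - (t + of_int i)\<bar> < 1" by (simp add: i_def) linarith
    ultimately have "s = t + of_int i" by (rule near)
    moreover from this have "i = 0" using eq shift[of t i] sigma by auto
    ultimately show "s = t" by simp
  qed
  ultimately show ?thesis using that cont\<kappa> lift sigma shift unfolding f_def by blast
qed

lemma iterate_shift:
  fixes G :: "real \<Rightarrow> real"
  assumes "\<And>t. G (t + 1) = G t + 1"
  shows "(G ^^ m) (t + of_int i) = (G ^^ m) t + of_int i"
proof -
  have n: "G (t + real i) = G t + real i" for t i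
  proof (induction i)
    case (Suc i)
    have "G (t + real (Suc i)) = G ((t + real i) + 1)" by (simp add: add_ac)
    then show ?case using assms[of "t + real i"] Suc by simp
  qed simp
  have z: "G (t + of_int i) = G t + of_int i" for t i
  proof (cases "i \<ge> 0")
    case True
    then show ?thesis using n[of t "nat i"] by simp
  next
    case False
    then show ?thesis using n[of "t + of_int i" "nat (- i)"] by simp
  qed
  show ?thesis by (induction m) (simp_all add: z)
qed

text \<open>By monotonicity an orbit that starts between \<open>x + i\<close> and \<open>x + i + 1\<close> stays between the orbits of these two
  points.\<close>

lemma rotation_number_of_orbit:
  fixes G :: "real \<Rightarrow> real"
  assumes mono: "strict_mono G" and deg: "\<And>t. G (t + 1) = G t + (1::real)"
    and orbit: "\<And>m. (G ^^ m) x = x + real m * \<tau>"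
  shows "(\<lambda>m. ((G ^^ m) t - t) / real m) \<longlonglongrightarrow> \<tau>"
proof -
  define i where "i = \<lfloor>t - x\<rfloor>"
  have t: "x + of_int i \<le> t" "t \<le> x + of_int (i + 1)" unfolding i_def by linarith+
  have bound: "\<bar>(G ^^ m) t - t - real m * \<tau>\<bar> \<le> 1" for m
  proof -
    have "(G ^^ m) (x + of_int i) \<le> (G ^^ m) t" "(G ^^ m) t \<le> (G ^^ m) (x + of_int (i + 1))"
      using t monoD[OF mono_pow[OF strict_mono_mono[OF mono]]] by auto
    then have "x + real m * \<tau> + of_int i \<le> (G ^^ m) t" "(G ^^ m) t \<le> x + real m * \<tau> + of_int (i + 1)"
      using iterate_shift[where G = G, OF deg, of m x i] iterate_shift[where G = G, OF deg, of m x "i + 1"] orbit[of m]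
      by simp_all
    then show ?thesis using t by (simp add: abs_le_iff)
  qed
  have "(\<lambda>m. ((G ^^ m) t - t) / real m - \<tau>) \<longlonglongrightarrow> 0"
  proof (rule Lim_null_comparison)
    show "(\<lambda>m. 1 / real m) \<longlonglongrightarrow> 0" by (rule lim_1_over_n)
    have "norm (((G ^^ m) t - t) / real m - \<tau>) \<le> 1 / real m" if "m > 0" for m
    proof -
      have "((G ^^ m) t - t) / real m - \<tau> = ((G ^^ m) t - t - real m * \<tau>) / real m"
        using that by (simp add: field_simps)
      then show ?thesis using bound[of m] that by (simp add: abs_divide divide_right_mono)
    qed
    then show "\<forall>\<^sub>F m in sequentially. norm (((G ^^ m) t - t) / real m - \<tau>) \<le> 1 / real m"
      by (intro eventually_mono[OF eventually_gt_at_top[of 0]])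
  qed
  then show ?thesis by (simp add: LIM_zero_iff)
qed

text \<open>If \<open>K\<close> commutes with the rotation by \<open>1 / n\<close>, it maps the orbit of \<open>1\<close> under \<open>D\<close>, a regular \<open>n\<close>-gon on
  which \<open>D\<close> is this rotation, to an orbit of the conjugate map on which it is the same rotation.\<close>

lemma rotation_number_conjugate:
  fixes K L D :: "complex \<Rightarrow> complex" and A :: "real \<Rightarrow> real"
  assumes n: "n > 0"
    and K: "continuous_on (sphere 0 1) K" "inj_on K (sphere 0 1)" "K ` sphere 0 1 = sphere 0 1"
    and L: "\<And>\<omega>. cmod \<omega> = 1 \<Longrightarrow> L (K \<omega>) = \<omega>"
    and eqv: "\<And>\<omega>. cmod \<omega> = 1 \<Longrightarrow> K (cis (2 * pi / real n) * \<omega>) = cis (2 * pi / real n) * K \<omega>"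
    and A: "continuous_on UNIV A" "strict_mono A" "\<And>t. A (t + 1) = A t + 1"
    and DA: "\<And>t. D (cis (2 * pi * t)) = cis (2 * pi * A t)"
    and orbit: "\<And>j. A (real j / real n) = real (Suc j) / real n"
  shows "has_poincare_rotation_number (K \<circ> D \<circ> L) (1 / real n)"
proof -
  obtain \<kappa> \<sigma> where \<kappa>: "continuous_on UNIV \<kappa>" "inj \<kappa>" "surj \<kappa>"
    "\<And>t. K (cis (2 * pi * t)) = cis (2 * pi * \<kappa> t)"
    "\<sigma> = 1 \<or> \<sigma> = -1" "\<And>t l. \<kappa> (t + of_int l) = \<kappa> t + \<sigma> * of_int l"
    using circle_homeo_lift[OF K(1,2)] K(3) by (metis order_refl)
  define G where "G = \<kappa> \<circ> A \<circ> inv \<kappa>"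
  have inv: "inv \<kappa> (\<kappa> t) = t" "\<kappa> (inv \<kappa> t) = t" for t
    using \<kappa>(2,3) by (simp_all add: surj_f_inv_f)
  have G\<kappa>: "G (\<kappa> t) = \<kappa> (A t)" for t by (simp add: G_def inv)
  have "continuous_on UNIV (inv \<kappa>)"
    using continuous_on_inverse_open[of UNIV \<kappa> "inv \<kappa>"] \<kappa>(1,3) inv by simp
  then have contG: "continuous_on UNIV G" unfolding G_def
    by (intro continuous_on_compose continuous_on_subset[OF \<kappa>(1)] continuous_on_subset[OF A(1)]) auto
  have injG: "inj G" unfolding G_def
    using injD[OF \<kappa>(2)] strict_mono_eq[OF A(2)] inv(2) by (intro injI) (metis comp_apply)
  have A_int: "A (t + of_int i) = A t + of_int i" for t i using iterate_shift[where G = A and m = 1, OF A(3)] by simp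
  have deg: "G (t + 1) = G t + 1" for t
  proof -
    define u where "u = inv \<kappa> t"
    \<comment> \<open>The degree \<open>\<sigma>\<close> of \<open>K\<close> enters twice, through \<open>\<kappa>\<close> and through its inverse, and \<open>\<sigma>\<^sup>2 = 1\<close>.\<close>
    obtain e :: int where e: "\<sigma> = of_int e" "\<sigma> * of_int e = 1" using \<kappa>(5) by (metis of_int_1 of_int_minus mult_1 minus_mult_minus mult_minus_left)
    have "t + 1 = \<kappa> (u + of_int e)" using \<kappa>(6)[of u e] e inv by (simp add: u_def)
    then have "G (t + 1) = \<kappa> (A u + of_int e)" by (simp add: G\<kappa> A_int)
    also have "\<dots> = G t + 1" using \<kappa>(6)[of "A u" e] e G\<kappa>[of u] inv by (simp add: u_def)
    finally show ?thesis .
  qed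
  have mono: "strict_mono G"
  proof (rule strict_monoI)
    fix s t :: real assume st: "s < t"
    obtain i :: nat where i: "t - s < real i" using reals_Archimedean2 by blast
    have "G (s + real i) = G s + real i" using iterate_shift[where G = G and m = 1 and t = s and i = "int i", OF deg] by simp
    moreover have "real i > 0" using i st by simp
    moreover have "continuous_on {s..s + real i} G" "inj_on G {s..s + real i}"
      using continuous_on_subset[OF contG] inj_on_subset[OF injG] by auto
    then have "(G s < G t \<and> G t < G (s + real i)) \<or> (G (s + real i) < G t \<and> G t < G s)"
      using continuous_inj_imp_mono[of s t "s + real i" G] st i by auto
    ultimately show "G s < G t" by auto
  qed
  have lift: "circle_lift (K \<circ> D \<circ> L) G"
    unfolding circle_lift_def
  proof (intro conjI allI contG mono deg)
    fix t
    define u where "u = inv \<kappa> t"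
    have "cis (2 * pi * t) = K (cis (2 * pi * u))" using \<kappa>(4)[of u] inv by (simp add: u_def)
    then have "L (cis (2 * pi * t)) = cis (2 * pi * u)" using L by simp
    then show "(K \<circ> D \<circ> L) (cis (2 * pi * t)) = cis (2 * pi * G t)"
      using DA[of u] \<kappa>(4)[of "A u"] G\<kappa>[of u] inv by (simp add: u_def)
  qed
  have c1: "continuous_on UNIV (\<lambda>t. \<kappa> (t + 1 / real n))"
    by (rule continuous_on_compose2[OF \<kappa>(1)]) (auto intro!: continuous_intros)
  have c2: "continuous_on UNIV (\<lambda>t. \<kappa> t + 1 / real n)" by (intro continuous_intros \<kappa>(1))
  have c3: "cis (2 * pi * \<kappa> (t + 1 / real n)) = cis (2 * pi * (\<kappa> t + 1 / real n))" for t
  proof -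
    have "cis (2 * pi * (t + 1 / real n)) = cis (2 * pi / real n) * cis (2 * pi * t)"
      by (simp add: cis_mult distrib_left add.commute)
    then have "cis (2 * pi * \<kappa> (t + 1 / real n)) = cis (2 * pi / real n) * cis (2 * pi * \<kappa> t)"
      using eqv[of "cis (2 * pi * t)"] \<kappa>(4)[of t] \<kappa>(4)[of "t + 1 / real n"] by simp
    then show ?thesis by (simp add: cis_mult distrib_left add.commute)
  qed
  obtain N :: int where N: "\<And>t. \<kappa> (t + 1 / real n) = \<kappa> t + 1 / real n + of_int N"
    using translation_unique[OF c1 c2 c3] by blast
  define \<tau> where "\<tau> = 1 / real n + of_int N"
  have kj: "\<kappa> (real j / real n) = \<kappa> 0 + real j * \<tau>" for j
  proof (induction j)
    case (Suc j)
    have "real (Suc j) / real n = real j / real n + 1 / real n" by (simp add: add_divide_distrib)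
    then show ?case using N[of "real j / real n"] Suc by (simp add: \<tau>_def distrib_right)
  qed simp
  have "(G ^^ j) (\<kappa> 0) = \<kappa> (real j / real n)" for j
    by (induction j) (use orbit in \<open>auto simp: G\<kappa>\<close>)
  then have "(G ^^ j) (\<kappa> 0) = \<kappa> 0 + real j * \<tau>" for j using kj by simp
  then have "(\<lambda>m. ((G ^^ m) t - t) / real m) \<longlonglongrightarrow> \<tau>" for t
    by (rule rotation_number_of_orbit[OF mono deg])
  then show ?thesis unfolding has_poincare_rotation_number_def
    using lift by (intro exI[of _ G] exI[of _ \<tau>]) (auto simp: \<tau>_def)
qed

lemma Riemann_map_normalized:
  assumes "open U" "simply_connected U" "U \<noteq> UNIV" "0 \<in> U"
  obtains \<phi> f where "\<phi> holomorphic_on U" "f holomorphic_on ball 0 1"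
    "\<And>z. z \<in> U \<Longrightarrow> \<phi> z \<in> ball 0 1 \<and> f (\<phi> z) = z" "\<And>w. w \<in> ball 0 1 \<Longrightarrow> f w \<in> U \<and> \<phi> (f w) = w" "\<phi> 0 = 0"
proof -
  obtain a b where ab: "a holomorphic_on U" "b holomorphic_on ball 0 1"
    "\<And>z. z \<in> U \<Longrightarrow> a z \<in> ball 0 1 \<and> b (a z) = z" "\<And>w. w \<in> ball 0 1 \<Longrightarrow> b w \<in> U \<and> a (b w) = w"
  proof -
    have "U \<noteq> {}" using assms(4) by blast
    then have "\<exists>f g. f holomorphic_on U \<and> g holomorphic_on ball 0 1 \<and>
      (\<forall>z \<in> U. f z \<in> ball 0 1 \<and> g (f z) = z) \<and> (\<forall>z \<in> ball 0 1. g z \<in> U \<and> f (g z) = z)"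
      using Riemann_mapping_theorem[of U] assms(1-3) by blast
    then show ?thesis using that by blast
  qed
  have "a 0 \<in> ball 0 1" using ab(3) assms(4) by blast
  then obtain u v where uv: "u (a 0) = 0" "u holomorphic_on ball 0 1" "u ` ball 0 1 \<subseteq> ball 0 1"
      "v holomorphic_on ball 0 1" "v ` ball 0 1 \<subseteq> ball 0 1"
      "\<And>z. z \<in> ball 0 1 \<Longrightarrow> u (v z) = z" "\<And>z. z \<in> ball 0 1 \<Longrightarrow> v (u z) = z"
    using ball_biholomorphism_exists by metis
  show ?thesis
  proof (rule that[of "u \<circ> a" "b \<circ> v"])
    show "u \<circ> a holomorphic_on U" using ab(3) by (intro holomorphic_on_compose_gen[OF ab(1) uv(2)]) auto
    show "b \<circ> v holomorphic_on ball 0 1" by (rule holomorphic_on_compose_gen[OF uv(4) ab(2) uv(5)])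
    show "(u \<circ> a) z \<in> ball 0 1 \<and> (b \<circ> v) ((u \<circ> a) z) = z" if "z \<in> U" for z
      using ab(3)[OF that] uv(3,7) by (simp add: image_subset_iff)
    show "(b \<circ> v) w \<in> U \<and> (u \<circ> a) ((b \<circ> v) w) = w" if "w \<in> ball 0 1" for w
      using ab(4) uv(5,6) that by (simp add: image_subset_iff)
    show "(u \<circ> a) 0 = 0" using uv(1) by simp
  qed
qed

text \<open>A normalized Riemann map inherits a rotational symmetry of the domain, by the Schwarz lemma.\<close>

lemma Riemann_map_rotation:
  assumes U: "open U" "0 \<in> U" and c: "cmod c = 1" and inv: "\<And>z. c * z \<in> U \<longleftrightarrow> z \<in> U"
    and hol: "\<phi> holomorphic_on U" "f holomorphic_on ball 0 1"
    and bi: "\<And>z. z \<in> U \<Longrightarrow> \<phi> z \<in> ball 0 1 \<and> f (\<phi> z) = z" "\<And>w. w \<in> ball 0 1 \<Longrightarrow> f w \<in> U \<and> \<phi> (f w) = w"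
    and 0: "\<phi> 0 = 0" and z: "z \<in> U"
  shows "\<phi> (c * z) = c * \<phi> z"
proof -
  have f0: "f 0 = 0" using bi(1)[of 0] U(2) 0 by simp
  have c0: "c \<noteq> 0" using c by auto
  have inv': "inverse c * z \<in> U \<longleftrightarrow> z \<in> U" for z using inv[of "inverse c * z"] c0 by (simp add: mult.assoc[symmetric])
  have holc: "(\<lambda>w. \<phi> (b * f w)) holomorphic_on ball 0 1" if b: "\<And>z. z \<in> U \<Longrightarrow> b * z \<in> U" for b
  proof -
    have "(\<lambda>w. b * f w) holomorphic_on ball 0 1" by (intro holomorphic_intros hol(2))
    moreover have "(\<lambda>w. b * f w) ` ball 0 1 \<subseteq> U" using b bi(2) by auto
    ultimately show ?thesis using holomorphic_on_compose_gen[OF _ hol(1)] by (simp add: o_def)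
  qed
  define a where "a w = \<phi> (c * f w)" for w
  define a' where "a' w = \<phi> (inverse c * f w)" for w
  have a: "a holomorphic_on ball 0 1" "a 0 = 0" "\<And>w. cmod w < 1 \<Longrightarrow> cmod (a w) < 1"
  proof -
    show "a holomorphic_on ball 0 1" unfolding a_def by (rule holc) (simp add: inv)
    show "a 0 = 0" by (simp add: a_def f0 0)
    show "cmod (a w) < 1" if "cmod w < 1" for w
      using bi(1)[of "c * f w"] bi(2)[of w] that inv by (simp add: a_def)
  qed
  have a': "a' holomorphic_on ball 0 1" "a' 0 = 0" "\<And>w. cmod w < 1 \<Longrightarrow> cmod (a' w) < 1"
  proof -
    show "a' holomorphic_on ball 0 1" unfolding a'_def by (rule holc) (simp add: inv')
    show "a' 0 = 0" by (simp add: a'_def f0 0)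
    show "cmod (a' w) < 1" if "cmod w < 1" for w
      using bi(1)[of "inverse c * f w"] bi(2)[of w] that inv' by (simp add: a'_def)
  qed
  have aa: "a' (a w) = w" if "cmod w < 1" for w
  proof -
    have w: "f w \<in> U" "\<phi> (f w) = w" using bi(2)[of w] that by auto
    then have "f (\<phi> (c * f w)) = c * f w" using bi(1)[of "c * f w"] inv by simp
    then show ?thesis using w c0 by (simp add: a_def a'_def mult.assoc[symmetric])
  qed
  have "cmod (a w) = cmod w" if w: "cmod w < 1" for w
  proof (rule antisym)
    show "cmod (a w) \<le> cmod w" by (rule Schwarz_Lemma(1)[OF a w])
    have "cmod (a' (a w)) \<le> cmod (a w)" by (rule Schwarz_Lemma(1)[OF a' a(3)[OF w]])
    then show "cmod w \<le> cmod (a w)" using aa[OF w] by simp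
  qed
  then have "\<exists>z. cmod z < 1 \<and> z \<noteq> 0 \<and> cmod (a z) = cmod z" by (intro exI[of _ "1/2"]) auto
  then obtain l where l: "\<And>w. cmod w < 1 \<Longrightarrow> a w = l * w"
    using Schwarz_Lemma(3)[OF a, of 0] by auto
  have eq: "\<phi> (c * z) = l * \<phi> z" if "z \<in> U" for z
    using l[of "\<phi> z"] bi(1)[OF that] by (simp add: a_def)
  have d: "(\<phi> has_field_derivative deriv \<phi> 0) (at 0)" using holomorphic_derivI[OF hol(1) U] .
  have "((\<lambda>z. \<phi> (c * z)) has_field_derivative deriv \<phi> 0 * c) (at 0)"
    using DERIV_chain2[of \<phi> "deriv \<phi> 0" "\<lambda>z. c * z" 0 c] d by (auto intro!: derivative_eq_intros)
  moreover have "((\<lambda>z. \<phi> (c * z)) has_field_derivative l * deriv \<phi> 0) (at 0)"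
  proof (rule has_field_derivative_transform_within_open[OF _ U])
    show "((\<lambda>z. l * \<phi> z) has_field_derivative l * deriv \<phi> 0) (at 0)" using d by (rule DERIV_cmult)
  qed (use eq in simp)
  ultimately have "deriv \<phi> 0 * c = l * deriv \<phi> 0" by (rule DERIV_unique)
  moreover have "deriv \<phi> 0 \<noteq> 0"
  proof
    assume d0: "deriv \<phi> 0 = 0"
    have "(f has_field_derivative deriv f 0) (at (\<phi> 0))"
      using holomorphic_derivI[OF hol(2) open_ball, of 0] 0 by simp
    then have "((\<lambda>z. f (\<phi> z)) has_field_derivative deriv f 0 * deriv \<phi> 0) (at 0)"
      using d by (rule DERIV_chain2)
    then have "((\<lambda>z. z) has_field_derivative deriv f 0 * deriv \<phi> 0) (at 0)"
      by (rule has_field_derivative_transform_within_open[OF _ U]) (use bi(1) in simp)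
    then show False using DERIV_unique[OF _ DERIV_ident] d0 by force
  qed
  ultimately have "l = c" by (simp add: mult.commute)
  then show ?thesis using eq[OF z] by simp
qed


section \<open>The basin of attraction\<close>

locale szlenk =
  fixes k :: real and n :: nat
  assumes k: "1 < k" "k < 2" and n: "n \<ge> 2"
begin

definition phase_at :: "complex \<Rightarrow> real" where "phase_at z = (1 + Re (sgn z ^ n)) / 2"

definition gauge :: "complex \<Rightarrow> real" where "gauge z = cmod z * \<mu> k (phase_at z)"

text \<open>The action on directions.\<close>

definition D :: "complex \<Rightarrow> complex" where
  "D \<omega> = \<omega> * cis (2 * pi / real n - 4 / real n * arctan (Im (\<omega> ^ n) / (3 + Re (\<omega> ^ n))))"

lemma sgn_power_bound: "cmod (sgn z ^ n) \<le> 1"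
  by (simp add: norm_power norm_sgn power_le_one)

lemma phase_at_bounds: "0 \<le> phase_at z" "phase_at z \<le> 1"
  using abs_Re_le_cmod[of "sgn z ^ n"] sgn_power_bound[of z] by (auto simp: phase_at_def abs_le_iff)

lemma sgn_rcis: "r > 0 \<Longrightarrow> sgn (rcis r \<theta>) = cis \<theta>"
  by (simp add: sgn_eq rcis_def norm_mult)

lemma phase_at_rcis: "r > 0 \<Longrightarrow> phase_at (rcis r \<theta>) = phase_of n \<theta>"
  by (simp add: phase_at_def phase_of_def sgn_rcis Complex.DeMoivre)

lemma D_cis: "D (cis \<theta>) = cis (angle n \<theta>)"
  by (simp add: D_def angle_def cis_mult Complex.DeMoivre add_diff_eq)

lemma F_polar: "F k n z = (growth k (phase_at z) (cmod z) * cmod z) *\<^sub>R D (sgn z)"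
proof (cases "z = 0")
  case True
  then show ?thesis using F_rcis[of n k 0 0] n k by simp
next
  case False
  define \<theta> where "\<theta> = Arg2pi z"
  have z: "z = rcis (cmod z) \<theta>" using polar_Arg2pi[of z] by (simp add: \<theta>_def)
  have "F k n z = rcis (growth k (phase_of n \<theta>) (cmod z) * cmod z) (angle n \<theta>)"
    using F_rcis[of n k "cmod z" \<theta>] n k z by simp
  moreover have "phase_of n \<theta> = phase_at z" "sgn z = cis \<theta>"
    using phase_at_rcis[of "cmod z" \<theta>] sgn_rcis[of "cmod z" \<theta>] z False by auto
  ultimately show ?thesis by (simp add: D_cis rcis_def scaleR_conv_of_real)
qed

lemma cmod_D: "cmod (D \<omega>) = cmod \<omega>" by (simp add: D_def norm_mult)

lemma growth_pos: "0 \<le> s \<Longrightarrow> r > 0 \<Longrightarrow> growth k s r > 0"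
  unfolding growth_def using k one_plus_sq_pos[of r] by (intro mult_pos_pos divide_pos_pos) auto

lemma cmod_F: "cmod (F k n z) = growth k (phase_at z) (cmod z) * cmod z"
proof (cases "z = 0")
  case False
  then show ?thesis using growth_pos[OF phase_at_bounds(1)[of z], of "cmod z"]
    by (simp add: F_polar cmod_D norm_sgn)
qed (simp add: F_polar D_def)

lemma F_0: "F k n 0 = 0" by (simp add: F_polar)

lemma F_eq_0_iff: "F k n z = 0 \<longleftrightarrow> z = 0"
proof (cases "z = 0")
  case False
  then have "cmod (F k n z) > 0"
    unfolding cmod_F using growth_pos[OF phase_at_bounds(1)[of z], of "cmod z"] by simp
  then show ?thesis using False by auto
qed (simp add: F_0)

lemma sgn_F:
  assumes "z \<noteq> 0"
  shows "sgn (F k n z) = D (sgn z)"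
proof -
  have "cmod (D (sgn z)) = 1" using assms by (simp add: cmod_D norm_sgn)
  then have "sgn (D (sgn z)) = D (sgn z)" by (simp add: sgn_div_norm)
  moreover have "growth k (phase_at z) (cmod z) * cmod z > 0"
    using growth_pos[OF phase_at_bounds(1)[of z], of "cmod z"] assms by simp
  ultimately show ?thesis by (simp add: F_polar sgn_scaleR)
qed

lemma isCont_sgn_power: "z \<noteq> 0 \<Longrightarrow> isCont (\<lambda>z. sgn z ^ n) z" for z :: complex
  by (intro continuous_intros isCont_sgn) auto

lemma isCont_phase_at: "z \<noteq> 0 \<Longrightarrow> isCont phase_at z"
  unfolding phase_at_def[abs_def] by (intro continuous_intros isCont_Re isCont_sgn_power) auto

lemma isCont_D: "cmod \<omega> \<le> 1 \<Longrightarrow> isCont D \<omega>"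
proof -
  assume w: "cmod \<omega> \<le> 1"
  have "\<bar>Re (\<omega> ^ n)\<bar> \<le> 1" using abs_Re_le_cmod[of "\<omega> ^ n"] w by (simp add: norm_power power_le_one order_trans)
  then have "3 + Re (\<omega> ^ n) \<noteq> 0" by linarith
  then have "isCont (\<lambda>\<omega>. 2 * pi / real n - 4 / real n * arctan (Im (\<omega> ^ n) / (3 + Re (\<omega> ^ n)))) \<omega>"
    using n by (intro continuous_intros isCont_Re isCont_Im) auto
  moreover have "isCont (\<lambda>t. exp (\<i> * complex_of_real t)) u" for u by (intro continuous_intros)
  ultimately have "isCont (\<lambda>\<omega>. exp (\<i> * of_real (2 * pi / real n - 4 / real n * arctan (Im (\<omega> ^ n) / (3 + Re (\<omega> ^ n)))))) \<omega>"
    by (rule isCont_o2)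
  then show ?thesis unfolding D_def[abs_def] cis_conv_exp by (intro continuous_mult continuous_ident)
qed

lemma isCont_F: "isCont (F k n) z"
proof (cases "z = 0")
  case True
  have "((\<lambda>z. k * (cmod z)\<^sup>2 * cmod z) \<longlongrightarrow> k * (cmod 0)\<^sup>2 * cmod 0) (at (0::complex))" by (intro tendsto_intros)
  then have lim: "((\<lambda>z. k * (cmod z)\<^sup>2 * cmod z) \<longlongrightarrow> 0) (at (0::complex))" by simp
  have "cmod (F k n z) \<le> k * (cmod z)\<^sup>2 * cmod z" for z
    unfolding cmod_F using growth_le[OF k phase_at_bounds] by (intro mult_right_mono) auto
  then have "(F k n \<longlongrightarrow> 0) (at 0)" by (intro Lim_null_comparison[OF _ lim]) auto
  then show ?thesis using True by (simp add: isCont_def F_0)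
next
  case False
  have 1: "isCont (\<lambda>z. D (sgn z)) z"
    using False by (intro isCont_o2[of z sgn D] isCont_sgn continuous_ident isCont_D) (auto simp: norm_sgn)
  have 2: "isCont (\<lambda>z. growth k (phase_at z) (cmod z)) z"
    unfolding growth_def using one_plus_sq_pos[of "cmod z"] False
    by (intro continuous_intros isCont_phase_at) auto
  show ?thesis unfolding F_polar[abs_def] by (intro continuous_intros 1 2)
qed

lemma isCont_gauge: "isCont gauge z"
proof (cases "z = 0")
  case True
  have "compact (\<mu> k ` {0..1})" by (intro compact_continuous_image continuous_\<mu> k compact_Icc)
  then have "bounded (\<mu> k ` {0..1})" by (rule compact_imp_bounded)
  then obtain M where "\<forall>y\<in>\<mu> k ` {0..1}. norm y \<le> M" unfolding bounded_iff by blast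
  then have M: "\<bar>\<mu> k x\<bar> \<le> M" if "x \<in> {0..1}" for x using that by auto
  have "((\<lambda>z. M * cmod z) \<longlongrightarrow> M * cmod 0) (at (0::complex))" by (intro tendsto_intros)
  then have lim: "((\<lambda>z. M * cmod z) \<longlongrightarrow> 0) (at (0::complex))" by simp
  have "norm (gauge z) \<le> M * cmod z" for z
    using mult_left_mono[OF M[of "phase_at z"] norm_ge_zero[of z]] phase_at_bounds[of z]
    by (simp add: gauge_def abs_mult mult.commute)
  then have "(gauge \<longlongrightarrow> 0) (at 0)" by (intro Lim_null_comparison[OF _ lim]) auto
  then show ?thesis using True by (simp add: isCont_def gauge_def)
next
  case False
  have "continuous_on (- {0}) (\<lambda>z. \<mu> k (phase_at z))"
    by (rule continuous_on_compose2[OF continuous_\<mu>[OF k]])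
      (use isCont_phase_at phase_at_bounds in \<open>auto intro!: continuous_at_imp_continuous_on\<close>)
  then have "isCont (\<lambda>z. \<mu> k (phase_at z)) z"
    using continuous_on_eq_continuous_at[of "- {0::complex}"] False by auto
  then show ?thesis unfolding gauge_def[abs_def] by (intro continuous_intros)
qed

sublocale gauge_domain gauge
proof
  show "continuous_on UNIV gauge" using isCont_gauge by (simp add: continuous_at_imp_continuous_on)
  show "gauge (t *\<^sub>R z) = t * gauge z" if "0 \<le> t" for t z
    using that by (cases "t = 0") (auto simp: gauge_def phase_at_def sgn_scaleR)
  show "0 \<le> gauge z" for z
    unfolding gauge_def using \<mu>_nonneg[OF k phase_at_bounds] by simp
  have "z ^ n = -1" if z: "cmod z = 1" "gauge z = 0" for z
  proof -
    have "\<mu> k (phase_at z) = 0" using z by (simp add: gauge_def)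
    then have "phase_at z = 0"
      using threshold(1)[OF k, of "phase_at z"] phase_at_bounds[of z] by (cases "phase_at z = 0") auto
    then have re: "Re (z ^ n) = -1" using z(1) by (simp add: phase_at_def sgn_eq)
    have "cmod (z ^ n) = 1" using z(1) by (simp add: norm_power)
    then have "(Re (z ^ n))\<^sup>2 + (Im (z ^ n))\<^sup>2 = 1" using cmod_power2[of "z ^ n"] by simp
    then have "Im (z ^ n) = 0" using re by simp
    then show ?thesis using re by (simp add: complex_eq_iff)
  qed
  then have "{z. cmod z = 1 \<and> gauge z = 0} \<subseteq> {z. z ^ n = -1}" by auto
  then show "finite {z. cmod z = 1 \<and> gauge z = 0}"
    using finite_nth_roots[of n "-1"] n finite_subset by auto
qed

text \<open>Phase and radius of the orbit follow the two-dimensional system.\<close>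

lemma F_iterate:
  assumes "z \<noteq> 0"
  shows "cmod ((F k n ^^ j) z) = rad k j (phase_at z, cmod z) \<and>
    phase_at ((F k n ^^ j) z) = phase k j (phase_at z, cmod z) \<and> (F k n ^^ j) z \<noteq> 0"
proof (induction j)
  case 0
  then show ?case using assms by (simp add: rad_0[OF k] phase_0[OF k])
next
  case (Suc j)
  define y where "y = (F k n ^^ j) z"
  have y0: "y \<noteq> 0" using Suc by (simp add: y_def)
  define \<theta> where "\<theta> = Arg2pi y"
  have y: "y = rcis (cmod y) \<theta>" using polar_Arg2pi[of y] by (simp add: \<theta>_def)
  have py: "phase_at y = phase_of n \<theta>" using phase_at_rcis[of "cmod y" \<theta>] y y0 by simp
  have g: "growth k (phase_of n \<theta>) (cmod y) * cmod y > 0"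
    using growth_pos[OF phase_at_bounds(1)[of y], of "cmod y"] y0 by (simp add: py)
  have "F k n y = rcis (growth k (phase_of n \<theta>) (cmod y) * cmod y) (angle n \<theta>)"
    using F_rcis[of n k "cmod y" \<theta>] n k y by simp
  then have "phase_at (F k n y) = phase_of n (angle n \<theta>)" using phase_at_rcis[OF g] by simp
  then have "phase_at (F k n y) = phase_at y * ((3 + phase_at y) / (1 + 3 * phase_at y))\<^sup>2"
    using phase_of_angle[of n \<theta>] n py by simp
  then show ?case using Suc cmod_F[of y] F_eq_0_iff[of y] y0
    by (simp add: y_def rad_Suc[OF k] phase_Suc[OF k])
qed

lemma basin_eq: "basin (F k n) = U"
proof -
  have "z \<in> basin (F k n) \<longleftrightarrow> z \<in> U" for z
  proof (cases "z = 0")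
    case True
    have "(F k n ^^ j) 0 = 0" for j by (induction j) (auto simp: F_0)
    then show ?thesis using True zero_in_U by (simp add: basin_def)
  next
    case False
    have "z \<in> basin (F k n) \<longleftrightarrow> (\<lambda>j. cmod ((F k n ^^ j) z)) \<longlonglongrightarrow> 0"
      by (simp add: basin_def tendsto_norm_zero_iff)
    also have "\<dots> \<longleftrightarrow> attracted k (phase_at z, cmod z)"
      using F_iterate[OF False] by (simp add: attracted_def[OF k])
    also have "\<dots> \<longleftrightarrow> z \<in> U"
      using attracted_iff_\<mu>[OF k phase_at_bounds, of "cmod z" z] by (simp add: U_def gauge_def)
    finally show ?thesis .
  qed
  then show ?thesis by blast
qed

lemma F_in_U_iff: "F k n z \<in> U \<longleftrightarrow> z \<in> U"
proof -
  have "(F k n ^^ j) (F k n z) = (F k n ^^ (Suc j)) z" for j by (simp add: funpow_swap1)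
  then have "F k n z \<in> basin (F k n) \<longleftrightarrow> z \<in> basin (F k n)"
    unfolding basin_def using filterlim_sequentially_Suc[of "\<lambda>j. (F k n ^^ j) z"] by simp
  then show ?thesis by (simp add: basin_eq)
qed

lemma growth_strict:
  assumes "0 \<le> s" "0 \<le> r" "growth k s r * r = growth k s r' * r'" "0 \<le> r'"
  shows "r = r'"
proof -
  have *: "growth k s a * a < growth k s b * b" if ab: "0 \<le> a" "a < b" for a b
  proof -
    have "growth k s a * a \<le> growth k s b * a"
      using growth_mono[OF k assms(1) order_refl ab(1), of b] ab by (intro mult_right_mono) auto
    also have "\<dots> < growth k s b * b" using growth_pos[OF assms(1), of b] ab by (intro mult_strict_left_mono) auto
    finally show ?thesis .
  qed
  show ?thesis using *[of r r'] *[of r' r] assms by (cases r r' rule: linorder_cases) auto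
qed

lemma inj_F: "inj (F k n)"
proof (rule injI)
  fix x y assume eq: "F k n x = F k n y"
  show "x = y"
  proof (cases "x = 0")
    case True
    then show ?thesis using eq F_eq_0_iff by metis
  next
    case False
    then have y0: "y \<noteq> 0" using eq F_eq_0_iff by metis
    have D: "D (sgn x) = D (sgn y)" using sgn_F[OF False] sgn_F[OF y0] eq by simp
    define a b where "a = Arg2pi x" and "b = Arg2pi y"
    have ab: "sgn x = cis a" "sgn y = cis b"
      using sgn_rcis[of "cmod x" a] sgn_rcis[of "cmod y" b] polar_Arg2pi[of x] polar_Arg2pi[of y] False y0
      by (simp_all add: a_def b_def)
    have "rcis 1 (angle n a) = rcis 1 (angle n b)" using D by (simp add: ab D_cis rcis_def)
    then obtain l :: int where "angle n a = angle n b + 2 * pi * of_int l"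
      using rcis_eq_shift[of 1] by (metis zero_neq_one)
    then have "angle n a = angle n (b + 2 * pi * of_int l)" using angle_2pi(1)[of n b l] n by simp
    then have "a = b + 2 * pi * of_int l"
      using strict_mono_angle[of n] n strict_mono_eq by (metis gr0I not_numeral_le_zero)
    then have sg: "sgn x = sgn y" using ab by (simp add: cis_mult[symmetric] cis_multiple_2pi)
    then have "phase_at x = phase_at y" by (simp add: phase_at_def)
    have "cmod (F k n x) = cmod (F k n y)" using eq by simp
    then have "growth k (phase_at x) (cmod x) * cmod x = growth k (phase_at x) (cmod y) * cmod y"
      unfolding cmod_F \<open>phase_at x = phase_at y\<close> .
    then have "cmod x = cmod y" 
      by (rule growth_strict[OF phase_at_bounds(1) norm_ge_zero _ norm_ge_zero])
    moreover have "cmod z *\<^sub>R sgn z = z" for z :: complex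
      by (cases "z = 0") (simp_all add: sgn_div_norm)
    ultimately show ?thesis using sg by metis
  qed
qed

text \<open>Direction and radius are found one after the other by the intermediate value theorem.\<close>

lemma surj_F: "surj (F k n)"
  unfolding surj_def
proof
  fix w :: complex
  show "\<exists>z. w = F k n z"
  proof (cases "w = 0")
    case True
    then show ?thesis using F_0 by metis
  next
    case False
    have n0: "n > 0" using n by simp
    define b where "b = Arg2pi w"
    have cont: "continuous_on S (angle n)" for S
      using isCont_angle by (auto intro: continuous_at_imp_continuous_on)
    obtain i :: nat where i: "\<bar>b - angle n 0\<bar> < real i" using reals_Archimedean2 by blast
    have p: "real i \<le> 2 * pi * real i" using pi_gt3 by (simp add: mult_le_cancel_right1)
    have "angle n (2 * pi * real i) = angle n 0 + 2 * pi * real i" "angle n (- (2 * pi * real i)) = angle n 0 - 2 * pi * real i"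
      using angle_2pi(1)[OF n0, of 0 "int i"] angle_2pi(1)[OF n0, of 0 "- int i"] by simp_all
    then have "angle n (- (2 * pi * real i)) \<le> b" "b \<le> angle n (2 * pi * real i)" using i p by auto
    moreover have "- (2 * pi * real i) \<le> 2 * pi * real i" using pi_gt_zero by simp
    ultimately obtain a where a: "angle n a = b" using IVT'[of "angle n" _ b] cont by blast
    define s where "s = phase_of n a"
    have s: "0 \<le> s" unfolding s_def phase_of_def using cos_ge_minus_one[of "real n * a"]
      by (intro divide_nonneg_nonneg) linarith+
    have contg: "continuous_on S (\<lambda>r. growth k s r * r)" for S
      unfolding growth_def using one_plus_sq_pos by (intro continuous_intros) (auto simp: less_imp_neq[symmetric])
    define R where "R = 1 + 4 / k * cmod w"
    have R: "R \<ge> 1" using k by (simp add: R_def)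
    have "cmod w \<le> k / 4 * R" using k by (simp add: R_def distrib_left)
    also have "\<dots> \<le> growth k s R * R" using growth_ge[OF k s R] R by (intro mult_right_mono) auto
    finally have "cmod w \<le> growth k s R * R" .
    moreover have "growth k s 0 * 0 \<le> cmod w" by simp
    ultimately obtain r where r: "0 \<le> r" "growth k s r * r = cmod w"
      using IVT'[of "\<lambda>r. growth k s r * r" 0 "cmod w" R] contg R by auto
    have "F k n (rcis r a) = rcis (cmod w) b" using F_rcis[of n k r a] n k r a by (simp add: s_def)
    then show ?thesis using polar_Arg2pi[of w] unfolding b_def by metis
  qed
qed

lemma F_image_U: "F k n ` U = U"
proof
  show "F k n ` U \<subseteq> U" using F_in_U_iff by blast
  show "U \<subseteq> F k n ` U"
  proof
    fix w assume w: "w \<in> U"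
    obtain z where "w = F k n z" using surj_F by (rule surjE)
    then show "w \<in> F k n ` U" using w F_in_U_iff[of z] by blast
  qed
qed

section \<open>The map on the sphere\<close>

text \<open>The extension of \<open>F k n\<close> to the sphere that fixes the pole; \<open>sphere_map\<close> has an arbitrary value there.\<close>

definition fhat :: "complex \<times> real \<Rightarrow> complex \<times> real" where
  "fhat p = (if p = (0, 1) then (0, 1) else sphere_map (F k n) p)"

lemma fhat_to_sphere: "fhat (to_sphere z) = to_sphere (F k n z)"
proof -
  have "to_sphere z \<noteq> (0, 1)" using snd_to_sphere_less[of z] by auto
  then show ?thesis by (simp add: fhat_def sphere_map_def inv_f_f[OF inj_to_sphere])
qed

lemma inv_to_sphere:
  assumes "p \<in> range to_sphere"
  shows "inv to_sphere p = (1 / (1 - snd p)) *\<^sub>R fst p"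
proof -
  obtain z where z: "p = to_sphere z" using assms by blast
  have pos: "(cmod z)\<^sup>2 + 1 \<noteq> 0" using zero_le_power2[of "cmod z"] by linarith
  have "1 - snd p = 2 / (1 + (cmod z)\<^sup>2)" using pos by (simp add: z to_sphere_def field_simps)
  moreover have "fst p = (2 / (1 + (cmod z)\<^sup>2)) *\<^sub>R z" by (simp add: z to_sphere_def)
  moreover have "1 / (2 / (1 + (cmod z)\<^sup>2)) * (2 / (1 + (cmod z)\<^sup>2)) = 1"
    using pos by (simp add: add.commute)
  ultimately have "(1 / (1 - snd p)) *\<^sub>R fst p = z" by (simp only: scaleR_scaleR scaleR_one)
  moreover have "inv to_sphere p = z" unfolding z by (rule inv_f_f[OF inj_to_sphere])
  ultimately show ?thesis by simp
qed

text \<open>Continuity at the pole holds because \<open>cmod (F k n z)\<close> is at least \<open>k / 4 * cmod z\<close> for \<open>cmod z \<ge> 1\<close>.\<close>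

lemma continuous_fhat: "continuous_on (insert (0, 1) (range to_sphere)) fhat"
  unfolding continuous_on_eq_continuous_within
proof
  fix p assume p: "p \<in> insert (0, 1) (range to_sphere)"
  let ?S = "insert (0, 1) (range to_sphere)"
  show "continuous (at p within ?S) fhat"
  proof (cases "p = (0, 1)")
    case False
    then have pr: "p \<in> range to_sphere" using p by blast
    then have sp: "snd p < 1" using snd_to_sphere_less by blast
    define g where "g p = to_sphere (F k n ((1 / (1 - snd p)) *\<^sub>R fst p))" for p :: "complex \<times> real"
    have "isCont (\<lambda>p. (1 / (1 - snd p)) *\<^sub>R fst p) p" using sp by (intro continuous_intros) auto
    moreover have "isCont to_sphere z" for z
      using to_sphere_continuous[of UNIV] by (simp add: continuous_on_eq_continuous_at)
    ultimately have "isCont g p" unfolding g_def using isCont_F by (intro isCont_o2[of p _ to_sphere] isCont_o2[of p _ "F k n"])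
    then have "continuous (at p within ?S) g" by (rule continuous_at_imp_continuous_at_within)
    moreover have "g x = fhat x" if x: "x \<in> ?S" "dist x p < dist p (0, 1)" for x
    proof -
      have "x \<noteq> (0, 1)" using x by (auto simp: dist_commute)
      then obtain z where z: "x = to_sphere z" using x(1) by blast
      then show ?thesis using inv_to_sphere[of x] inv_f_f[OF inj_to_sphere, of z]
        by (simp add: g_def fhat_to_sphere)
    qed
    ultimately show ?thesis
      using continuous_transform_within[of p ?S g "dist p (0, 1)" fhat] p False by auto
  next
    case True
    show ?thesis unfolding continuous_within_eps_delta
    proof (intro allI impI)
      fix e :: real assume e: "e > 0"
      \<comment> \<open>If \<open>cmod z > L\<close>, then \<open>to_sphere (F k n z)\<close> is within \<open>16 / (k * L) < e\<close> of the pole.\<close>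
      define L where "L = 1 + 32 / (k * e)"
      have L: "L \<ge> 1" using e k by (simp add: L_def)
      have "dist (fhat x) (fhat p) < e" if x: "x \<in> ?S" "dist x p < 2 / (1 + L\<^sup>2)" for x
      proof (cases "x = p")
        case False
        then obtain z where z: "x = to_sphere z" using x(1) True by blast
        have "dist (snd x) (snd p) < 2 / (1 + L\<^sup>2)" using dist_snd_le[of x p] x(2) by linarith
        moreover have "snd x = 1 - 2 / (1 + (cmod z)\<^sup>2)"
          using one_plus_sq_pos[of "cmod z"] by (simp add: z to_sphere_def field_simps)
        ultimately have "2 / (1 + (cmod z)\<^sup>2) < 2 / (1 + L\<^sup>2)"
          using True one_plus_sq_pos[of "cmod z"] by (simp add: dist_real_def)
        then have "L\<^sup>2 < (cmod z)\<^sup>2"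
          using one_plus_sq_pos[of "cmod z"] one_plus_sq_pos[of L] by (simp add: divide_simps)
        then have zL: "L < cmod z" by (rule power2_less_imp_less) simp
        have "k / 4 * L \<le> growth k (phase_at z) (cmod z) * cmod z"
          using growth_ge[OF k phase_at_bounds(1), of "cmod z" z] zL L k by (intro mult_mono) auto
        then have F: "k / 4 * L \<le> cmod (F k n z)" by (simp add: cmod_F)
        have kL: "k / 4 * L > 0" using k L by simp
        then have "F k n z \<noteq> 0" using F by auto
        then have "dist (fhat x) (fhat p) \<le> 4 / cmod (F k n z)"
          using dist_to_sphere_pole True by (simp add: z fhat_to_sphere) (simp add: fhat_def)
        also have "\<dots> \<le> 4 / (k / 4 * L)" using F kL \<open>F k n z \<noteq> 0\<close> k L
          by (intro divide_left_mono mult_pos_pos[of "cmod (F k n z)" "k / 4 * L"]) simp_all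
        also have "\<dots> < e"
        proof -
          have "k * L * e = k * e + 32" using k e by (simp add: L_def field_simps)
          then have "16 < k * L * e" using k e by (simp add: add_pos_pos)
          then show ?thesis using k L by (simp add: divide_simps mult_ac)
        qed
        finally show ?thesis .
      qed (use e in simp)
      then show "\<exists>d>0. \<forall>x\<in>?S. dist x p < d \<longrightarrow> dist (fhat x) (fhat p) < e"
        using one_plus_sq_pos[of L] by (intro exI[of _ "2 / (1 + L\<^sup>2)"]) auto
    qed
  qed
qed

lemma inj_fhat: "inj_on fhat (insert (0, 1) (range to_sphere))"
proof -
  have ne: "fhat (to_sphere z) \<noteq> (0, 1)" for z
    using snd_to_sphere_less[of "F k n z"] unfolding fhat_to_sphere by auto
  have inj: "inj_on fhat (range to_sphere)"
  proof (rule inj_onI)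
    fix x y assume "x \<in> range to_sphere" "y \<in> range to_sphere" and eq: "fhat x = fhat y"
    then obtain u v where uv: "x = to_sphere u" "y = to_sphere v" by blast
    have "F k n u = F k n v" using eq unfolding uv fhat_to_sphere by (rule injD[OF inj_to_sphere])
    then show "x = y" using injD[OF inj_F] uv by blast
  qed
  have "fhat (0, 1) \<notin> fhat ` (range to_sphere - {(0, 1)})"
  proof
    assume "fhat (0, 1) \<in> fhat ` (range to_sphere - {(0, 1)})"
    then obtain z where "fhat (0, 1) = fhat (to_sphere z)" by blast
    then show False using ne[of z] by (simp add: fhat_def[of "(0, 1)"])
  qed
  then show ?thesis using inj by simp
qed

abbreviation "V \<equiv> to_sphere ` U"

lemma fhat_V: "fhat ` V = V"
proof -
  have "fhat ` V = to_sphere ` F k n ` U" by (simp add: image_image fhat_to_sphere)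
  then show ?thesis by (simp add: F_image_U)
qed

lemma closure_V: "closure V \<subseteq> insert (0, 1) (range to_sphere)"
  unfolding closure_eq by (auto simp: P_def)

lemma ex_closure_homeo: "\<exists>g. closure_homeo V fhat g"
proof -
  have comp: "compact (closure V)" unfolding closure_eq by (rule compact_image)
  have cont: "continuous_on (closure V) fhat" by (rule continuous_on_subset[OF continuous_fhat closure_V])
  have "fhat ` closure V \<subseteq> closure V"
    using fhat_V closure_subset[of V] by (intro image_closure_subset[OF cont]) auto
  moreover have "closure V \<subseteq> fhat ` closure V"
  proof (rule closure_minimal)
    show "V \<subseteq> fhat ` closure V" using fhat_V image_mono[OF closure_subset[of V], of fhat] by simp
    show "closed (fhat ` closure V)" by (intro compact_imp_closed compact_continuous_image cont comp)
  qed
  ultimately have im: "fhat ` closure V = closure V" by blast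
  obtain g where "homeomorphism (closure V) (closure V) fhat g"
    using homeomorphism_compact[OF comp cont im inj_on_subset[OF inj_fhat closure_V]] by blast
  then have "closure_homeo V fhat g" using comp fhat_V by unfold_locales
  then show ?thesis by blast
qed

lemma scaled_directions:
  assumes "w \<in> ball 0 1" "w \<noteq> 0"
  shows "sgn (psi (F k n (B w))) = D (sgn w)"
proof -
  have "cmod w + gauge w - (cmod w)\<^sup>2 > 0" using denominator_pos[of w] assms by simp
  then have B: "sgn (B w) = sgn w" "B w \<noteq> 0" using assms by (auto simp: B_def sgn_scaleR sgn_one)
  have F0: "F k n (B w) \<noteq> 0" using B F_eq_0_iff by simp
  have "cmod z + gauge z > 0" "1 + cmod z > 0" if "z \<noteq> 0" for z
    using that nonneg[of z] by (auto intro: add_pos_nonneg add_pos_pos)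
  then have "sgn (psi z) = sgn z" if "z \<noteq> 0" for z using that by (simp add: psi_def sgn_scaleR)
  then show ?thesis using F0 sgn_F[OF B(2)] B(1) by simp
qed

text \<open>In the coordinates of the disk the map acts on directions by \<open>D\<close>, and it preserves the limit \<open>1\<close> of the
  modulus at the boundary since it is a homeomorphism of the open disk.\<close>

lemma boundary_map:
  assumes w: "cmod \<omega> = 1"
  shows "prime_end_map fhat (end_at \<omega>) = end_at (D \<omega>)"
proof -
  obtain g where g: "closure_homeo V fhat g" using ex_closure_homeo by blast
  interpret closure_homeo V fhat g by (rule g)
  define T where "T = q \<circ> (fhat \<circ> P)"
  have PB: "P x = to_sphere (B x)" if "x \<in> ball 0 1" for x using that by (simp add: P_def)
  have FU: "F k n (B x) \<in> U" if "x \<in> ball 0 1" for x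
    using that homeomorphism_B F_in_U_iff by (auto simp: homeomorphism_def)
  have T: "T x = psi (F k n (B x))" if "x \<in> ball 0 1" for x
    using PB[OF that] FU[OF that] by (simp add: T_def fhat_to_sphere q_to_sphere)
  have "homeomorphism V V fhat g"
    using homeomorphism_of_subsets[OF hom closure_subset closure_subset fhat_V] .
  then have homT: "homeomorphism (ball 0 1) (ball 0 1) T ((q \<circ> g) \<circ> P)"
    unfolding T_def using homeomorphism_compose[OF homeomorphism_compose[OF homeo] homeomorphism_symD[OF homeo]]
    by blast
  have "((\<lambda>x. cmod (T x)) \<longlongrightarrow> 1) (at \<omega> within ball 0 1)"
  proof (rule tendstoI)
    fix e :: real assume "e > 0"
    then obtain d where d: "d > 0" "\<And>z. cmod z < 1 \<Longrightarrow> cmod z > 1 - d \<Longrightarrow> cmod (T z) > 1 - e"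
      using tendsto_bdry_of_homeomorphism_disk[OF homT] by blast
    have "dist (cmod (T x)) 1 < e" if x: "x \<in> ball 0 1" "dist x \<omega> < d" for x
    proof -
      have "cmod x > 1 - d" using x(2) w norm_triangle_ineq2[of \<omega> x] by (simp add: dist_norm norm_minus_commute)
      then have "cmod (T x) > 1 - e" using d(2) x(1) by simp
      moreover have "T x \<in> ball 0 1" using homT x(1) by (auto simp: homeomorphism_def)
      ultimately show ?thesis by (simp add: dist_real_def)
    qed
    then show "\<forall>\<^sub>F x in at \<omega> within ball 0 1. dist (cmod (T x)) 1 < e"
      unfolding eventually_at using d(1) by blast
  qed
  moreover have "((\<lambda>x. D (sgn x)) \<longlongrightarrow> D (sgn \<omega>)) (at \<omega> within ball 0 1)"
  proof -
    have "\<omega> \<noteq> 0" using w by auto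
    then have "isCont (\<lambda>x. D (sgn x)) \<omega>"
      by (intro isCont_o2[of \<omega> sgn D] isCont_sgn continuous_ident isCont_D) (auto simp: norm_sgn)
    then show ?thesis unfolding isCont_def by (meson tendsto_within_subset subset_UNIV)
  qed
  ultimately have "((\<lambda>x. cmod (T x) *\<^sub>R D (sgn x)) \<longlongrightarrow> 1 *\<^sub>R D (sgn \<omega>)) (at \<omega> within ball 0 1)"
    by (rule tendsto_scaleR)
  moreover have "sgn \<omega> = \<omega>" using w by (simp add: sgn_eq)
  ultimately have "((\<lambda>x. cmod (T x) *\<^sub>R D (sgn x)) \<longlongrightarrow> D \<omega>) (at \<omega> within ball 0 1)" by simp
  moreover have "\<forall>\<^sub>F x in at \<omega> within ball 0 1. cmod (T x) *\<^sub>R D (sgn x) = T x"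
  proof -
    have "\<forall>\<^sub>F x in at \<omega> within ball 0 1. x \<in> - {0}"
      using w by (intro eventually_at_in_open'[THEN filter_leD[OF at_le[OF subset_UNIV]]]) auto
    moreover have "\<forall>\<^sub>F x in at \<omega> within ball 0 1. x \<in> ball 0 1" by (simp add: eventually_at_filter)
    ultimately show ?thesis
    proof eventually_elim
      case (elim x)
      then have "D (sgn x) = sgn (T x)" using scaled_directions[of x] T[of x] by simp
      then show ?case by (cases "T x = 0") (simp_all add: sgn_div_norm)
    qed
  qed
  ultimately have lim: "(T \<longlongrightarrow> D \<omega>) (at \<omega> within ball 0 1)"
    by (rule Lim_transform_eventually)
  have "T z \<in> ball 0 1 \<and> P (T z) = fhat (P z)" if z: "z \<in> ball 0 1" for z
  proof -
    have "P z \<in> V" using homeo z by (auto simp: homeomorphism_def)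
    then have "fhat (P z) \<in> V" using fhat_V by blast
    then show ?thesis using q(1,2) by (simp add: T_def)
  qed
  then show ?thesis using prime_end_map_end_at(1)[OF g w _ lim] by blast
qed

section \<open>The rotation number\<close>

lemma gauge_rotation: "gauge (cis (2 * pi / real n) * z) = gauge z"
proof -
  have "cis (2 * pi / real n) ^ n = 1" using n by (simp add: Complex.DeMoivre)
  then have "phase_at (cis (2 * pi / real n) * z) = phase_at z"
    by (simp add: phase_at_def sgn_mult power_mult_distrib sgn_div_norm[of "cis (2 * pi / real n)"])
  then show ?thesis by (simp add: gauge_def norm_mult)
qed

lemma B_rotation: "B (cis (2 * pi / real n) * w) = cis (2 * pi / real n) * B w"
  by (simp add: B_def gauge_rotation norm_mult)

text \<open>The homeomorphism \<open>K\<close> commutes with the rotation because the normalized Riemann map and the coordinates \<open>B\<close>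
  do.\<close>

theorem rotation_number: "has_rotation_number (F k n) (1 / real n)"
proof -
  define c where "c = cis (2 * pi / real n)"
  have n0: "n > 0" using n by simp
  have "U \<noteq> UNIV"
  proof -
    obtain z where "cmod z = 1" "gauge z \<noteq> 0" using exists_regular_direction[of UNIV 1] by auto
    then have "gauge (B z) = 1" by (rule m_B)
    then have "B z \<notin> U" by (simp add: U_def)
    then show ?thesis by blast
  qed
  then obtain \<phi> f where phi: "\<phi> holomorphic_on U" "f holomorphic_on ball 0 1"
    "\<And>z. z \<in> U \<Longrightarrow> \<phi> z \<in> ball 0 1 \<and> f (\<phi> z) = z" "\<And>w. w \<in> ball 0 1 \<Longrightarrow> f w \<in> U \<and> \<phi> (f w) = w" "\<phi> 0 = 0"
    using Riemann_map_normalized[OF open_U starlike_U _ zero_in_U] by blast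
  interpret gauge_riemann gauge \<phi> f by unfold_locales (use phi in auto)
  obtain K L where K: "homeomorphism (cball 0 1) (cball 0 1) K L" "\<And>w. w \<in> ball 0 1 \<Longrightarrow> K w = \<phi> (B w)"
    "K ` sphere 0 1 = sphere 0 1"
    using extends_to_circle by metis
  have contK: "continuous_on (cball 0 1) K" and LK: "\<And>w. w \<in> cball 0 1 \<Longrightarrow> L (K w) = w"
    using K(1) by (auto simp: homeomorphism_def)
  have sub: "sphere 0 1 \<subseteq> cball (0::complex) 1" by auto
  have c1: "cmod c = 1" by (simp add: c_def)
  have cU: "c * z \<in> U \<longleftrightarrow> z \<in> U" for z by (simp add: U_def c_def gauge_rotation)
  have eq_ball: "K (c * w) = c * K w" if w: "w \<in> ball 0 1" for w
  proof -
    have "c * w \<in> ball 0 1" using w c1 by (simp add: norm_mult)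
    then show ?thesis
      using K(2) w B_rotation[of w] B_in_U[OF w]
        Riemann_map_rotation[OF open_U zero_in_U c1 cU phi, of "B w"] by (simp add: c_def)
  qed
  have eqv: "K (c * \<omega>) = c * K \<omega>" if w: "cmod \<omega> = 1" for \<omega>
  proof -
    have "continuous_on (cball 0 1) (\<lambda>w. K (c * w))"
      by (rule continuous_on_compose2[OF contK]) (use c1 in \<open>auto simp: norm_mult intro!: continuous_intros\<close>)
    then have "continuous_on (closure (ball 0 1)) (\<lambda>w. K (c * w) - c * K w)"
      using contK by (auto intro!: continuous_intros)
    from continuous_constant_on_closure[OF this, of 0 \<omega>]
    have "K (c * \<omega>) - c * K \<omega> = 0" using eq_ball w by simp
    then show ?thesis by simp
  qed
  define A where "A t = angle n (2 * pi * t) / (2 * pi)" for t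
  have rot: "has_poincare_rotation_number (K \<circ> D \<circ> L) (1 / real n)"
  proof (rule rotation_number_conjugate[OF n0, of K L A])
    show "continuous_on (sphere 0 1) K" using contK sub continuous_on_subset by blast
    show "inj_on K (sphere 0 1)" using LK by (intro inj_on_inverseI[of _ L]) auto
    show "K ` sphere 0 1 = sphere 0 1" by (rule K(3))
    show "L (K \<omega>) = \<omega>" if "cmod \<omega> = 1" for \<omega> using LK that by simp
    show "K (cis (2 * pi / real n) * \<omega>) = cis (2 * pi / real n) * K \<omega>" if "cmod \<omega> = 1" for \<omega>
      using eqv[OF that] by (simp add: c_def)
    have "continuous_on UNIV (\<lambda>t. angle n (2 * pi * t))"
      by (rule continuous_on_compose2[of UNIV "angle n"])
        (auto intro!: continuous_intros continuous_at_imp_continuous_on isCont_angle)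
    then show "continuous_on UNIV A" unfolding A_def by (intro continuous_intros) auto
    show "strict_mono A" unfolding A_def
      using strict_mono_angle[OF n0] by (auto intro!: strict_monoI divide_strict_right_mono simp: strict_mono_less)
    show "A (t + 1) = A t + 1" for t
      using angle_2pi(1)[OF n0, of "2 * pi * t" 1] by (simp add: A_def distrib_left add_divide_distrib)
    show "D (cis (2 * pi * t)) = cis (2 * pi * A t)" for t by (simp add: D_cis A_def)
    show "A (real j / real n) = real (Suc j) / real n" for j
    proof -
      have "angle n (2 * pi * (real j / real n)) = angle n 0 + 2 * pi * real j / real n"
        using angle_shift(1)[OF n0, of 0 "int j"] by simp
      also have "angle n 0 = 2 * pi / real n" by (simp add: angle_def)
      finally show ?thesis by (simp add: A_def add_divide_distrib)
    qed
  qed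
  have Psub: "N j \<subseteq> V" if N: "N \<in> fundamental_chains V" for N j
  proof -
    obtain A where "crosscut_nbhd V A (N j)" using N unfolding fundamental_chains_def by blast
    then show ?thesis by (rule preimage_component(3))
  qed
  have ends: "prime_end_map (sphere_map (F k n)) (end_at \<omega>) = end_at (D \<omega>)" if w: "cmod \<omega> = 1" for \<omega>
  proof -
    have "sphere_map (F k n) ` S = fhat ` S" if S: "S \<subseteq> V" for S
    proof (intro image_cong refl)
      fix p assume "p \<in> S"
      then obtain z where "p = to_sphere z" using S by blast
      then have "p \<noteq> (0, 1)" using snd_to_sphere_less[of z] by auto
      then show "sphere_map (F k n) p = fhat p" by (simp add: fhat_def)
    qed
    then have "prime_end_map (sphere_map (F k n)) (end_at \<omega>) = prime_end_map fhat (end_at \<omega>)"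
      unfolding prime_end_map_def using Psub by (intro image_cong) (auto simp: end_at_def)
    then show ?thesis using boundary_map[OF w] by simp
  qed
  have D1: "cmod (D \<omega>) = 1" if "cmod \<omega> = 1" for \<omega> using cmod_D that by simp
  have "prime_end_map (sphere_map (F k n)) E \<in> prime_ends V \<and>
      (K \<circ> D \<circ> L) ((K \<circ> disk_coordinate) (Inr E)) = (K \<circ> disk_coordinate) (Inr (prime_end_map (sphere_map (F k n)) E))"
    if E: "E \<in> prime_ends V" for E
  proof -
    obtain \<omega> where w: "cmod \<omega> = 1" "E = end_at \<omega>" using prime_endE[OF E] .
    have "end_at (D \<omega>) \<in> prime_ends V" using bij_betwE[OF bij_betw_end_at] D1[OF w(1)] by simp
    then show ?thesis using w ends[OF w(1)] D1[OF w(1)] LK[of \<omega>] by (simp add: disk_coordinate_Inr)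
  qed
  then show ?thesis
    unfolding has_rotation_number_def Let_def basin_eq
    using uniformization[OF K(1,2)] rot by (intro exI[of _ "K \<circ> disk_coordinate"] exI[of _ "K \<circ> D \<circ> L"]) blast
qed

end

theorem proposition4p2:
  fixes k :: real and n :: nat
  assumes "1 < k" and "k < 2 / sqrt 3" and "n \<ge> 2"
  shows "has_rotation_number (F k n) (1 / real n)"
proof -
  have "2 / sqrt 3 < 2" by (simp add: divide_less_eq)
  then interpret szlenk k n by unfold_locales (use assms in auto)
  show ?thesis by (rule rotation_number)
qed

end
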